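(* Let $D$ be a real composition division algebra of dimension $d\in\{2,4,8\}$, let $E_D\to\mathbb{RP}^d$ be its coordinate-deletion bundle (defined in the context), let $\gamma$ be the tautological real line bundle on $\mathbb{RP}^d$, and let $\eta=[\gamma]-1\in\widetilde{KO}(\mathbb{RP}^d)$. Then $$[E_D]-d=d\,\eta\in\widetilde{KO}(\mathbb{RP}^d).$$ Equivalently, $[E_D]-d=[\gamma^{\oplus d}]-d$. Thus $E_D$ and $\gamma^{\oplus d}$ are stably isomorphic.
   Context: $D$ is a finite-dimensional unital (not necessarily associative) real composition division algebra with multiplicative quadratic norm $N:D\to\mathbb R$, $N(uv)=N(u)N(v)$, $N(1)=1$, whose polar form $\langle u,v\rangle=\frac12(N(u+v)-N(u)-N(v))$ is positive definite, and $d=\dim_{\mathbb R}D\in\{2,4,8\}$; thus $D\cong\mathbb C,\mathbb H$ or $\mathbb O$. Fix an ordered orthonormal basis $(e_0,\dots,e_{d-1})$ of $D$. For $u\in D$, $L_u(v)=uv$ and $M(u)\in M_d(\mathbb R)$ is the matrix of $L_u$ in this basis. On $\mathbb{RP}^d=\{[\alpha_0:\cdots:\alpha_d]\}$ let $U_i=\{\alpha_i\neq0\}$ ($i=0,\dots,d$), let $\sigma_i:\{0,\dots,d-1\}\to\{0,\dots,d\}\setminus\{i\}$ be the increasing bijection, define $q_i:U_i\to D$ by $q_i([\alpha])=\sum_{r=0}^{d-1}\frac{\alpha_{\sigma_i(r)}}{\alpha_i}e_r$, and put $M_i(p)=M(q_i(p))$. The bundle $E_D\to\mathbb{RP}^d$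 is the rank-$d$ real vector bundle obtained by gluing the $U_i\times\mathbb R^d$ via the transition functions $g_{ij}=M_iM_j^{-1}:U_i\cap U_j\to\mathrm{GL}_d(\mathbb R)$ for $i\ne j$ (and $g_{ii}=I_d$), with the convention that local representatives of a vector satisfy $w_i=g_{ij}w_j$. Stably isomorphic means isomorphic after adding a trivial bundle $\varepsilon^r$, for some $r\ge0$, to both. *)

theory Defs
  imports
    "HOL-Analysis.Analysis"
    "HOL-Algebra.Elementary_Groups"
    "Jordan_Normal_Form.Gauss_Jordan_Elimination"
    "Jordan_Normal_Form.Determinant"
begin

section \<open>Composition division algebras\<close>

definition polar :: "('a::real_vector \<Rightarrow> real) \<Rightarrow> 'a \<Rightarrow> 'a \<Rightarrow> real" where
  "polar N u v = (N (u + v) - N u - N v) / 2"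

locale composition_division_algebra =
  fixes mul :: "'a::real_vector \<Rightarrow> 'a \<Rightarrow> 'a"
    and unt :: 'a
    and N :: "'a \<Rightarrow> real"
  assumes finite_dimensional: "\<exists>B::'a set. finite B \<and> span B = UNIV"
    and bilinear_mul: "bilinear mul"
    and left_unit: "mul unt u = u"
    and right_unit: "mul u unt = u"
    and left_division: "a \<noteq> 0 \<Longrightarrow> \<exists>!x. mul a x = b"
    and right_division: "a \<noteq> 0 \<Longrightarrow> \<exists>!x. mul x a = b"
    and norm_scale: "N (c *\<^sub>R u) = c\<^sup>2 * N u"
    and bilinear_polar: "bilinear (polar N)"
    and norm_mult: "N (mul u v) = N u * N v"
    and norm_unit: "N unt = 1"
    and polar_pos: "u \<noteq> 0 \<Longrightarrow> polar N u u > 0"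

definition orthonormal_basis :: "('a::real_vector \<Rightarrow> real) \<Rightarrow> nat \<Rightarrow> (nat \<Rightarrow> 'a) \<Rightarrow> bool" where
  "orthonormal_basis N d e \<longleftrightarrow>
     (\<forall>r<d. \<forall>s<d. polar N (e r) (e s) = (if r = s then 1 else 0)) \<and> span (e ` {..<d}) = UNIV"

definition left_mult_mat :: "('a::real_vector \<Rightarrow> 'a \<Rightarrow> 'a) \<Rightarrow> (nat \<Rightarrow> 'a) \<Rightarrow> nat \<Rightarrow> 'a \<Rightarrow> real mat" where
  "left_mult_mat mul e d u =
     mat d d (\<lambda>(r, s). representation (e ` {..<d}) (mul u (e s)) (e r))"


section \<open>Real vector bundles\<close>

text \<open>The finest topology on \<open>f ` topspace X\<close> making \<open>f\<close> continuous.\<close>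

definition quotient_topology :: "'a topology \<Rightarrow> ('a \<Rightarrow> 'b) \<Rightarrow> 'b topology" where
  "quotient_topology X f =
     topology (\<lambda>V. V \<subseteq> f ` topspace X \<and> openin X {x \<in> topspace X. f x \<in> V})"

lemma openin_quotient_topology:
  "openin (quotient_topology X f) V \<longleftrightarrow>
     V \<subseteq> f ` topspace X \<and> openin X {x \<in> topspace X. f x \<in> V}"
proof -
  have "istopology (\<lambda>V. V \<subseteq> f ` topspace X \<and> openin X {x \<in> topspace X. f x \<in> V})"
  proof -
    have "openin X {x \<in> topspace X. f x \<in> S \<inter> T}"
      if "openin X {x \<in> topspace X. f x \<in> S}" "openin X {x \<in> topspace X. f x \<in> T}" for S T
    proof -
      have "{x \<in> topspace X. f x \<in> S \<inter> T} =
            {x \<in> topspace X. f x \<in> S} \<inter> {x \<in> topspace X. f x \<in> T}" by auto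
      then show ?thesis using that by auto
    qed
    moreover have "openin X {x \<in> topspace X. f x \<in> \<Union>\<K>}"
      if "\<And>K. K \<in> \<K> \<Longrightarrow> openin X {x \<in> topspace X. f x \<in> K}" for \<K>
    proof -
      have "{x \<in> topspace X. f x \<in> \<Union>\<K>} = (\<Union>K\<in>\<K>. {x \<in> topspace X. f x \<in> K})" by auto
      then show ?thesis using that by auto
    qed
    ultimately show ?thesis
      unfolding istopology_def by blast
  qed
  then show ?thesis
    by (simp add: quotient_topology_def topology_inverse')
qed

lemma topspace_quotient_topology [simp]: "topspace (quotient_topology X f) = f ` topspace X"
proof
  show "topspace (quotient_topology X f) \<subseteq> f ` topspace X"
    using openin_quotient_topology[of X f "topspace (quotient_topology X f)"] by simp
  have "{x \<in> topspace X. f x \<in> f ` topspace X} = topspace X" by auto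
  then have "openin (quotient_topology X f) (f ` topspace X)"
    by (simp add: openin_quotient_topology)
  then show "f ` topspace X \<subseteq> topspace (quotient_topology X f)"
    by (rule openin_subset)
qed

lemma quotient_map_quotient_topology: "quotient_map X (quotient_topology X f) f"
  by (auto simp: quotient_map_def openin_quotient_topology)

text \<open>
  Here \<open>\<real>\<^sup>n\<close> is \<^term>\<open>Euclidean_space n\<close>, whose points are the functions \<open>nat \<Rightarrow> real\<close> vanishing
  from \<open>n\<close> on. In a bundle, \<open>fib_add\<close> is only meaningful for two vectors in the same fibre.
\<close>

record ('b, 'e) vbundle =
  tot :: "'e topology"
  proj :: "'e \<Rightarrow> 'b"
  fib_add :: "'e \<Rightarrow> 'e \<Rightarrow> 'e"
  fib_scale :: "real \<Rightarrow> 'e \<Rightarrow> 'e"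

definition fibre :: "('b, 'e) vbundle \<Rightarrow> 'b \<Rightarrow> 'e set" where
  "fibre E x = {v \<in> topspace (tot E). proj E v = x}"

definition bundle_iso :: "('b, 'e) vbundle \<Rightarrow> ('b, 'f) vbundle \<Rightarrow> bool" where
  "bundle_iso E F \<longleftrightarrow>
     (\<exists>f. homeomorphic_map (tot E) (tot F) f \<and>
          (\<forall>v \<in> topspace (tot E). proj F (f v) = proj E v) \<and>
          (\<forall>x. \<forall>v \<in> fibre E x. \<forall>w \<in> fibre E x.
             f (fib_add E v w) = fib_add F (f v) (f w)) \<and>
          (\<forall>c. \<forall>v \<in> topspace (tot E). f (fib_scale E c v) = fib_scale F c (f v)))"

definition trivial_bundle :: "'b topology \<Rightarrow> nat \<Rightarrow> ('b, 'b \<times> (nat \<Rightarrow> real)) vbundle" where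
  "trivial_bundle X n =
     \<lparr>tot = prod_topology X (Euclidean_space n),
      proj = fst,
      fib_add = (\<lambda>(x, v) (y, w). (x, \<lambda>i. v i + w i)),
      fib_scale = (\<lambda>c (x, v). (x, \<lambda>i. c * v i))\<rparr>"

definition restrict_bundle :: "('b, 'e) vbundle \<Rightarrow> 'b set \<Rightarrow> ('b, 'e) vbundle" where
  "restrict_bundle E U = E\<lparr>tot := subtopology (tot E) {v. proj E v \<in> U}\<rparr>"

text \<open>
  The vector space axioms in the fibres follow from local triviality. The rank may differ
  between the components of \<open>X\<close>.
\<close>

definition vector_bundle :: "'b topology \<Rightarrow> ('b, 'e) vbundle \<Rightarrow> bool" where
  "vector_bundle X E \<longleftrightarrow>
     continuous_map (tot E) X (proj E) \<and>
     (\<forall>x. \<forall>v \<in> fibre E x. \<forall>w \<in> fibre E x. fib_add E v w \<in> fibre E x) \<and>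
     (\<forall>c x. \<forall>v \<in> fibre E x. fib_scale E c v \<in> fibre E x) \<and>
     (\<forall>x \<in> topspace X. \<exists>U n. openin X U \<and> x \<in> U \<and>
        bundle_iso (restrict_bundle E U) (trivial_bundle (subtopology X U) n))"

definition bundle_rank :: "('b, 'e) vbundle \<Rightarrow> 'b \<Rightarrow> nat" where
  "bundle_rank E x = (THE n. \<exists>h. bij_betw h (fibre E x) (topspace (Euclidean_space n)) \<and>
     (\<forall>v \<in> fibre E x. \<forall>w \<in> fibre E x. h (fib_add E v w) = (\<lambda>i. h v i + h w i)) \<and>
     (\<forall>c. \<forall>v \<in> fibre E x. h (fib_scale E c v) = (\<lambda>i. c * h v i)))"

definition whitney_sum ::
    "('b, 'e) vbundle \<Rightarrow> ('b, 'f) vbundle \<Rightarrow> ('b, 'e \<times> 'f) vbundle" where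
  "whitney_sum E F =
     \<lparr>tot = subtopology (prod_topology (tot E) (tot F)) {(v, w). proj E v = proj F w},
      proj = (\<lambda>(v, w). proj E v),
      fib_add = (\<lambda>(v, w) (v', w'). (fib_add E v v', fib_add F w w')),
      fib_scale = (\<lambda>c (v, w). (fib_scale E c v, fib_scale F c w))\<rparr>"

text \<open>
  The \<open>k\<close>-fold Whitney sum of \<open>E\<close> with itself. The base point is recorded in the total space so
  that the case \<open>k = 0\<close> is correct as well.
\<close>

definition bundle_power ::
    "'b topology \<Rightarrow> ('b, 'e) vbundle \<Rightarrow> nat \<Rightarrow> ('b, 'b \<times> (nat \<Rightarrow> 'e)) vbundle" where
  "bundle_power X E k =
     \<lparr>tot = subtopology (prod_topology X (product_topology (\<lambda>_. tot E) {..<k}))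
              {(x, v). \<forall>i<k. proj E (v i) = x},
      proj = fst,
      fib_add = (\<lambda>(x, v) (y, w). (x, \<lambda>i\<in>{..<k}. fib_add E (v i) (w i))),
      fib_scale = (\<lambda>c (x, v). (x, \<lambda>i\<in>{..<k}. fib_scale E c (v i)))\<rparr>"

definition stably_isomorphic :: "'b topology \<Rightarrow> ('b, 'e) vbundle \<Rightarrow> ('b, 'f) vbundle \<Rightarrow> bool" where
  "stably_isomorphic X E F \<longleftrightarrow>
     (\<exists>r. bundle_iso (whitney_sum E (trivial_bundle X r)) (whitney_sum F (trivial_bundle X r)))"


section \<open>Gluing along a cocycle\<close>

definition mat_act :: "real mat \<Rightarrow> (nat \<Rightarrow> real) \<Rightarrow> nat \<Rightarrow> real" where
  "mat_act A w = (\<lambda>r. if r < dim_row A then vec_index (A *\<^sub>v Matrix.vec (dim_col A) w) r else 0)"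

definition glue_rel ::
    "'i set \<Rightarrow> ('i \<Rightarrow> 'b set) \<Rightarrow> nat \<Rightarrow> ('i \<Rightarrow> 'i \<Rightarrow> 'b \<Rightarrow> real mat) \<Rightarrow>
     (('i \<times> 'b \<times> (nat \<Rightarrow> real)) \<times> ('i \<times> 'b \<times> (nat \<Rightarrow> real))) set" where
  "glue_rel I U n g =
     {((i, p, w), (j, q, v)). i \<in> I \<and> j \<in> I \<and> p = q \<and> p \<in> U i \<inter> U j \<and>
        w \<in> topspace (Euclidean_space n) \<and> v \<in> topspace (Euclidean_space n) \<and>
        w = mat_act (g i j p) v}"

text \<open>
  The quotient of \<open>\<Squnion>\<^sub>i U\<^sub>i \<times> \<real>\<^sup>n\<close> by \<^const>\<open>glue_rel\<close>, for an open cover \<open>U\<close> and a cocycle \<open>g\<close>.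
  The sum of two classes over \<open>p\<close> consists of the sums of their representatives in a common
  chart, and similarly for multiples.
\<close>

definition glued_bundle ::
    "'b topology \<Rightarrow> 'i set \<Rightarrow> ('i \<Rightarrow> 'b set) \<Rightarrow> nat \<Rightarrow> ('i \<Rightarrow> 'i \<Rightarrow> 'b \<Rightarrow> real mat) \<Rightarrow>
     ('b, ('i \<times> 'b \<times> (nat \<Rightarrow> real)) set) vbundle" where
  "glued_bundle X I U n g =
     \<lparr>tot = quotient_topology
              (sum_topology (\<lambda>i. prod_topology (subtopology X (U i)) (Euclidean_space n)) I)
              (\<lambda>z. glue_rel I U n g `` {z}),
      proj = (\<lambda>A. THE p. \<exists>i w. (i, p, w) \<in> A),
      fib_add = (\<lambda>A B. {(i, p, \<lambda>k. v k + w k) | i p v w. (i, p, v) \<in> A \<and> (i, p, w) \<in> B}),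
      fib_scale = (\<lambda>c A. {(i, p, \<lambda>k. c * v k) | i p v. (i, p, v) \<in> A})\<rparr>"


section \<open>Real projective space and its bundles\<close>

text \<open>The points are the lines through the origin of \<open>\<real>\<^sup>d\<^sup>+\<^sup>1\<close>, as sets of vectors.\<close>

definition proj_point :: "(nat \<Rightarrow> real) \<Rightarrow> (nat \<Rightarrow> real) set" where
  "proj_point \<alpha> = {(\<lambda>k. c * \<alpha> k) | c. True}"

definition RP :: "nat \<Rightarrow> (nat \<Rightarrow> real) set topology" where
  "RP d = quotient_topology
            (subtopology (Euclidean_space (Suc d)) {\<alpha>. \<alpha> \<noteq> (\<lambda>_. 0)}) proj_point"

definition hom_coords :: "(nat \<Rightarrow> real) set \<Rightarrow> nat \<Rightarrow> real" where
  "hom_coords p = (SOME \<alpha>. \<alpha> \<in> p \<and> \<alpha> \<noteq> (\<lambda>_. 0))"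

definition chart_domain :: "nat \<Rightarrow> nat \<Rightarrow> (nat \<Rightarrow> real) set set" where
  "chart_domain d i = {p \<in> topspace (RP d). hom_coords p i \<noteq> 0}"

definition tautological_bundle :: "nat \<Rightarrow> ((nat \<Rightarrow> real) set, (nat \<Rightarrow> real) set \<times> (nat \<Rightarrow> real)) vbundle" where
  "tautological_bundle d =
     \<lparr>tot = subtopology (prod_topology (RP d) (Euclidean_space (Suc d))) {(p, v). v \<in> p},
      proj = fst,
      fib_add = (\<lambda>(p, v) (q, w). (p, \<lambda>k. v k + w k)),
      fib_scale = (\<lambda>c (p, v). (p, \<lambda>k. c * v k))\<rparr>"

text \<open>
  \<^term>\<open>insert_index i\<close> is the increasing bijection from \<open>{0..d-1}\<close> onto \<open>{0..d} - {i}\<close>.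
\<close>

definition deletion_coord :: "(nat \<Rightarrow> 'a::real_vector) \<Rightarrow> nat \<Rightarrow> nat \<Rightarrow> (nat \<Rightarrow> real) set \<Rightarrow> 'a" where
  "deletion_coord e d i p =
     (\<Sum>r<d. (hom_coords p (insert_index i r) / hom_coords p i) *\<^sub>R e r)"

definition deletion_mat ::
    "('a::real_vector \<Rightarrow> 'a \<Rightarrow> 'a) \<Rightarrow> (nat \<Rightarrow> 'a) \<Rightarrow> nat \<Rightarrow> nat \<Rightarrow> (nat \<Rightarrow> real) set \<Rightarrow> real mat" where
  "deletion_mat mul e d i p = left_mult_mat mul e d (deletion_coord e d i p)"

text \<open>
  For \<open>i \<noteq> j\<close> and \<open>p\<close> in both chart domains, \<open>deletion_coord e d j p \<noteq> 0\<close>, so that the inverse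
  below exists.
\<close>

definition deletion_cocycle ::
    "('a::real_vector \<Rightarrow> 'a \<Rightarrow> 'a) \<Rightarrow> (nat \<Rightarrow> 'a) \<Rightarrow> nat \<Rightarrow> nat \<Rightarrow> nat \<Rightarrow> (nat \<Rightarrow> real) set \<Rightarrow> real mat" where
  "deletion_cocycle mul e d i j p =
     (if i = j then 1\<^sub>m d
      else deletion_mat mul e d i p * the (mat_inverse (deletion_mat mul e d j p)))"

definition coordinate_deletion_bundle ::
    "('a::real_vector \<Rightarrow> 'a \<Rightarrow> 'a) \<Rightarrow> (nat \<Rightarrow> 'a) \<Rightarrow> nat \<Rightarrow>
     ((nat \<Rightarrow> real) set, (nat \<times> (nat \<Rightarrow> real) set \<times> (nat \<Rightarrow> real)) set) vbundle" where
  "coordinate_deletion_bundle mul e d =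
     glued_bundle (RP d) {..d} (chart_domain d) d (deletion_cocycle mul e d)"


section \<open>Real K-theory\<close>

text \<open>
  Groups are written multiplicatively, as in HOL-Algebra: \<open>x [^] k\<close> is the multiple \<open>k x\<close> of a class.
\<close>

definition grothendieck_rel :: "('a, 'm) monoid_scheme \<Rightarrow> (('a \<times> 'a) \<times> ('a \<times> 'a)) set" where
  "grothendieck_rel M =
     {((a, b), (c, d)). {a, b, c, d} \<subseteq> carrier M \<and>
        (\<exists>k \<in> carrier M. a \<otimes>\<^bsub>M\<^esub> d \<otimes>\<^bsub>M\<^esub> k = c \<otimes>\<^bsub>M\<^esub> b \<otimes>\<^bsub>M\<^esub> k)}"

definition grothendieck_group :: "('a, 'm) monoid_scheme \<Rightarrow> ('a \<times> 'a) set monoid" where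
  "grothendieck_group M =
     \<lparr>carrier = (carrier M \<times> carrier M) // grothendieck_rel M,
      monoid.mult = (\<lambda>x y. \<Union>(a, b)\<in>x. \<Union>(c, d)\<in>y.
        grothendieck_rel M `` {(a \<otimes>\<^bsub>M\<^esub> c, b \<otimes>\<^bsub>M\<^esub> d)}),
      one = grothendieck_rel M `` {(\<one>\<^bsub>M\<^esub>, \<one>\<^bsub>M\<^esub>)}\<rparr>"

definition grothendieck_of :: "('a, 'm) monoid_scheme \<Rightarrow> 'a \<Rightarrow> ('a \<times> 'a) set" where
  "grothendieck_of M a = grothendieck_rel M `` {(a, \<one>\<^bsub>M\<^esub>)}"

text \<open>
  To have a set of isomorphism classes, total spaces are taken in the type
  \<open>'b \<times> (nat \<Rightarrow> real)\<close>. Choosing a basis in each fibre shows that every vector bundle, with total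
  space in any type, is isomorphic to one of this kind; \<open>iso_class X E\<close> is therefore the class of
  a bundle \<open>E\<close> of arbitrary type.
\<close>

type_synonym 'b std_bundle = "('b, 'b \<times> (nat \<Rightarrow> real)) vbundle"

definition iso_class :: "'b topology \<Rightarrow> ('b, 'e) vbundle \<Rightarrow> 'b std_bundle set" where
  "iso_class X E = {F. vector_bundle X F \<and> bundle_iso E F}"

definition Vect :: "'b topology \<Rightarrow> 'b std_bundle set monoid" where
  "Vect X =
     \<lparr>carrier = {iso_class X E | E :: 'b std_bundle. vector_bundle X E},
      monoid.mult = (\<lambda>A B. \<Union>E\<in>A. \<Union>F\<in>B. iso_class X (whitney_sum E F)),
      one = iso_class X (trivial_bundle X 0)\<rparr>"

definition KO :: "'b topology \<Rightarrow> ('b std_bundle set \<times> 'b std_bundle set) set monoid" where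
  "KO X = grothendieck_group (Vect X)"

definition KO_class ::
    "'b topology \<Rightarrow> ('b, 'e) vbundle \<Rightarrow> ('b std_bundle set \<times> 'b std_bundle set) set" where
  "KO_class X E = grothendieck_of (Vect X) (iso_class X E)"

definition KO_diff ::
    "'b topology \<Rightarrow> ('b, 'e) vbundle \<Rightarrow> ('b, 'f) vbundle \<Rightarrow>
     ('b std_bundle set \<times> 'b std_bundle set) set" where
  "KO_diff X E F = KO_class X E \<otimes>\<^bsub>KO X\<^esub> inv\<^bsub>KO X\<^esub> KO_class X F"

definition virtual_rank ::
    "'b \<Rightarrow> ('b std_bundle set \<times> 'b std_bundle set) set \<Rightarrow> int" where
  "virtual_rank x z =
     the_elem (\<Union>(A, B)\<in>z. \<Union>E\<in>A. \<Union>F\<in>B. {int (bundle_rank E x) - int (bundle_rank F x)})"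

text \<open>
  The kernel of the rank at the base point \<open>x0\<close>, i.e. of the restriction
  \<open>KO X \<rightarrow> KO {x0} \<cong> \<int>\<close>.
\<close>

definition reduced_KO ::
    "'b topology \<Rightarrow> 'b \<Rightarrow> ('b std_bundle set \<times> 'b std_bundle set) set monoid" where
  "reduced_KO X x0 = (KO X)\<lparr>carrier := kernel (KO X) integer_group (virtual_rank x0)\<rparr>"

end

theory Submission
  imports Defs
begin

text \<open>
  Let \<open>Q\<^sub>i a\<close> be the matrix of left multiplication by the vector \<open>a \<in> \<real>\<^sup>d\<^sup>+\<^sup>1\<close> with the \<open>i\<close>-th
  coordinate deleted. It is linear in \<open>a\<close>, and since the norm is multiplicative, \<open>Q\<^sub>i\<^sup>T Q\<^sub>i =
  Q\<^sub>i Q\<^sub>i\<^sup>T = n\<^sub>i\<close> with \<open>n\<^sub>i a = \<bar>a\<bar>\<^sup>2 - a\<^sub>i\<^sup>2\<close>. The coordinate-deletion bundle \<open>E\<close> has the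
  coordinate vector \<open>w\<^sub>i\<close> on the \<open>i\<close>-th chart, and \<open>w\<^sub>i = Q\<^sub>i u / a\<^sub>i\<close> for all \<open>i\<close> describes a
  bundle map \<open>u \<mapsto> w\<close> from the trivial bundle \<open>\<epsilon>\<^sup>d\<close> to \<open>E\<close>, which is bijective except at the \<open>d
  + 1\<close> coordinate points, where one \<open>Q\<^sub>i\<close> vanishes. The bundle \<open>\<gamma>\<^sup>d\<close>, whose vectors over \<open>[a]\<close>
  for a unit vector \<open>a\<close> are the odd functions \<open>{a, - a} \<rightarrow> \<real>\<^sup>d\<close>, receives the maps \<open>u \<mapsto> Q\<^sub>j u\<close>
  from \<open>\<epsilon>\<^sup>d\<close>, and the \<open>j\<close>-th one is singular at the \<open>j\<close>-th coordinate point alone, in the same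
  way as the map to \<open>E\<close>. So every coordinate point should contribute \<open>[\<gamma>\<^sup>d] - d\<close> to \<open>[E] - d\<close>.

  This becomes an isomorphism \<open>E \<oplus> \<epsilon>\<^bsup>d\<^sup>2\<^esup> \<cong> (\<gamma>\<^sup>d)\<^sup>d\<^sup>+\<^sup>1\<close> (\<open>deletion_bundle_sum_iso\<close>). The
  fibre of \<open>\<epsilon>\<^bsup>d\<^sup>2\<^esup>\<close> is the space of the families \<open>(u\<^sub>0, \<dots>, u\<^sub>d)\<close> of sum zero, and it is mapped
  by \<open>(u\<^sub>j) \<mapsto> (Q\<^sub>j u\<^sub>j)\<close>; this is injective everywhere, because at most one \<open>Q\<^sub>j\<close> is singular
  and that \<open>u\<^sub>j\<close> is determined by the others. The bundle \<open>E\<close> is mapped to a complement by \<open>w \<mapsto>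
  (m\<^sub>j Q\<^sub>j u)\<close>, where \<open>m\<^sub>j\<close> is the product of the \<open>n\<^sub>k\<close> with \<open>k \<noteq> j\<close>; with these weights the
  map is polynomial in \<open>a\<close> and in the coordinate vector, also at the coordinate points.

  The square matrix with the blocks \<open>a\<^sub>0, Q\<^sub>0, - Q\<^sub>0\<^sup>T, a\<^sub>0\<close> is \<open>\<bar>a\<bar>\<close> times an orthogonal one
  and linear in \<open>a\<close>, hence \<open>\<gamma>\<^sup>2\<^sup>d \<cong> \<epsilon>\<^sup>2\<^sup>d\<close> (\<open>tautological_power_trivial\<close>). As \<open>d\<close> is even,
  \<open>d\<^sup>2\<close> of the copies of \<open>\<gamma>\<close> above are trivial together, and \<open>E \<oplus> \<epsilon>\<^bsup>d\<^sup>2\<^esup> \<cong> \<gamma>\<^sup>d \<oplus> \<epsilon>\<^bsup>d\<^sup>2\<^esup>\<close>. The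
  identities in \<open>KO\<close> follow from this formally.

  Two facts make the explicit maps cheap. A continuous bundle map between bundles of equal
  rank that is injective on the fibres is an isomorphism (\<open>injective_bundle_map_iso\<close>). An even
  continuous function of the unit representatives of a line is a continuous function on
  projective space (\<open>continuous_map_unit_rep\<close>).
\<close>


section \<open>Continuity into Euclidean space\<close>

lemma continuous_map_into_Euclidean_space:
  "continuous_map T (Euclidean_space n) f \<longleftrightarrow>
     (\<forall>x\<in>topspace T. \<forall>i\<ge>n. f x i = 0) \<and> (\<forall>i<n. continuous_map T euclideanreal (\<lambda>x. f x i))"
  (is "?L \<longleftrightarrow> ?R")
proof
  assume ?L
  then show ?R
    by (auto simp: Euclidean_space_def continuous_map_in_subtopology continuous_map_componentwise_UNIV)
next
  assume R: ?R
  have "continuous_map T euclideanreal (\<lambda>x. f x i)" for i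
  proof (cases "i < n")
    case False
    have "continuous_map T euclideanreal (\<lambda>x. 0)" by simp
    then show ?thesis
      by (rule continuous_map_eq) (use R False in auto)
  qed (use R in auto)
  then show ?L
    using R by (auto simp: Euclidean_space_def continuous_map_in_subtopology continuous_map_componentwise_UNIV)
qed

lemma continuous_map_Euclidean_coord:
  assumes "continuous_map T (Euclidean_space n) f"
  shows "continuous_map T euclideanreal (\<lambda>x. f x i)"
  using assms
  by (simp add: Euclidean_space_def continuous_map_in_subtopology continuous_map_componentwise_UNIV)

abbreviation "Vec n \<equiv> topspace (Euclidean_space n)"

lemma Vec_iff: "v \<in> Vec n \<longleftrightarrow> (\<forall>i\<ge>n. v i = 0)"
  by (simp add: topspace_Euclidean_space)

lemma Vec_add [simp, intro]: "v \<in> Vec n \<Longrightarrow> w \<in> Vec n \<Longrightarrow> (\<lambda>i. v i + w i) \<in> Vec n"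
  and Vec_scale [simp, intro]: "v \<in> Vec n \<Longrightarrow> (\<lambda>i. c * v i) \<in> Vec n"
  by (auto simp: Vec_iff)


section \<open>Bundle maps\<close>

text \<open>The total space of an isomorphic copy is only known through the bundle map, so linearity of an
  inverse needs to know that sums and multiples do not leave the fibre.\<close>

definition fibre_closed :: "('b, 'e) vbundle \<Rightarrow> bool" where
  "fibre_closed E \<longleftrightarrow>
     (\<forall>x. \<forall>v \<in> fibre E x. \<forall>w \<in> fibre E x. fib_add E v w \<in> fibre E x) \<and>
     (\<forall>c x. \<forall>v \<in> fibre E x. fib_scale E c v \<in> fibre E x)"

definition bundle_map :: "('b, 'e) vbundle \<Rightarrow> ('b, 'f) vbundle \<Rightarrow> ('e \<Rightarrow> 'f) \<Rightarrow> bool" where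
  "bundle_map E F f \<longleftrightarrow>
     continuous_map (tot E) (tot F) f \<and>
     (\<forall>v \<in> topspace (tot E). proj F (f v) = proj E v) \<and>
     (\<forall>x. \<forall>v \<in> fibre E x. \<forall>w \<in> fibre E x. f (fib_add E v w) = fib_add F (f v) (f w)) \<and>
     (\<forall>c. \<forall>v \<in> topspace (tot E). f (fib_scale E c v) = fib_scale F c (f v))"

definition bundle_iso_map :: "('b, 'e) vbundle \<Rightarrow> ('b, 'f) vbundle \<Rightarrow> ('e \<Rightarrow> 'f) \<Rightarrow> bool" where
  "bundle_iso_map E F f \<longleftrightarrow> bundle_map E F f \<and> homeomorphic_map (tot E) (tot F) f"

lemma bundle_iso_iff: "bundle_iso E F \<longleftrightarrow> (\<exists>f. bundle_iso_map E F f)"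
  unfolding bundle_iso_def bundle_iso_map_def bundle_map_def
  using homeomorphic_imp_continuous_map by blast

lemma in_fibre: "v \<in> fibre E x \<longleftrightarrow> v \<in> topspace (tot E) \<and> proj E v = x"
  by (simp add: fibre_def)

lemma bundle_map_fibre: "bundle_map E F f \<Longrightarrow> v \<in> fibre E x \<Longrightarrow> f v \<in> fibre F x"
  by (auto simp: bundle_map_def in_fibre continuous_map_def)

lemma bundle_map_add:
  "bundle_map E F f \<Longrightarrow> v \<in> fibre E x \<Longrightarrow> w \<in> fibre E x \<Longrightarrow>
     f (fib_add E v w) = fib_add F (f v) (f w)"
  by (auto simp: bundle_map_def)

lemma bundle_map_scale:
  "bundle_map E F f \<Longrightarrow> v \<in> topspace (tot E) \<Longrightarrow> f (fib_scale E c v) = fib_scale F c (f v)"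
  by (auto simp: bundle_map_def)

lemma bundle_map_compose:
  assumes f: "bundle_map E F f" and g: "bundle_map F G g"
  shows "bundle_map E G (g \<circ> f)"
proof -
  have "f v \<in> topspace (tot F)" if "v \<in> topspace (tot E)" for v
    using f that by (auto simp: bundle_map_def continuous_map_def)
  moreover have "g (f (fib_add E v w)) = fib_add G (g (f v)) (g (f w))"
    if "v \<in> fibre E x" "w \<in> fibre E x" for x v w
    using bundle_map_add[OF f that] bundle_map_add[OF g bundle_map_fibre[OF f that(1)] bundle_map_fibre[OF f that(2)]]
    by simp
  ultimately show ?thesis
    using f g unfolding bundle_map_def
    by (auto intro: continuous_map_compose)
qed

lemma bundle_iso_map_compose:
  "bundle_iso_map E F f \<Longrightarrow> bundle_iso_map F G g \<Longrightarrow> bundle_iso_map E G (g \<circ> f)"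
  by (auto simp: bundle_iso_map_def bundle_map_compose homeomorphic_map_compose)

lemma bundle_iso_map_id: "bundle_iso_map E E (\<lambda>v. v)"
  by (simp add: bundle_iso_map_def bundle_map_def homeomorphic_map_id[unfolded id_def])

lemma fibre_closedD:
  assumes "fibre_closed E"
  shows "v \<in> fibre E x \<Longrightarrow> w \<in> fibre E x \<Longrightarrow> fib_add E v w \<in> fibre E x"
    and "v \<in> fibre E x \<Longrightarrow> fib_scale E c v \<in> fibre E x"
  using assms by (auto simp: fibre_closed_def)

lemma fibre_closed_topspace:
  assumes "fibre_closed E" "v \<in> topspace (tot E)"
  shows "fib_scale E c v \<in> topspace (tot E)" "proj E (fib_scale E c v) = proj E v"
  using fibre_closedD(2)[OF assms(1), of v "proj E v"] assms(2) by (auto simp: in_fibre)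

lemma bundle_iso_map_inverse:
  assumes f: "bundle_iso_map E F f" and E: "fibre_closed E"
  obtains g where "bundle_iso_map F E g" "\<And>v. v \<in> topspace (tot E) \<Longrightarrow> g (f v) = v"
    "\<And>w. w \<in> topspace (tot F) \<Longrightarrow> f (g w) = w"
proof -
  obtain g where g: "homeomorphic_maps (tot E) (tot F) f g"
    using f by (auto simp: bundle_iso_map_def homeomorphic_map_maps)
  then have gf: "\<And>v. v \<in> topspace (tot E) \<Longrightarrow> g (f v) = v"
    and fg: "\<And>w. w \<in> topspace (tot F) \<Longrightarrow> f (g w) = w"
    and cg: "continuous_map (tot F) (tot E) g"
    by (auto simp: homeomorphic_maps_def)
  have bf: "bundle_map E F f" using f by (simp add: bundle_iso_map_def)
  have gin: "g w \<in> topspace (tot E)" if "w \<in> topspace (tot F)" for w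
    using cg that by (auto simp: continuous_map_def)
  have projg: "proj E (g w) = proj F w" if "w \<in> topspace (tot F)" for w
    using bf gin[OF that] fg[OF that] unfolding bundle_map_def by metis
  have gfib: "g w \<in> fibre E x" if "w \<in> fibre F x" for w x
    using that gin projg by (auto simp: in_fibre)
  have "g (fib_add F v w) = fib_add E (g v) (g w)" if "v \<in> fibre F x" "w \<in> fibre F x" for x v w
  proof -
    have "f (fib_add E (g v) (g w)) = fib_add F v w"
      using bundle_map_add[OF bf gfib[OF that(1)] gfib[OF that(2)]] that fg by (auto simp: in_fibre)
    moreover have "fib_add E (g v) (g w) \<in> topspace (tot E)"
      using fibre_closedD(1)[OF E gfib[OF that(1)] gfib[OF that(2)]] by (simp add: in_fibre)
    ultimately show ?thesis using gf by metis
  qed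
  moreover have "g (fib_scale F c w) = fib_scale E c (g w)" if "w \<in> topspace (tot F)" for c w
  proof -
    have "f (fib_scale E c (g w)) = fib_scale F c w"
      using bundle_map_scale[OF bf gin[OF that]] fg[OF that] by auto
    then show ?thesis using gf fibre_closed_topspace[OF E gin[OF that]] by metis
  qed
  ultimately have "bundle_map F E g"
    using cg projg by (auto simp: bundle_map_def)
  moreover have "homeomorphic_map (tot F) (tot E) g"
    using g homeomorphic_maps_map by blast
  ultimately show thesis
    using that[of g] gf fg by (auto simp: bundle_iso_map_def)
qed

lemma bundle_iso_refl: "bundle_iso E E"
  using bundle_iso_map_id bundle_iso_iff by blast

lemma bundle_iso_trans: "bundle_iso E F \<Longrightarrow> bundle_iso F G \<Longrightarrow> bundle_iso E G"
  using bundle_iso_map_compose bundle_iso_iff by metis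

lemma bundle_iso_sym: "bundle_iso E F \<Longrightarrow> fibre_closed E \<Longrightarrow> bundle_iso F E"
  using bundle_iso_map_inverse bundle_iso_iff by metis

lemma fibre_closed_iso:
  assumes iso: "bundle_iso E F" and E: "fibre_closed E"
  shows "fibre_closed F"
proof -
  obtain f where f: "bundle_iso_map E F f" using iso by (auto simp: bundle_iso_iff)
  then obtain g where g: "bundle_iso_map F E g" and fg: "\<And>w. w \<in> topspace (tot F) \<Longrightarrow> f (g w) = w"
    using bundle_iso_map_inverse[OF f E] by metis
  have bf: "bundle_map E F f" and bg: "bundle_map F E g" using f g by (auto simp: bundle_iso_map_def)
  have gfib: "g v \<in> fibre E x" and fgv: "f (g v) = v" if "v \<in> fibre F x" for v x
    using that bundle_map_fibre[OF bg] fg by (auto simp: in_fibre)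
  have "fib_add F v w \<in> fibre F x" if "v \<in> fibre F x" "w \<in> fibre F x" for x v w
    using bundle_map_fibre[OF bf fibre_closedD(1)[OF E gfib[OF that(1)] gfib[OF that(2)]]]
      bundle_map_add[OF bf gfib[OF that(1)] gfib[OF that(2)]] that fgv by metis
  moreover have "fib_scale F c v \<in> fibre F x" if "v \<in> fibre F x" for c x v
    using bundle_map_fibre[OF bf fibre_closedD(2)[OF E gfib[OF that]]]
      bundle_map_scale[OF bf, of "g v" c] that fgv gfib by (metis in_fibre)
  ultimately show ?thesis by (auto simp: fibre_closed_def)
qed


section \<open>Restrictions and local triviality\<close>

lemma restrict_bundle_simps [simp]:
  "tot (restrict_bundle E U) = subtopology (tot E) {v. proj E v \<in> U}"
  "proj (restrict_bundle E U) = proj E"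
  "fib_add (restrict_bundle E U) = fib_add E"
  "fib_scale (restrict_bundle E U) = fib_scale E"
  by (simp_all add: restrict_bundle_def)

lemma fibre_restrict: "fibre (restrict_bundle E U) x = (if x \<in> U then fibre E x else {})"
  by (auto simp: fibre_def)

lemma restrict_restrict: "restrict_bundle (restrict_bundle E U) V = restrict_bundle E (U \<inter> V)"
  by (simp add: restrict_bundle_def subtopology_subtopology Collect_conj_eq)

lemma fibre_closed_restrict: "fibre_closed E \<Longrightarrow> fibre_closed (restrict_bundle E U)"
  by (simp add: fibre_closed_def fibre_restrict)

lemma bundle_map_restrict:
  assumes "bundle_map E F f"
  shows "bundle_map (restrict_bundle E U) (restrict_bundle F U) f"
  using assms unfolding bundle_map_def
  by (auto simp: fibre_restrict continuous_map_in_subtopology continuous_map_from_subtopology)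

lemma bundle_iso_map_restrict:
  assumes "bundle_iso_map E F f"
  shows "bundle_iso_map (restrict_bundle E U) (restrict_bundle F U) f"
proof -
  have "homeomorphic_map (tot (restrict_bundle E U)) (tot (restrict_bundle F U)) f"
    using assms by (auto simp: bundle_iso_map_def bundle_map_def intro!: homeomorphic_map_subtopologies_alt)
  then show ?thesis
    using assms bundle_map_restrict by (auto simp: bundle_iso_map_def)
qed

lemma bundle_iso_restrict: "bundle_iso E F \<Longrightarrow> bundle_iso (restrict_bundle E U) (restrict_bundle F U)"
  using bundle_iso_map_restrict bundle_iso_iff by metis

lemma trivial_bundle_simps [simp]:
  "tot (trivial_bundle X n) = prod_topology X (Euclidean_space n)"
  "proj (trivial_bundle X n) = fst"
  "fib_add (trivial_bundle X n) = (\<lambda>(x, v) (y, w). (x, \<lambda>i. v i + w i))"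
  "fib_scale (trivial_bundle X n) = (\<lambda>c (x, v). (x, \<lambda>i. c * v i))"
  by (simp_all add: trivial_bundle_def)

lemma fibre_trivial: "fibre (trivial_bundle X n) x = (if x \<in> topspace X then {x} \<times> Vec n else {})"
  by (auto simp: fibre_def)

lemma fibre_closed_trivial: "fibre_closed (trivial_bundle X n)"
  by (auto simp: fibre_closed_def fibre_trivial)

lemma restrict_trivial: "restrict_bundle (trivial_bundle X n) U = trivial_bundle (subtopology X U) n"
proof -
  have "subtopology (prod_topology X (Euclidean_space n)) {v. fst v \<in> U}
      = subtopology (prod_topology X (Euclidean_space n)) (U \<times> Vec n)"
  proof -
    have "topspace (prod_topology X (Euclidean_space n)) \<inter> {v. fst v \<in> U}
        = topspace (prod_topology X (Euclidean_space n)) \<inter> (U \<times> Vec n)" by auto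
    then show ?thesis by (metis subtopology_restrict)
  qed
  then show ?thesis
    by (simp add: restrict_bundle_def trivial_bundle_def prod_topology_subtopology)
qed

lemma vector_bundle_fibre_closed: "vector_bundle X E \<Longrightarrow> fibre_closed E"
  by (simp add: vector_bundle_def fibre_closed_def)

lemma vector_bundle_proj: "vector_bundle X E \<Longrightarrow> continuous_map (tot E) X (proj E)"
  by (simp add: vector_bundle_def)

lemma vector_bundle_proj_in: "vector_bundle X E \<Longrightarrow> v \<in> topspace (tot E) \<Longrightarrow> proj E v \<in> topspace X"
  using vector_bundle_proj by (fastforce simp: continuous_map_def)

text \<open>Local trivialisations are used as frames, that is, as maps from the product to the bundle; the
  symmetry of \<^const>\<open>bundle_iso\<close> turns them round.\<close>

lemma vector_bundleI:
  assumes "continuous_map (tot E) X (proj E)" "fibre_closed E"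
    and "\<And>x. x \<in> topspace X \<Longrightarrow> \<exists>U n. openin X U \<and> x \<in> U \<and>
        bundle_iso (trivial_bundle (subtopology X U) n) (restrict_bundle E U)"
  shows "vector_bundle X E"
  unfolding vector_bundle_def
proof (intro conjI ballI)
  fix x assume "x \<in> topspace X"
  from assms(3)[OF this] show "\<exists>U n. openin X U \<and> x \<in> U \<and>
     bundle_iso (restrict_bundle E U) (trivial_bundle (subtopology X U) n)"
    using bundle_iso_sym fibre_closed_trivial by blast
qed (use assms(1,2) in \<open>auto simp: fibre_closed_def\<close>)

lemma vector_bundle_local:
  assumes "vector_bundle X E" "x \<in> topspace X"
  obtains U n where "openin X U" "x \<in> U" "bundle_iso (trivial_bundle (subtopology X U) n) (restrict_bundle E U)"
  using assms bundle_iso_sym fibre_closed_restrict[OF vector_bundle_fibre_closed[OF assms(1)]]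
  unfolding vector_bundle_def by blast

lemma bundle_iso_restrict_trivial_smaller:
  assumes "bundle_iso (trivial_bundle (subtopology X U) n) (restrict_bundle E U)"
  shows "bundle_iso (trivial_bundle (subtopology X (U \<inter> V)) n) (restrict_bundle E (U \<inter> V))"
  using bundle_iso_restrict[OF assms, of V]
  by (simp add: restrict_trivial restrict_restrict subtopology_subtopology)

lemma vector_bundle_iso:
  assumes iso: "bundle_iso E F" and E: "vector_bundle X E"
  shows "vector_bundle X F"
proof (rule vector_bundleI)
  note Ec = vector_bundle_fibre_closed[OF E]
  show Fc: "fibre_closed F"
    using fibre_closed_iso[OF iso] Ec by simp
  obtain g where g: "bundle_iso_map F E g"
    using bundle_iso_sym[OF iso Ec] by (auto simp: bundle_iso_iff)
  have "continuous_map (tot F) X (proj E \<circ> g)"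
    using g vector_bundle_proj[OF E]
    by (auto simp: bundle_iso_map_def bundle_map_def intro: continuous_map_compose)
  then show "continuous_map (tot F) X (proj F)"
    by (rule continuous_map_eq) (use g in \<open>auto simp: bundle_iso_map_def bundle_map_def\<close>)
  fix x assume "x \<in> topspace X"
  then obtain U n where "openin X U" "x \<in> U"
    "bundle_iso (trivial_bundle (subtopology X U) n) (restrict_bundle E U)"
    using vector_bundle_local[OF E] by metis
  then show "\<exists>U n. openin X U \<and> x \<in> U \<and>
        bundle_iso (trivial_bundle (subtopology X U) n) (restrict_bundle F U)"
    using bundle_iso_trans bundle_iso_restrict[OF iso] by blast
qed

lemma vector_bundle_trivial: "vector_bundle X (trivial_bundle X n)"
proof (rule vector_bundleI[OF _ fibre_closed_trivial])
  show "continuous_map (tot (trivial_bundle X n)) X (proj (trivial_bundle X n))"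
    by (simp add: continuous_map_fst)
  fix x assume "x \<in> topspace X"
  then show "\<exists>U m. openin X U \<and> x \<in> U \<and>
     bundle_iso (trivial_bundle (subtopology X U) m) (restrict_bundle (trivial_bundle X n) U)"
    by (metis openin_topspace restrict_trivial bundle_iso_refl)
qed


section \<open>Linear maps between coordinate spaces\<close>

definition vec_linear :: "nat \<Rightarrow> ((nat \<Rightarrow> real) \<Rightarrow> nat \<Rightarrow> real) \<Rightarrow> bool" where
  "vec_linear n T \<longleftrightarrow>
     (\<forall>v \<in> Vec n. \<forall>w \<in> Vec n. T (\<lambda>i. v i + w i) = (\<lambda>i. T v i + T w i)) \<and>
     (\<forall>c. \<forall>v \<in> Vec n. T (\<lambda>i. c * v i) = (\<lambda>i. c * T v i))"

lemma vec_linear_add: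
  "vec_linear n T \<Longrightarrow> v \<in> Vec n \<Longrightarrow> w \<in> Vec n \<Longrightarrow> T (\<lambda>i. v i + w i) = (\<lambda>i. T v i + T w i)"
  and vec_linear_scale: "vec_linear n T \<Longrightarrow> v \<in> Vec n \<Longrightarrow> T (\<lambda>i. c * v i) = (\<lambda>i. c * T v i)"
  by (auto simp: vec_linear_def)

definition axis_vec :: "nat \<Rightarrow> nat \<Rightarrow> real" where
  "axis_vec s = (\<lambda>i. if i = s then 1 else 0)"

lemma axis_vec_Vec: "s < n \<Longrightarrow> axis_vec s \<in> Vec n"
  by (auto simp: Vec_iff axis_vec_def)

lemma vec_linear_expand:
  assumes T: "vec_linear n T" and v: "v \<in> Vec n"
  shows "T v r = (\<Sum>s<n. T (axis_vec s) r * v s)"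
proof -
  have "T (\<lambda>i. if i < k then v i else 0) r = (\<Sum>s<k. T (axis_vec s) r * v s)" if "k \<le> n" for k
    using that
  proof (induction k)
    case 0
    have "T (\<lambda>i. 0 * v i) = (\<lambda>i. 0 * T v i)"
      by (rule vec_linear_scale[OF T v])
    then show ?case by (auto dest: fun_cong)
  next
    case (Suc k)
    have eq: "(\<lambda>i. if i < Suc k then v i else 0)
            = (\<lambda>i. (if i < k then v i else 0) + v k * axis_vec k i)"
      by (auto simp: axis_vec_def less_Suc_eq fun_eq_iff)
    have *: "(\<lambda>i. if i < k then v i else 0) \<in> Vec n" "axis_vec k \<in> Vec n"
      using Suc.prems by (auto simp: Vec_iff axis_vec_def)
    then have "(\<lambda>i. v k * axis_vec k i) \<in> Vec n"
      by (rule_tac Vec_scale)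
    with * have "T (\<lambda>i. (if i < k then v i else 0) + v k * axis_vec k i)
        = (\<lambda>i. T (\<lambda>i. if i < k then v i else 0) i + T (\<lambda>i. v k * axis_vec k i) i)"
      by (intro vec_linear_add[OF T])
    moreover have "T (\<lambda>i. v k * axis_vec k i) = (\<lambda>i. v k * T (axis_vec k) i)"
      by (rule vec_linear_scale[OF T *(2)])
    ultimately show ?case
      unfolding eq using Suc by simp
  qed
  from this[of n] have "T (\<lambda>i. if i < n then v i else 0) r = (\<Sum>s<n. T (axis_vec s) r * v s)"
    by simp
  moreover have "(\<lambda>i. if i < n then v i else 0) = v"
    using v by (auto simp: Vec_iff)
  ultimately show ?thesis by simp
qed

text \<open>Two mutually inverse matrices \<open>B\<close> and \<open>C\<close> have \<open>n = tr (C B) = tr (B C) = m\<close>.\<close>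

lemma vec_dim_unique:
  assumes T: "vec_linear n T" "\<And>v. v \<in> Vec n \<Longrightarrow> T v \<in> Vec m"
    and S: "vec_linear m S" "\<And>v. v \<in> Vec m \<Longrightarrow> S v \<in> Vec n"
    and ST: "\<And>v. v \<in> Vec n \<Longrightarrow> S (T v) = v" and TS: "\<And>v. v \<in> Vec m \<Longrightarrow> T (S v) = v"
  shows "n = m"
proof -
  have "S (T (axis_vec s)) s = (\<Sum>r<m. S (axis_vec r) s * T (axis_vec s) r)" if "s < n" for s
    using vec_linear_expand[OF S(1) T(2)[OF axis_vec_Vec[OF that]]] .
  then have 1: "(\<Sum>s<n. \<Sum>r<m. S (axis_vec r) s * T (axis_vec s) r) = (\<Sum>s<n. 1)"
    by (intro sum.cong) (auto simp: ST axis_vec_Vec, simp add: axis_vec_def)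
  have "T (S (axis_vec r)) r = (\<Sum>s<n. T (axis_vec s) r * S (axis_vec r) s)" if "r < m" for r
    using vec_linear_expand[OF T(1) S(2)[OF axis_vec_Vec[OF that]]] .
  then have 2: "(\<Sum>r<m. \<Sum>s<n. T (axis_vec s) r * S (axis_vec r) s) = (\<Sum>r<m. 1)"
    by (intro sum.cong) (auto simp: TS axis_vec_Vec, simp add: axis_vec_def)
  have "(\<Sum>s<n. \<Sum>r<m. S (axis_vec r) s * T (axis_vec s) r)
      = (\<Sum>r<m. \<Sum>s<n. T (axis_vec s) r * S (axis_vec r) s)"
    by (subst sum.swap) (simp add: mult.commute)
  with 1 2 have "real n = real m" by simp
  then show ?thesis by simp
qed

lemma continuous_map_det:
  fixes M :: "'x \<Rightarrow> real mat"
  assumes M: "\<And>x. x \<in> topspace T \<Longrightarrow> M x \<in> carrier_mat n n"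
    and c: "\<And>i j. i < n \<Longrightarrow> j < n \<Longrightarrow> continuous_map T euclideanreal (\<lambda>x. M x $$ (i, j))"
  shows "continuous_map T euclideanreal (\<lambda>x. Determinant.det (M x))"
proof -
  have "continuous_map T euclideanreal
      (\<lambda>x. \<Sum>p \<in> {p. p permutes {0..<n}}. signof p * (\<Prod>i = 0..<n. M x $$ (i, p i)))"
  proof (intro continuous_map_sum continuous_map_real_mult continuous_map_prod c)
    fix p i assume "p \<in> {p. p permutes {0..<n}}" "i \<in> {0..<n}"
    then show "i < n" "p i < n" using permutes_in_image[of p "{0..<n}" i] by auto
  qed (auto simp: finite_permutations)
  then show ?thesis
    by (rule continuous_map_eq) (simp add: det_def'[OF M])
qed

text \<open>Cramer's rule makes the inverse of a continuous family of injective square matrices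
  continuous.\<close>

lemma continuous_matrix_inverse:
  fixes A :: "'x \<Rightarrow> nat \<Rightarrow> nat \<Rightarrow> real"
  assumes inj: "\<And>x v. x \<in> topspace T \<Longrightarrow> v \<in> Vec n \<Longrightarrow> (\<And>r. r < n \<Longrightarrow> (\<Sum>s<n. A x r s * v s) = 0) \<Longrightarrow> v = (\<lambda>_. 0)"
    and cont: "\<And>r s. r < n \<Longrightarrow> s < n \<Longrightarrow> continuous_map T euclideanreal (\<lambda>x. A x r s)"
  shows "\<exists>B. (\<forall>r<n. \<forall>s<n. continuous_map T euclideanreal (\<lambda>x. B x r s)) \<and>
    (\<forall>x \<in> topspace T. \<forall>r<n. \<forall>s<n. (\<Sum>t<n. B x r t * A x t s) = (if r = s then 1 else 0) \<and>
       (\<Sum>t<n. A x r t * B x t s) = (if r = s then 1 else 0))"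
proof -
  define M where "M x = mat n n (\<lambda>(r, s). A x r s)" for x
  have M: "M x \<in> carrier_mat n n" for x by (simp add: M_def)
  have Mi: "M x $$ (r, s) = A x r s" if "r < n" "s < n" for x r s using that by (simp add: M_def)
  have detM: "continuous_map T euclideanreal (\<lambda>x. Determinant.det (M x))"
    by (rule continuous_map_det[OF M]) (simp add: Mi cont)
  have nz: "Determinant.det (M x) \<noteq> 0" if "x \<in> topspace T" for x
  proof
    assume "Determinant.det (M x) = 0"
    then obtain v where v: "v \<in> carrier_vec n" "v \<noteq> 0\<^sub>v n" "M x *\<^sub>v v = 0\<^sub>v n"
      using det_0_iff_vec_prod_zero[OF M] by blast
    define v' where "v' i = (if i < n then vec_index v i else 0)" for i
    have "(\<Sum>s<n. A x r s * v' s) = 0" if "r < n" for r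
    proof -
      have "vec_index (M x *\<^sub>v v) r = (\<Sum>s<n. A x r s * v' s)"
        using that v(1) by (simp add: M_def scalar_prod_def v'_def lessThan_atLeast0)
      then show ?thesis using v(3) that by simp
    qed
    moreover have "v' \<in> Vec n" by (simp add: Vec_iff v'_def)
    ultimately have "v' = (\<lambda>_. 0)" using inj[OF \<open>x \<in> topspace T\<close>] by blast
    then have "v = 0\<^sub>v n"
      using v(1) by (intro eq_vecI) (auto simp: v'_def fun_eq_iff split: if_splits)
    with v(2) show False by simp
  qed
  define B where "B x r s = adj_mat (M x) $$ (r, s) / Determinant.det (M x)" for x r s
  have "continuous_map T euclideanreal (\<lambda>x. B x r s)" if "r < n" "s < n" for r s
  proof -
    have "continuous_map T euclideanreal (\<lambda>x. Determinant.det (mat_delete (M x) s r))"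
    proof (rule continuous_map_det[where n = "n - 1"])
      show "mat_delete (M x) s r \<in> carrier_mat (n - 1) (n - 1)" for x
        using M[of x] by (simp add: mat_delete_def)
      fix i j assume ij: "i < n - 1" "j < n - 1"
      then have "mat_delete (M x) s r $$ (i, j)
         = A x (if i < s then i else Suc i) (if j < r then j else Suc j)" for x
        using M[of x] by (auto simp: mat_delete_def M_def)
      then show "continuous_map T euclideanreal (\<lambda>x. mat_delete (M x) s r $$ (i, j))"
        using ij cont by auto
    qed
    moreover have "adj_mat (M x) $$ (r, s) = (-1) ^ (s + r) * Determinant.det (mat_delete (M x) s r)" for x
      using that M[of x] by (simp add: adj_mat_def cofactor_def)
    ultimately show ?thesis
      unfolding B_def using detM nz
      by (auto intro!: continuous_map_real_divide continuous_map_real_mult)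
  qed
  moreover have "(\<Sum>t<n. B x r t * A x t s) = (if r = s then 1 else 0)"
    if x: "x \<in> topspace T" and rs: "r < n" "s < n" for x r s
  proof -
    have "(\<Sum>t<n. adj_mat (M x) $$ (r, t) * A x t s) = (adj_mat (M x) * M x) $$ (r, s)"
      using rs adj_mat(1)[OF M, of x] M[of x] by (simp add: scalar_prod_def lessThan_atLeast0 Mi)
    also have "\<dots> = (if r = s then Determinant.det (M x) else 0)"
      using rs by (simp add: adj_mat(3)[OF M])
    finally show ?thesis
      using nz[OF x] by (simp add: B_def flip: sum_divide_distrib)
  qed
  moreover have "(\<Sum>t<n. A x r t * B x t s) = (if r = s then 1 else 0)"
    if x: "x \<in> topspace T" and rs: "r < n" "s < n" for x r s
  proof -
    have "(\<Sum>t<n. A x r t * adj_mat (M x) $$ (t, s)) = (M x * adj_mat (M x)) $$ (r, s)"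
      using rs adj_mat(1)[OF M, of x] M[of x] by (simp add: scalar_prod_def lessThan_atLeast0 Mi)
    also have "\<dots> = (if r = s then Determinant.det (M x) else 0)"
      using rs by (simp add: adj_mat(2)[OF M])
    finally show ?thesis
      using nz[OF x] by (simp add: B_def flip: sum_divide_distrib)
  qed
  ultimately show ?thesis by blast
qed


section \<open>Rank\<close>

definition fibre_frame :: "('b, 'e) vbundle \<Rightarrow> 'b \<Rightarrow> nat \<Rightarrow> ('e \<Rightarrow> nat \<Rightarrow> real) \<Rightarrow> bool" where
  "fibre_frame E x n h \<longleftrightarrow> bij_betw h (fibre E x) (Vec n) \<and>
     (\<forall>v \<in> fibre E x. \<forall>w \<in> fibre E x. h (fib_add E v w) = (\<lambda>i. h v i + h w i)) \<and>
     (\<forall>c. \<forall>v \<in> fibre E x. h (fib_scale E c v) = (\<lambda>i. c * h v i))"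

text \<open>The change from one frame to another is a linear isomorphism of coordinate spaces.\<close>

lemma fibre_frame_unique:
  assumes E: "fibre_closed E" and h: "fibre_frame E x n h" and k: "fibre_frame E x m k"
  shows "n = m"
proof -
  have lin: "vec_linear n (\<lambda>v. k (inv_into (fibre E x) h v))"
    if "fibre_frame E x n h" "fibre_frame E x m k" for n m h k
  proof -
    let ?i = "inv_into (fibre E x) h"
    have b: "bij_betw h (fibre E x) (Vec n)" using that by (simp add: fibre_frame_def)
    have i: "?i v \<in> fibre E x" "h (?i v) = v" if "v \<in> Vec n" for v
      using b that by (auto simp: bij_betw_def inv_into_into f_inv_into_f)
    have ih: "?i (h u) = u" if "u \<in> fibre E x" for u
      using b that by (simp add: bij_betw_def)
    have "?i (\<lambda>i. v i + w i) = fib_add E (?i v) (?i w)" if "v \<in> Vec n" "w \<in> Vec n" for v w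
      using ih[OF fibre_closedD(1)[OF E i(1)[OF that(1)] i(1)[OF that(2)]]] \<open>fibre_frame E x n h\<close> i that
      by (simp add: fibre_frame_def)
    moreover have "?i (\<lambda>i. c * v i) = fib_scale E c (?i v)" if "v \<in> Vec n" for c v
      using ih[OF fibre_closedD(2)[OF E i(1)[OF that]]] \<open>fibre_frame E x n h\<close> i that
      by (simp add: fibre_frame_def)
    ultimately show ?thesis
      using \<open>fibre_frame E x m k\<close> i unfolding vec_linear_def fibre_frame_def by auto
  qed
  have bh: "bij_betw h (fibre E x) (Vec n)" and bk: "bij_betw k (fibre E x) (Vec m)"
    using h k by (simp_all add: fibre_frame_def)
  show ?thesis
  proof (rule vec_dim_unique[OF lin[OF h k] _ lin[OF k h]])
    fix v assume "v \<in> Vec n"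
    then show "k (inv_into (fibre E x) h v) \<in> Vec m"
      using bh bk by (metis bij_betw_apply bij_betw_inv_into)
    show "h (inv_into (fibre E x) k (k (inv_into (fibre E x) h v))) = v"
      using bh bk \<open>v \<in> Vec n\<close>
      by (metis bij_betw_apply bij_betw_inv_into bij_betw_inv_into_left bij_betw_inv_into_right)
  next
    fix v assume "v \<in> Vec m"
    then show "h (inv_into (fibre E x) k v) \<in> Vec n"
      using bh bk by (metis bij_betw_apply bij_betw_inv_into)
    show "k (inv_into (fibre E x) h (h (inv_into (fibre E x) k v))) = v"
      using bh bk \<open>v \<in> Vec m\<close>
      by (metis bij_betw_apply bij_betw_inv_into bij_betw_inv_into_left bij_betw_inv_into_right)
  qed
qed

lemma bundle_rank_eqI:
  assumes "fibre_closed E" "fibre_frame E x n h"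
  shows "bundle_rank E x = n"
  unfolding bundle_rank_def fibre_frame_def[symmetric]
  using fibre_frame_unique[OF assms(1) _ assms(2)] assms(2) by blast

lemma fibre_frame_pullback:
  assumes f: "bundle_iso_map E F f" and h: "fibre_frame F x n h"
  shows "fibre_frame E x n (h \<circ> f)"
proof -
  have bf: "bundle_map E F f" and hf: "homeomorphic_map (tot E) (tot F) f"
    using f by (auto simp: bundle_iso_map_def)
  have inj: "inj_on f (topspace (tot E))" and surj: "f ` topspace (tot E) = topspace (tot F)"
    using hf homeomorphic_imp_injective_map homeomorphic_imp_surjective_map by blast+
  have "f ` fibre E x = fibre F x"
  proof
    show "f ` fibre E x \<subseteq> fibre F x" using bundle_map_fibre[OF bf] by auto
    show "fibre F x \<subseteq> f ` fibre E x"
    proof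
      fix w assume w: "w \<in> fibre F x"
      then obtain v where v: "v \<in> topspace (tot E)" "f v = w" using surj unfolding in_fibre by (metis imageE)
      then have "proj E v = x" using bf w by (auto simp: bundle_map_def in_fibre)
      then show "w \<in> f ` fibre E x" using v by (auto simp: in_fibre)
    qed
  qed
  moreover have "inj_on f (fibre E x)" using inj by (rule inj_on_subset) (auto simp: in_fibre)
  ultimately have "bij_betw f (fibre E x) (fibre F x)" by (simp add: bij_betw_def)
  moreover have "h (f (fib_add E v w)) = (\<lambda>i. h (f v) i + h (f w) i)"
    if "v \<in> fibre E x" "w \<in> fibre E x" for v w
    using h that bundle_map_fibre[OF bf] by (simp add: bundle_map_add[OF bf that] fibre_frame_def)
  moreover have "h (f (fib_scale E c v)) = (\<lambda>i. c * h (f v) i)" if "v \<in> fibre E x" for c v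
    using h that bundle_map_fibre[OF bf] bundle_map_scale[OF bf] by (auto simp: fibre_frame_def in_fibre)
  ultimately show ?thesis
    using h unfolding fibre_frame_def by (auto intro: bij_betw_trans)
qed

lemma fibre_frame_trivial: "x \<in> topspace X \<Longrightarrow> fibre_frame (trivial_bundle X n) x n snd"
  by (auto simp: fibre_frame_def fibre_trivial bij_betw_def inj_on_def image_iff)

lemma fibre_frame_restrict: "x \<in> U \<Longrightarrow> fibre_frame (restrict_bundle E U) x n h \<longleftrightarrow> fibre_frame E x n h"
  by (simp add: fibre_frame_def fibre_restrict)

lemma bundle_rank_local:
  assumes E: "fibre_closed E" and iso: "bundle_iso (trivial_bundle (subtopology X U) n) (restrict_bundle E U)"
    and x: "x \<in> U" "x \<in> topspace X"
  shows "bundle_rank E x = n" "\<exists>h. fibre_frame E x n h"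
proof -
  obtain g where g: "bundle_iso_map (restrict_bundle E U) (trivial_bundle (subtopology X U) n) g"
    using bundle_iso_sym[OF iso fibre_closed_trivial] by (auto simp: bundle_iso_iff)
  have "fibre_frame E x n (snd \<circ> g)"
    using fibre_frame_pullback[OF g fibre_frame_trivial] x by (simp add: fibre_frame_restrict)
  then show "bundle_rank E x = n" "\<exists>h. fibre_frame E x n h"
    using bundle_rank_eqI[OF E] by blast+
qed

lemma vector_bundle_frame:
  assumes E: "vector_bundle X E" and x: "x \<in> topspace X"
  obtains h where "fibre_frame E x (bundle_rank E x) h"
  using vector_bundle_local[OF E x] bundle_rank_local[OF vector_bundle_fibre_closed[OF E] _ _ x] by metis

lemma bundle_rank_iso:
  assumes iso: "bundle_iso E F" and F: "vector_bundle X F" and x: "x \<in> topspace X" and E: "fibre_closed E"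
  shows "bundle_rank E x = bundle_rank F x"
proof -
  obtain h where "fibre_frame F x (bundle_rank F x) h" using vector_bundle_frame[OF F x] .
  then show ?thesis
    using iso bundle_rank_eqI[OF E] fibre_frame_pullback by (metis bundle_iso_iff)
qed

lemma bundle_rank_trivial: "x \<in> topspace X \<Longrightarrow> bundle_rank (trivial_bundle X n) x = n"
  using bundle_rank_eqI[OF fibre_closed_trivial fibre_frame_trivial] .


section \<open>Injective bundle maps between bundles of equal rank\<close>

text \<open>The map has the form \<open>(x, v) \<mapsto> (x, A x v)\<close> with \<open>A\<close> a continuous family of injective square
  matrices, and the inverse family is continuous as well.\<close>

lemma trivial_bundle_map_homeomorphic:
  assumes f: "bundle_map (trivial_bundle T n) (trivial_bundle T n) f"
    and inj: "\<And>x v. x \<in> topspace T \<Longrightarrow> v \<in> Vec n \<Longrightarrow> snd (f (x, v)) = (\<lambda>_. 0) \<Longrightarrow> v = (\<lambda>_. 0)"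
  shows "homeomorphic_map (tot (trivial_bundle T n)) (tot (trivial_bundle T n)) f"
proof -
  let ?P = "prod_topology T (Euclidean_space n)"
  define L where "L x v = snd (f (x, v))" for x v
  have cf: "continuous_map ?P ?P f" using f by (simp add: bundle_map_def)
  have fL: "f (x, v) = (x, L x v)" if "x \<in> topspace T" "v \<in> Vec n" for x v
    using f that by (auto simp: bundle_map_def L_def prod_eq_iff)
  have LV: "L x v \<in> Vec n" if "x \<in> topspace T" "v \<in> Vec n" for x v
  proof -
    have "f (x, v) \<in> topspace T \<times> Vec n" using cf that by (auto simp: continuous_map_def Pi_iff)
    then show ?thesis using fL[OF that] by simp
  qed
  have lin: "vec_linear n (L x)" if "x \<in> topspace T" for x
    unfolding vec_linear_def
  proof (intro conjI ballI allI)
    fix v w assume vw: "v \<in> Vec n" "w \<in> Vec n"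
    with that have "(x, v) \<in> fibre (trivial_bundle T n) x" "(x, w) \<in> fibre (trivial_bundle T n) x"
      by (auto simp: fibre_trivial)
    from bundle_map_add[OF f this] show "L x (\<lambda>i. v i + w i) = (\<lambda>i. L x v i + L x w i)"
      using that vw fL by simp
  next
    fix c and v assume v: "v \<in> Vec n"
    with that have "(x, v) \<in> topspace (tot (trivial_bundle T n))" by simp
    from bundle_map_scale[OF f this, of c] show "L x (\<lambda>i. c * v i) = (\<lambda>i. c * L x v i)"
      using that v fL by simp
  qed
  define A where "A x r s = L x (axis_vec s) r" for x r s
  have Lv: "L x v r = (\<Sum>s<n. A x r s * v s)" if "x \<in> topspace T" "v \<in> Vec n" for x v r
    unfolding A_def using vec_linear_expand[OF lin[OF that(1)] that(2)] .
  have contA: "continuous_map T euclideanreal (\<lambda>x. A x r s)" if "r < n" "s < n" for r s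
  proof -
    have "continuous_map T ?P (\<lambda>x. (x, axis_vec s))"
      using axis_vec_Vec[OF that(2)] by (simp add: continuous_map_pairedI)
    from continuous_map_snd_of[OF continuous_map_compose[OF this cf, unfolded o_def]]
    show ?thesis unfolding A_def L_def by (intro continuous_map_Euclidean_coord) (simp add: o_def)
  qed
  have injA: "v = (\<lambda>_. 0)" if x: "x \<in> topspace T" and v: "v \<in> Vec n"
     and z: "\<And>r. r < n \<Longrightarrow> (\<Sum>s<n. A x r s * v s) = 0" for x v
  proof (rule inj[OF x v])
    have "L x v r = 0" for r
      using z[of r] Lv[OF x v, of r] LV[OF x v] by (cases "r < n") (auto simp: Vec_iff)
    then show "snd (f (x, v)) = (\<lambda>_. 0)" by (auto simp: L_def)
  qed
  let ?inverse = "\<lambda>B. (\<forall>r<n. \<forall>s<n. continuous_map T euclideanreal (\<lambda>x. B x r s)) \<and>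
    (\<forall>x \<in> topspace T. \<forall>r<n. \<forall>s<n. (\<Sum>t<n. B x r t * A x t s) = (if r = s then 1 else 0) \<and>
       (\<Sum>t<n. A x r t * B x t s) = (if r = s then 1 else 0))"
  have "\<exists>B. ?inverse B"
    by (rule continuous_matrix_inverse) (use injA contA in \<open>blast+\<close>)
  then obtain B where B: "?inverse B" by blast
  note BA = B[THEN conjunct2, rule_format, THEN conjunct1] and AB = B[THEN conjunct2, rule_format, THEN conjunct2]
  define K where "K x w = (\<lambda>r. if r < n then \<Sum>t<n. B x r t * w t else 0)" for x w
  have KV: "K x w \<in> Vec n" for x w by (simp add: K_def Vec_iff)
  have mm: "(\<Sum>t<n. P t * (\<Sum>s<n. Q t s * v s)) = (\<Sum>s<n. (\<Sum>t<n. P t * Q t s) * v s)"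
    for P :: "nat \<Rightarrow> real" and Q and v
    by (simp only: sum_distrib_left sum_distrib_right mult.assoc) (rule sum.swap)
  have KL: "K x (L x v) = v" if "x \<in> topspace T" "v \<in> Vec n" for x v
  proof
    fix r show "K x (L x v) r = v r"
    proof (cases "r < n")
      case True
      then have "K x (L x v) r = (\<Sum>s<n. (\<Sum>t<n. B x r t * A x t s) * v s)"
        by (simp add: K_def Lv[OF that] mm)
      also have "\<dots> = (\<Sum>s<n. if r = s then v s else 0)"
        by (rule sum.cong) (simp_all add: BA[OF that(1) True])
      finally show ?thesis using True by simp
    qed (use KV that(2) in \<open>auto simp: Vec_iff\<close>)
  qed
  have LK: "L x (K x w) = w" if "x \<in> topspace T" "w \<in> Vec n" for x w
  proof
    fix r show "L x (K x w) r = w r"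
    proof (cases "r < n")
      case True
      have "L x (K x w) r = (\<Sum>s<n. A x r s * (\<Sum>t<n. B x s t * w t))"
        unfolding Lv[OF that(1) KV] by (simp add: K_def)
      also have "\<dots> = (\<Sum>t<n. if r = t then w t else 0)"
        unfolding mm by (rule sum.cong) (simp_all add: AB[OF that(1) True])
      finally show ?thesis using True by simp
    qed (use LV[OF that(1) KV] that(2) in \<open>auto simp: Vec_iff\<close>)
  qed
  have contK: "continuous_map ?P (Euclidean_space n) (\<lambda>z. K (fst z) (snd z))"
    unfolding continuous_map_into_Euclidean_space
  proof (intro conjI ballI allI impI)
    fix r assume "r < n"
    have "continuous_map ?P euclideanreal (\<lambda>z. \<Sum>t<n. B (fst z) r t * snd z t)"
    proof (intro continuous_map_sum continuous_map_real_mult)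
      fix t assume "t \<in> {..<n}"
      then show "continuous_map ?P euclideanreal (\<lambda>z. B (fst z) r t)"
        using continuous_map_compose[OF continuous_map_fst B[THEN conjunct1, rule_format, of r t]] \<open>r < n\<close>
        by (simp add: o_def)
      show "continuous_map ?P euclideanreal (\<lambda>z. snd z t)"
        by (rule continuous_map_Euclidean_coord[OF continuous_map_snd])
    qed simp
    then show "continuous_map ?P euclideanreal (\<lambda>z. K (fst z) (snd z) r)"
      using \<open>r < n\<close> by (simp add: K_def)
  qed (simp add: K_def)
  have "homeomorphic_maps ?P ?P f (\<lambda>z. (fst z, K (fst z) (snd z)))"
    unfolding homeomorphic_maps_def using cf contK KL LK
    by (auto simp: fL LV KV intro!: continuous_map_pairedI continuous_map_fst)
  then show ?thesis
    using homeomorphic_maps_map by auto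
qed

text \<open>Equal ranks make the matrices in local trivialisations square, so that injectivity already
  gives an inverse, continuous by Cramer's rule; being a homeomorphism is then local in the base.
  The zero vector of the fibre of \<open>v\<close> is written as the multiple \<open>0 v\<close>. This lemma reduces every
  isomorphism between concrete bundles below to an injectivity argument in a single fibre.\<close>

lemma injective_bundle_map_iso:
  assumes E: "vector_bundle X E" and F: "vector_bundle X F"
    and rank: "\<And>x. x \<in> topspace X \<Longrightarrow> bundle_rank E x = bundle_rank F x"
    and f: "bundle_map E F f"
    and inj: "\<And>v. v \<in> topspace (tot E) \<Longrightarrow> f v = fib_scale F 0 (f v) \<Longrightarrow> v = fib_scale E 0 v"
  shows "bundle_iso_map E F f"
proof -
  note Ec = vector_bundle_fibre_closed[OF E] and Fc = vector_bundle_fibre_closed[OF F]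
  have local: "\<exists>U. openin X U \<and> x \<in> U \<and>
      homeomorphic_map (tot (restrict_bundle E U)) (tot (restrict_bundle F U)) f"
    if x: "x \<in> topspace X" for x
  proof -
    obtain U n where U: "openin X U" "x \<in> U"
      "bundle_iso (trivial_bundle (subtopology X U) n) (restrict_bundle E U)"
      using vector_bundle_local[OF E x] .
    obtain V m where V: "openin X V" "x \<in> V"
      "bundle_iso (trivial_bundle (subtopology X V) m) (restrict_bundle F V)"
      using vector_bundle_local[OF F x] .
    define W where "W = U \<inter> V"
    let ?T = "subtopology X W" and ?E = "restrict_bundle E W" and ?F = "restrict_bundle F W"
    have W: "openin X W" "x \<in> W" using U V by (auto simp: W_def)
    have "n = m"
      using bundle_rank_local(1)[OF Ec U(3) U(2) x] bundle_rank_local(1)[OF Fc V(3) V(2) x] rank[OF x] by simp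
    obtain h where h: "bundle_iso_map (trivial_bundle ?T n) ?E h"
      using bundle_iso_restrict_trivial_smaller[OF U(3), of V] by (auto simp: W_def bundle_iso_iff)
    obtain k where k: "bundle_iso_map (trivial_bundle ?T n) ?F k"
      using bundle_iso_restrict_trivial_smaller[OF V(3), of U] \<open>n = m\<close>
      by (auto simp: W_def bundle_iso_iff Int_commute)
    obtain h' where h': "bundle_iso_map ?E (trivial_bundle ?T n) h'"
      and hh': "\<And>v. v \<in> topspace (tot ?E) \<Longrightarrow> h (h' v) = v"
      using bundle_iso_map_inverse[OF h fibre_closed_trivial] by metis
    obtain k' where k': "bundle_iso_map ?F (trivial_bundle ?T n) k'"
      and kk': "\<And>v. v \<in> topspace (tot ?F) \<Longrightarrow> k (k' v) = v"
      using bundle_iso_map_inverse[OF k fibre_closed_trivial] by metis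
    have bms: "bundle_map (trivial_bundle ?T n) ?E h" "bundle_map ?F (trivial_bundle ?T n) k'"
      "bundle_map ?E (trivial_bundle ?T n) h'" "bundle_map (trivial_bundle ?T n) ?F k"
      using h k' h' k by (auto simp: bundle_iso_map_def)
    have fr: "bundle_map ?E ?F f" using bundle_map_restrict[OF f] .
    let ?g = "k' \<circ> f \<circ> h"
    have g: "bundle_map (trivial_bundle ?T n) (trivial_bundle ?T n) ?g"
      using bundle_map_compose[OF bms(1) bundle_map_compose[OF fr bms(2)]] by (simp add: comp_assoc)
    have "homeomorphic_map (tot (trivial_bundle ?T n)) (tot (trivial_bundle ?T n)) ?g"
    proof (rule trivial_bundle_map_homeomorphic[OF g])
      fix y v assume y: "y \<in> topspace ?T" and v: "v \<in> Vec n" and z: "snd (?g (y, v)) = (\<lambda>_. 0)"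
      have yv: "(y, v) \<in> fibre (trivial_bundle ?T n) y" using y v by (simp add: fibre_trivial)
      define u where "u = h (y, v)"
      have u: "u \<in> fibre ?E y" using bundle_map_fibre[OF bms(1) yv] by (simp add: u_def)
      then have uE: "u \<in> topspace (tot E)" by (auto simp: in_fibre)
      have fu: "f u \<in> fibre ?F y" using bundle_map_fibre[OF fr u] .
      have k'fu: "k' (f u) = fib_scale (trivial_bundle ?T n) 0 (k' (f u))"
        using z bundle_map_fibre[OF bms(2) fu] by (auto simp: u_def fibre_trivial split: if_splits)
      have "f u = k (k' (f u))" using kk'[of "f u"] fu by (auto simp: in_fibre)
      also have "\<dots> = k (fib_scale (trivial_bundle ?T n) 0 (k' (f u)))" using k'fu by simp
      also have "\<dots> = fib_scale ?F 0 (k (k' (f u)))"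
        using bundle_map_fibre[OF bms(2) fu] by (intro bundle_map_scale[OF bms(4)]) (simp add: in_fibre)
      also have "\<dots> = fib_scale F 0 (f u)" using kk'[of "f u"] fu by (auto simp: in_fibre)
      finally have "u = fib_scale E 0 u" using inj[OF uE] by simp
      also have "\<dots> = fib_scale ?E 0 (h (y, v))" by (simp add: u_def)
      also have "\<dots> = h (fib_scale (trivial_bundle ?T n) 0 (y, v))"
        using yv by (intro bundle_map_scale[OF bms(1), symmetric]) (simp add: in_fibre)
      finally have "h (y, v) = h (y, \<lambda>_. 0)" by (simp add: u_def)
      moreover have "inj_on h (topspace (tot (trivial_bundle ?T n)))"
        using h homeomorphic_imp_injective_map unfolding bundle_iso_map_def by blast
      moreover have "(y, \<lambda>_. 0) \<in> topspace (tot (trivial_bundle ?T n))" "(y, v) \<in> topspace (tot (trivial_bundle ?T n))"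
        using y v by (auto simp: Vec_iff)
      ultimately show "v = (\<lambda>_. 0)" by (auto dest: inj_onD)
    qed
    then have "homeomorphic_map (tot ?E) (tot ?F) (k \<circ> (?g \<circ> h'))"
      using h' k by (meson bundle_iso_map_def homeomorphic_map_compose)
    then have "homeomorphic_map (tot ?E) (tot ?F) f"
    proof (rule homeomorphic_map_eq)
      fix v assume v: "v \<in> topspace (tot ?E)"
      then have "f v \<in> topspace (tot ?F)"
        using fr by (auto simp: bundle_map_def continuous_map_def Pi_iff)
      then show "(k \<circ> (?g \<circ> h')) v = f v" using v hh' kk' by simp
    qed
    then show ?thesis using W by blast
  qed
  have projE: "proj E v \<in> topspace X" if "v \<in> topspace (tot E)" for v using vector_bundle_proj_in[OF E that] .
  have projF: "proj F v \<in> topspace X" if "v \<in> topspace (tot F)" for v using vector_bundle_proj_in[OF F that] .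
  have pf: "proj F (f v) = proj E v" if "v \<in> topspace (tot E)" for v using f that by (simp add: bundle_map_def)
  have "homeomorphic_map (tot E) (tot F) f"
  proof (rule bijective_open_imp_homeomorphic_map)
    show cf: "continuous_map (tot E) (tot F) f" using f by (simp add: bundle_map_def)
    show "f ` topspace (tot E) = topspace (tot F)"
    proof
      show "f ` topspace (tot E) \<subseteq> topspace (tot F)" using cf by (auto simp: continuous_map_def)
      show "topspace (tot F) \<subseteq> f ` topspace (tot E)"
      proof
        fix w assume w: "w \<in> topspace (tot F)"
        obtain U where U: "proj F w \<in> U"
          "homeomorphic_map (tot (restrict_bundle E U)) (tot (restrict_bundle F U)) f"
          using local[OF projF[OF w]] by blast
        have "w \<in> topspace (tot (restrict_bundle F U))" using w U(1) by simp
        then have "w \<in> f ` topspace (tot (restrict_bundle E U))"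
          using homeomorphic_imp_surjective_map[OF U(2)] by simp
        then show "w \<in> f ` topspace (tot E)" by auto
      qed
    qed
    show "inj_on f (topspace (tot E))"
    proof (rule inj_onI)
      fix v w assume v: "v \<in> topspace (tot E)" and w: "w \<in> topspace (tot E)" and eq: "f v = f w"
      obtain U where U: "proj E v \<in> U"
        "homeomorphic_map (tot (restrict_bundle E U)) (tot (restrict_bundle F U)) f"
        using local[OF projE[OF v]] by blast
      moreover have "proj E w = proj E v" using pf v w eq by metis
      ultimately show "v = w"
        using homeomorphic_imp_injective_map[OF U(2)] v w eq by (auto dest: inj_onD)
    qed
    show "open_map (tot E) (tot F) f"
      unfolding open_map_def
    proof (intro allI impI)
      fix O' assume O': "openin (tot E) O'"
      show "openin (tot F) (f ` O')"
      proof (subst openin_subopen, intro ballI)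
        fix w assume "w \<in> f ` O'"
        then obtain v where v: "v \<in> O'" "w = f v" by auto
        then have vE: "v \<in> topspace (tot E)" using O' openin_subset by blast
        obtain U where U: "openin X U" "proj E v \<in> U"
          "homeomorphic_map (tot (restrict_bundle E U)) (tot (restrict_bundle F U)) f"
          using local[OF projE[OF vE]] by blast
        let ?S = "O' \<inter> {v. proj E v \<in> U}"
        have "openin (tot (restrict_bundle E U)) ?S"
          using O' by (auto simp: openin_subtopology)
        then have "openin (tot (restrict_bundle F U)) (f ` ?S)"
          using U(3) by (meson homeomorphic_imp_open_map open_map_def)
        moreover have "openin (tot F) (topspace (tot F) \<inter> {v. proj F v \<in> U})"
          using openin_continuous_map_preimage[OF vector_bundle_proj[OF F] U(1)] by (simp add: Int_def)
        ultimately have "openin (tot F) (f ` ?S)"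
          by (metis openin_trans_full restrict_bundle_simps(1) subtopology_restrict)
        then show "\<exists>T. openin (tot F) T \<and> w \<in> T \<and> T \<subseteq> f ` O'"
          using v U(2) by (intro exI[of _ "f ` ?S"]) auto
      qed
    qed
  qed
  with f show ?thesis by (simp add: bundle_iso_map_def)
qed


section \<open>Whitney sums\<close>

lemma whitney_sum_simps [simp]:
  "tot (whitney_sum E F) = subtopology (prod_topology (tot E) (tot F)) {(v, w). proj E v = proj F w}"
  "proj (whitney_sum E F) = (\<lambda>(v, w). proj E v)"
  "fib_add (whitney_sum E F) = (\<lambda>(v, w) (v', w'). (fib_add E v v', fib_add F w w'))"
  "fib_scale (whitney_sum E F) = (\<lambda>c (v, w). (fib_scale E c v, fib_scale F c w))"
  by (simp_all add: whitney_sum_def)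

lemma fibre_whitney: "fibre (whitney_sum E F) x = fibre E x \<times> fibre F x"
  by (auto simp: fibre_def)

lemma fibre_closed_whitney:
  "fibre_closed E \<Longrightarrow> fibre_closed F \<Longrightarrow> fibre_closed (whitney_sum E F)"
  by (auto simp: fibre_closed_def fibre_whitney)

lemma continuous_map_whitneyI:
  assumes "continuous_map T (tot E) f" "continuous_map T (tot F) g"
    and "\<And>z. z \<in> topspace T \<Longrightarrow> proj E (f z) = proj F (g z)"
  shows "continuous_map T (tot (whitney_sum E F)) (\<lambda>z. (f z, g z))"
  using assms by (auto simp: continuous_map_in_subtopology intro: continuous_map_pairedI)

lemma continuous_map_whitney_fst: "continuous_map (tot (whitney_sum E F)) (tot E) fst"
  and continuous_map_whitney_snd: "continuous_map (tot (whitney_sum E F)) (tot F) snd"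
  by (auto intro: continuous_map_from_subtopology continuous_map_fst continuous_map_snd)

lemma continuous_map_from_whitney_fst:
  "continuous_map (tot E) Y a \<Longrightarrow> continuous_map (tot (whitney_sum E F)) Y (\<lambda>z. a (fst z))"
  and continuous_map_from_whitney_snd:
  "continuous_map (tot F) Y b \<Longrightarrow> continuous_map (tot (whitney_sum E F)) Y (\<lambda>z. b (snd z))"
  using continuous_map_compose[OF continuous_map_whitney_fst, of E Y a F]
    continuous_map_compose[OF continuous_map_whitney_snd, of F Y b E] by (simp_all add: o_def)

lemma bundle_iso_mapI:
  assumes "bundle_map E F f" "continuous_map (tot F) (tot E) g"
    and "\<And>v. v \<in> topspace (tot E) \<Longrightarrow> g (f v) = v" "\<And>w. w \<in> topspace (tot F) \<Longrightarrow> f (g w) = w"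
  shows "bundle_iso_map E F f"
proof -
  have "homeomorphic_maps (tot E) (tot F) f g"
    using assms by (auto simp: homeomorphic_maps_def bundle_map_def)
  then show ?thesis
    using assms(1) homeomorphic_maps_map by (auto simp: bundle_iso_map_def)
qed

text \<open>Closedness of the fibres provides the inverse bundle maps, whose product is the inverse.\<close>

lemma whitney_sum_cong:
  assumes E: "bundle_iso E E'" and F: "bundle_iso F F'"
    and Ec: "fibre_closed E" and Fc: "fibre_closed F"
  shows "bundle_iso (whitney_sum E F) (whitney_sum E' F')"
proof -
  obtain f where f: "bundle_iso_map E E' f" using E by (auto simp: bundle_iso_iff)
  obtain g where g: "bundle_iso_map F F' g" using F by (auto simp: bundle_iso_iff)
  obtain f' where f': "bundle_iso_map E' E f'"
    and ff': "\<And>v. v \<in> topspace (tot E) \<Longrightarrow> f' (f v) = v" "\<And>w. w \<in> topspace (tot E') \<Longrightarrow> f (f' w) = w"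
    using bundle_iso_map_inverse[OF f Ec] by metis
  obtain g' where g': "bundle_iso_map F' F g'"
    and gg': "\<And>v. v \<in> topspace (tot F) \<Longrightarrow> g' (g v) = v" "\<And>w. w \<in> topspace (tot F') \<Longrightarrow> g (g' w) = w"
    using bundle_iso_map_inverse[OF g Fc] by metis
  have *: "continuous_map (tot (whitney_sum A B)) (tot (whitney_sum A' B')) (\<lambda>z. (a (fst z), b (snd z)))"
    if "bundle_iso_map A A' a" "bundle_iso_map B B' b" for A :: "('x, 'y) vbundle" and B :: "('x, 'z) vbundle"
      and A' :: "('x, 'u) vbundle" and B' :: "('x, 'v) vbundle" and a b
  proof (rule continuous_map_whitneyI)
    show "continuous_map (tot (whitney_sum A B)) (tot A') (\<lambda>z. a (fst z))"
      using that by (intro continuous_map_from_whitney_fst) (simp add: bundle_iso_map_def bundle_map_def)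
    show "continuous_map (tot (whitney_sum A B)) (tot B') (\<lambda>z. b (snd z))"
      using that by (intro continuous_map_from_whitney_snd) (simp add: bundle_iso_map_def bundle_map_def)
  qed (use that in \<open>auto simp: bundle_iso_map_def bundle_map_def\<close>)
  have bf: "bundle_map E E' f" and bg: "bundle_map F F' g" using f g by (auto simp: bundle_iso_map_def)
  have "bundle_map (whitney_sum E F) (whitney_sum E' F') (\<lambda>z. (f (fst z), g (snd z)))"
    using *[OF f g] bf bg bundle_map_add[OF bf] bundle_map_add[OF bg]
    unfolding bundle_map_def by (auto simp: fibre_whitney)
  then have "bundle_iso_map (whitney_sum E F) (whitney_sum E' F') (\<lambda>z. (f (fst z), g (snd z)))"
    by (rule bundle_iso_mapI[OF _ *[OF f' g']]) (auto simp: ff' gg')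
  then show ?thesis by (auto simp: bundle_iso_iff)
qed

lemma restrict_whitney:
  "restrict_bundle (whitney_sum E F) U = whitney_sum (restrict_bundle E U) (restrict_bundle F U)"
proof -
  let ?P = "prod_topology (tot E) (tot F)" and ?D = "{(v, w). proj E v = proj F w}"
  have "subtopology (subtopology ?P ?D) {z. (\<lambda>(v, w). proj E v) z \<in> U}
      = subtopology (subtopology ?P ({v. proj E v \<in> U} \<times> {w. proj F w \<in> U})) ?D"
    unfolding subtopology_subtopology by (rule arg_cong[where f = "subtopology ?P"]) auto
  then show ?thesis
    by (simp add: restrict_bundle_def whitney_sum_def subtopology_Times)
qed

lemma whitney_trivial:
  "bundle_iso (whitney_sum (trivial_bundle X n) (trivial_bundle X m)) (trivial_bundle X (n + m))"
  unfolding bundle_iso_iff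
proof (intro exI bundle_iso_mapI)
  let ?W = "whitney_sum (trivial_bundle X n) (trivial_bundle X m)" and ?T = "trivial_bundle X (n + m)"
  let ?f = "\<lambda>z. (fst (fst z), \<lambda>i. if i < n then snd (fst z) i else snd (snd z) (i - n))"
  let ?g = "\<lambda>z. ((fst z, \<lambda>i. if i < n then snd z i else 0), (fst z, \<lambda>i. snd z (i + n)))"
  have c1: "continuous_map (tot ?W) X (\<lambda>z. fst (fst z))"
    by (rule continuous_map_from_whitney_fst) (simp add: continuous_map_fst)
  have c2: "continuous_map (tot ?W) euclideanreal (\<lambda>z. snd (fst z) i)" for i
    by (rule continuous_map_Euclidean_coord[where n = n, OF continuous_map_from_whitney_fst]) (simp add: continuous_map_snd)
  have c3: "continuous_map (tot ?W) euclideanreal (\<lambda>z. snd (snd z) i)" for i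
    by (rule continuous_map_Euclidean_coord[where n = m, OF continuous_map_from_whitney_snd]) (simp add: continuous_map_snd)
  have c4: "continuous_map (tot ?T) euclideanreal (\<lambda>z. snd z i)" for i
    by (rule continuous_map_Euclidean_coord[where n = "n + m"]) (simp add: continuous_map_snd)
  show "bundle_map ?W ?T ?f"
    unfolding bundle_map_def
  proof (intro conjI ballI allI)
    show "continuous_map (tot ?W) (tot ?T) ?f"
      unfolding trivial_bundle_simps
    proof (rule continuous_map_pairedI[OF c1])
      show "continuous_map (tot ?W) (Euclidean_space (n + m))
         (\<lambda>z i. if i < n then snd (fst z) i else snd (snd z) (i - n))"
        unfolding continuous_map_into_Euclidean_space
      proof (intro conjI allI impI ballI)
        fix i show "continuous_map (tot ?W) euclideanreal
            (\<lambda>z. if i < n then snd (fst z) i else snd (snd z) (i - n))"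
          using c2 c3 by (cases "i < n") auto
      qed (auto simp: Vec_iff)
    qed
  qed (auto simp: fibre_whitney fibre_trivial split: if_splits)
  show "continuous_map (tot ?T) (tot ?W) ?g"
  proof (rule continuous_map_whitneyI)
    have "continuous_map (tot ?T) (Euclidean_space n) (\<lambda>z i. if i < n then snd z i else 0)"
      unfolding continuous_map_into_Euclidean_space using c4 by auto
    then show "continuous_map (tot ?T) (tot (trivial_bundle X n)) (\<lambda>z. (fst z, \<lambda>i. if i < n then snd z i else 0))"
      by (auto intro: continuous_map_pairedI continuous_map_fst)
    have "continuous_map (tot ?T) (Euclidean_space m) (\<lambda>z i. snd z (i + n))"
      unfolding continuous_map_into_Euclidean_space using c4 by (auto simp: Vec_iff)
    then show "continuous_map (tot ?T) (tot (trivial_bundle X m)) (\<lambda>z. (fst z, \<lambda>i. snd z (i + n)))"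
      by (auto intro: continuous_map_pairedI continuous_map_fst)
  qed simp
  show "?g (?f v) = v" if "v \<in> topspace (tot ?W)" for v
    using that by (auto simp: Vec_iff fun_eq_iff)
  show "?f (?g w) = w" if "w \<in> topspace (tot ?T)" for w
    using that by (auto simp: Vec_iff fun_eq_iff)
qed

lemma whitney_local:
  assumes E: "bundle_iso (trivial_bundle (subtopology X U) n) (restrict_bundle E U)"
    and F: "bundle_iso (trivial_bundle (subtopology X V) m) (restrict_bundle F V)"
  shows "bundle_iso (trivial_bundle (subtopology X (U \<inter> V)) (n + m)) (restrict_bundle (whitney_sum E F) (U \<inter> V))"
proof -
  let ?T = "subtopology X (U \<inter> V)"
  have "bundle_iso (trivial_bundle ?T (n + m)) (whitney_sum (trivial_bundle ?T n) (trivial_bundle ?T m))"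
    by (rule bundle_iso_sym[OF whitney_trivial]) (intro fibre_closed_whitney fibre_closed_trivial)
  moreover have "bundle_iso (whitney_sum (trivial_bundle ?T n) (trivial_bundle ?T m))
      (whitney_sum (restrict_bundle E (U \<inter> V)) (restrict_bundle F (U \<inter> V)))"
    using bundle_iso_restrict_trivial_smaller[OF E, of V] bundle_iso_restrict_trivial_smaller[OF F, of U]
    by (intro whitney_sum_cong fibre_closed_trivial) (simp_all add: Int_commute)
  ultimately show ?thesis by (auto simp: restrict_whitney intro: bundle_iso_trans)
qed

lemma vector_bundle_whitney:
  assumes E: "vector_bundle X E" and F: "vector_bundle X F"
  shows "vector_bundle X (whitney_sum E F)"
proof (rule vector_bundleI)
  show "fibre_closed (whitney_sum E F)"
    using fibre_closed_whitney[OF vector_bundle_fibre_closed[OF E] vector_bundle_fibre_closed[OF F]] .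
  show "continuous_map (tot (whitney_sum E F)) X (proj (whitney_sum E F))"
    using continuous_map_from_whitney_fst[OF vector_bundle_proj[OF E], of F]
    by (simp add: case_prod_unfold)
  fix x assume x: "x \<in> topspace X"
  obtain U n where U: "openin X U" "x \<in> U"
    "bundle_iso (trivial_bundle (subtopology X U) n) (restrict_bundle E U)"
    using vector_bundle_local[OF E x] .
  obtain V m where V: "openin X V" "x \<in> V"
    "bundle_iso (trivial_bundle (subtopology X V) m) (restrict_bundle F V)"
    using vector_bundle_local[OF F x] .
  show "\<exists>U n. openin X U \<and> x \<in> U \<and>
      bundle_iso (trivial_bundle (subtopology X U) n) (restrict_bundle (whitney_sum E F) U)"
    using openin_Int[OF U(1) V(1)] U(2) V(2) whitney_local[OF U(3) V(3)] by blast
qed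

lemma bundle_rank_whitney:
  assumes E: "vector_bundle X E" and F: "vector_bundle X F" and x: "x \<in> topspace X"
  shows "bundle_rank (whitney_sum E F) x = bundle_rank E x + bundle_rank F x"
proof -
  note Ec = vector_bundle_fibre_closed[OF E] and Fc = vector_bundle_fibre_closed[OF F]
  obtain U n where U: "openin X U" "x \<in> U"
    "bundle_iso (trivial_bundle (subtopology X U) n) (restrict_bundle E U)"
    using vector_bundle_local[OF E x] .
  obtain V m where V: "openin X V" "x \<in> V"
    "bundle_iso (trivial_bundle (subtopology X V) m) (restrict_bundle F V)"
    using vector_bundle_local[OF F x] .
  have "bundle_rank (whitney_sum E F) x = n + m"
    by (rule bundle_rank_local(1)[OF fibre_closed_whitney[OF Ec Fc] whitney_local[OF U(3) V(3)] _ x])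
      (use U(2) V(2) in simp)
  then show ?thesis
    using bundle_rank_local(1)[OF Ec U(3,2) x] bundle_rank_local(1)[OF Fc V(3,2) x] by simp
qed

lemma whitney_commute: "bundle_iso (whitney_sum E F) (whitney_sum F E)"
  unfolding bundle_iso_iff
proof (intro exI bundle_iso_mapI)
  have c: "continuous_map (tot (whitney_sum A B)) (tot (whitney_sum B A)) (\<lambda>z. (snd z, fst z))"
    for A :: "('x, 'y) vbundle" and B :: "('x, 'z) vbundle"
    by (rule continuous_map_whitneyI[OF continuous_map_whitney_snd continuous_map_whitney_fst]) auto
  show "continuous_map (tot (whitney_sum F E)) (tot (whitney_sum E F)) (\<lambda>z. (snd z, fst z))" by (rule c)
  show "bundle_map (whitney_sum E F) (whitney_sum F E) (\<lambda>z. (snd z, fst z))"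
    unfolding bundle_map_def
    by (intro conjI ballI allI c) (auto simp: fibre_whitney)
qed auto

lemma whitney_assoc:
  "bundle_iso (whitney_sum (whitney_sum E F) G) (whitney_sum E (whitney_sum F G))"
  unfolding bundle_iso_iff
proof (intro exI bundle_iso_mapI)
  let ?L = "whitney_sum (whitney_sum E F) G" and ?R = "whitney_sum E (whitney_sum F G)"
  let ?f = "\<lambda>z. (fst (fst z), (snd (fst z), snd z))" and ?g = "\<lambda>z. ((fst z, fst (snd z)), snd (snd z))"
  have c: "continuous_map (tot ?L) (tot ?R) ?f"
    by (intro continuous_map_whitneyI continuous_map_from_whitney_fst continuous_map_whitney_fst
        continuous_map_whitney_snd) auto
  show "continuous_map (tot ?R) (tot ?L) ?g"
    by (intro continuous_map_whitneyI continuous_map_from_whitney_snd continuous_map_whitney_fst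
        continuous_map_whitney_snd) auto
  show "bundle_map ?L ?R ?f"
    unfolding bundle_map_def
    by (intro conjI ballI allI c) (auto simp: fibre_whitney)
qed auto

lemma whitney_trivial_zero:
  assumes E: "vector_bundle X E"
  shows "bundle_iso (whitney_sum E (trivial_bundle X 0)) E"
  unfolding bundle_iso_iff
proof (intro exI bundle_iso_mapI)
  let ?W = "whitney_sum E (trivial_bundle X 0)"
  show "bundle_map ?W E fst"
    unfolding bundle_map_def
    by (intro conjI ballI allI continuous_map_whitney_fst) (auto simp: fibre_whitney fibre_trivial split: if_splits)
  show "continuous_map (tot E) (tot ?W) (\<lambda>v. (v, (proj E v, \<lambda>_. 0)))"
    using vector_bundle_proj[OF E]
    by (intro continuous_map_whitneyI) (auto intro!: continuous_map_pairedI simp: Vec_iff)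
qed (auto simp: Vec_iff)


section \<open>Powers of a bundle\<close>

lemma bundle_power_simps [simp]:
  "tot (bundle_power X E k) = subtopology (prod_topology X (product_topology (\<lambda>_. tot E) {..<k}))
              {(x, v). \<forall>i<k. proj E (v i) = x}"
  "proj (bundle_power X E k) = fst"
  "fib_add (bundle_power X E k) = (\<lambda>(x, v) (y, w). (x, \<lambda>i\<in>{..<k}. fib_add E (v i) (w i)))"
  "fib_scale (bundle_power X E k) = (\<lambda>c (x, v). (x, \<lambda>i\<in>{..<k}. fib_scale E c (v i)))"
  by (simp_all add: bundle_power_def)

lemma continuous_map_powerI:
  assumes "continuous_map T X f" "\<And>i. i < k \<Longrightarrow> continuous_map T (tot E) (\<lambda>z. g z i)"
    and "\<And>z. z \<in> topspace T \<Longrightarrow> g z \<in> extensional {..<k}"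
    and "\<And>z i. z \<in> topspace T \<Longrightarrow> i < k \<Longrightarrow> proj E (g z i) = f z"
  shows "continuous_map T (tot (bundle_power X E k)) (\<lambda>z. (f z, g z))"
  using assms by (auto simp: continuous_map_in_subtopology continuous_map_componentwise intro!: continuous_map_pairedI)

lemma continuous_map_power_base: "continuous_map (tot (bundle_power X E k)) X fst"
  by (auto intro: continuous_map_from_subtopology continuous_map_fst)

lemma continuous_map_power_coord:
  assumes "i < k" shows "continuous_map (tot (bundle_power X E k)) (tot E) (\<lambda>z. snd z i)"
  unfolding bundle_power_simps
  using continuous_map_compose[OF continuous_map_snd[of X "product_topology (\<lambda>_. tot E) {..<k}"] continuous_map_product_projection[of i "{..<k}" "\<lambda>_. tot E"]] assms
  by (intro continuous_map_from_subtopology) (simp add: o_def)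

lemma bundle_power_0: "bundle_iso (trivial_bundle X 0) (bundle_power X E 0)"
  unfolding bundle_iso_iff
proof (intro exI bundle_iso_mapI)
  let ?f = "\<lambda>z. (fst z, \<lambda>_. undefined)"
  have c: "continuous_map (tot (trivial_bundle X 0)) (tot (bundle_power X E 0)) ?f"
    by (rule continuous_map_powerI) (auto simp: continuous_map_fst)
  show "bundle_map (trivial_bundle X 0) (bundle_power X E 0) ?f"
    unfolding bundle_map_def
    by (intro conjI ballI allI c) (auto simp: fibre_trivial restrict_def split: if_splits)
  show "continuous_map (tot (bundle_power X E 0)) (tot (trivial_bundle X 0)) (\<lambda>z. (fst z, \<lambda>_. 0))"
    using continuous_map_power_base[of X E 0]
    by (auto intro!: continuous_map_pairedI simp: Vec_iff)
qed (auto simp: Vec_iff)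

lemma bundle_power_Suc:
  assumes Ec: "fibre_closed E"
  shows "bundle_iso (whitney_sum (bundle_power X E k) E) (bundle_power X E (Suc k))"
  unfolding bundle_iso_iff
proof (intro exI bundle_iso_mapI)
  let ?W = "whitney_sum (bundle_power X E k) E" and ?P = "bundle_power X E (Suc k)"
  let ?f = "\<lambda>z. (fst (fst z), (snd (fst z))(k := snd z))"
  let ?g = "\<lambda>z. ((fst z, restrict (snd z) {..<k}), snd z k)"
  have c: "continuous_map (tot ?W) (tot ?P) ?f"
  proof (rule continuous_map_powerI)
    show "continuous_map (tot ?W) X (\<lambda>z. fst (fst z))"
      by (rule continuous_map_from_whitney_fst[OF continuous_map_power_base])
    fix i assume i: "i < Suc k"
    show "continuous_map (tot ?W) (tot E) (\<lambda>z. ((snd (fst z))(k := snd z)) i)"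
    proof (cases "i = k")
      case True
      then show ?thesis using continuous_map_whitney_snd[of "bundle_power X E k" E] by simp
    next
      case False
      then show ?thesis
        using i continuous_map_from_whitney_fst[OF continuous_map_power_coord[of i k X E]] by simp
    qed
  qed (auto simp: PiE_def extensional_def less_Suc_eq)
  show "bundle_map ?W ?P ?f"
    unfolding bundle_map_def
    by (intro conjI ballI allI c)
       (auto simp: fibre_whitney in_fibre fun_eq_iff less_Suc_eq)
  show "continuous_map (tot ?P) (tot ?W) ?g"
    using continuous_map_power_base[of X E "Suc k"] continuous_map_power_coord[of _ "Suc k" X E]
    by (intro continuous_map_whitneyI continuous_map_powerI) auto
  show "?g (?f v) = v" if "v \<in> topspace (tot ?W)" for v
    using that by (auto simp: PiE_def extensional_def fun_eq_iff)
  show "?f (?g w) = w" if "w \<in> topspace (tot ?P)" for w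
    using that by (auto simp: PiE_def extensional_def fun_eq_iff)
qed

lemma vector_bundle_power:
  assumes E: "vector_bundle X E"
  shows "vector_bundle X (bundle_power X E k)"
proof (induction k)
  case 0 show ?case using vector_bundle_iso[OF bundle_power_0 vector_bundle_trivial] .
next
  case (Suc k)
  show ?case
    using vector_bundle_iso[OF bundle_power_Suc[OF vector_bundle_fibre_closed[OF E]] vector_bundle_whitney[OF Suc E]] .
qed

lemma bundle_rank_power:
  assumes E: "vector_bundle X E" and x: "x \<in> topspace X"
  shows "bundle_rank (bundle_power X E k) x = k * bundle_rank E x"
proof (induction k)
  case 0
  show ?case
    using bundle_rank_iso[OF bundle_power_0 vector_bundle_power[OF E] x fibre_closed_trivial] bundle_rank_trivial[OF x, of 0]
    by simp
next
  case (Suc k)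
  note Ec = vector_bundle_fibre_closed[OF E]
  have "bundle_rank (whitney_sum (bundle_power X E k) E) x = bundle_rank (bundle_power X E (Suc k)) x"
    using vector_bundle_fibre_closed[OF vector_bundle_whitney[OF vector_bundle_power[OF E, of k] E]]
    by (intro bundle_rank_iso[OF bundle_power_Suc[OF Ec] vector_bundle_power[OF E] x])
  then show ?case
    using Suc bundle_rank_whitney[OF vector_bundle_power[OF E] E x] by simp
qed


section \<open>Standard total spaces\<close>

text \<open>Coordinates with respect to an arbitrary frame of each fibre embed the total space as a set;
  its topology is transported along this injection.\<close>

lemma exists_std_bundle:
  assumes E: "vector_bundle X E"
  obtains F :: "'b std_bundle" where "vector_bundle X F" "bundle_iso E F"
proof -
  note Ec = vector_bundle_fibre_closed[OF E]
  define H where "H x = (SOME h. fibre_frame E x (bundle_rank E x) h)" for x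
  have H: "fibre_frame E x (bundle_rank E x) (H x)" if "x \<in> topspace X" for x
    unfolding H_def using vector_bundle_frame[OF E that] by (metis someI_ex)
  define f where "f v = (proj E v, H (proj E v) v)" for v
  have inj: "inj_on f (topspace (tot E))"
  proof (rule inj_onI)
    fix v w assume v: "v \<in> topspace (tot E)" and w: "w \<in> topspace (tot E)" and eq: "f v = f w"
    have "bij_betw (H (proj E v)) (fibre E (proj E v)) (Vec (bundle_rank E (proj E v)))"
      using H[OF vector_bundle_proj_in[OF E v]] by (simp add: fibre_frame_def)
    then have "inj_on (H (proj E v)) (fibre E (proj E v))" by (rule bij_betw_imp_inj_on)
    moreover have "H (proj E v) v = H (proj E v) w" "proj E v = proj E w"
      using eq by (auto simp: f_def)
    ultimately show "v = w" using v w by (metis in_fibre inj_onD)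
  qed
  define i where "i = inv_into (topspace (tot E)) f"
  have if_id: "i (f v) = v" if "v \<in> topspace (tot E)" for v
    using inj that by (simp add: i_def)
  define F :: "'b std_bundle" where
    "F = \<lparr>tot = quotient_topology (tot E) f, proj = fst,
          fib_add = (\<lambda>a b. f (fib_add E (i a) (i b))), fib_scale = (\<lambda>c a. f (fib_scale E c (i a)))\<rparr>"
  have "homeomorphic_map (tot E) (tot F) f"
    using inj quotient_map_quotient_topology by (auto simp: F_def homeomorphic_map_def)
  moreover have "fst (f v) = proj E v" for v by (simp add: f_def)
  then have "bundle_map E F f"
    using homeomorphic_imp_continuous_map[OF calculation]
    by (auto simp: bundle_map_def F_def in_fibre if_id)
  ultimately have "bundle_iso_map E F f" by (simp add: bundle_iso_map_def)
  then have "bundle_iso E F" by (auto simp: bundle_iso_iff)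
  then show thesis using that vector_bundle_iso[OF _ E] by blast
qed


section \<open>The monoid of isomorphism classes of vector bundles\<close>

text \<open>The two total spaces may have different types; the classes are compared through a member of one
  of them, which exists because every bundle has a standard copy.\<close>

lemma iso_class_eq_iff:
  fixes X :: "'b topology"
  assumes E: "vector_bundle X E" and F: "vector_bundle X F"
  shows "iso_class X E = iso_class X F \<longleftrightarrow> bundle_iso E F"
proof
  assume eq: "iso_class X E = iso_class X F"
  obtain G :: "'b std_bundle" where G: "vector_bundle X G" "bundle_iso E G" using exists_std_bundle[OF E] .
  then have "G \<in> iso_class X F" using eq by (auto simp: iso_class_def)
  then have "bundle_iso F G" by (simp add: iso_class_def)
  then show "bundle_iso E F"
    using G(2) bundle_iso_trans bundle_iso_sym vector_bundle_fibre_closed[OF F] by blast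
next
  assume iso: "bundle_iso E F"
  then have iso': "bundle_iso F E" using bundle_iso_sym vector_bundle_fibre_closed[OF E] by blast
  show "iso_class X E = iso_class X F"
    using bundle_iso_trans[OF iso] bundle_iso_trans[OF iso'] by (auto simp: iso_class_def)
qed

lemma iso_class_carrier:
  fixes X :: "'b topology"
  assumes "vector_bundle X E"
  shows "iso_class X E \<in> carrier (Vect X)"
proof -
  obtain G :: "'b std_bundle" where G: "vector_bundle X G" "bundle_iso E G" using exists_std_bundle[OF assms] .
  then have "iso_class X E = iso_class X G" using iso_class_eq_iff[OF assms G(1)] by simp
  then show ?thesis using G(1) by (auto simp: Vect_def)
qed

lemma carrier_VectE:
  assumes "A \<in> carrier (Vect X)"
  obtains E :: "'b std_bundle" where "vector_bundle X E" "A = iso_class X E"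
  using assms by (auto simp: Vect_def)

lemma Vect_mult:
  assumes E: "vector_bundle X E" and F: "vector_bundle X F"
  shows "iso_class X E \<otimes>\<^bsub>Vect X\<^esub> iso_class X F = iso_class X (whitney_sum E F)"
proof -
  have eq: "iso_class X (whitney_sum E' F') = iso_class X (whitney_sum E F)"
    if "E' \<in> iso_class X E" "F' \<in> iso_class X F" for E' F'
  proof -
    have "bundle_iso (whitney_sum E F) (whitney_sum E' F')"
      using that E F by (auto simp: iso_class_def intro!: whitney_sum_cong vector_bundle_fibre_closed)
    moreover have "vector_bundle X (whitney_sum E F)" "vector_bundle X (whitney_sum E' F')"
      using that E F by (auto simp: iso_class_def intro!: vector_bundle_whitney)
    ultimately show ?thesis using iso_class_eq_iff by metis
  qed
  obtain E' where E': "E' \<in> iso_class X E" using exists_std_bundle[OF E] by (auto simp: iso_class_def)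
  obtain F' where F': "F' \<in> iso_class X F" using exists_std_bundle[OF F] by (auto simp: iso_class_def)
  have "iso_class X E \<otimes>\<^bsub>Vect X\<^esub> iso_class X F
      = (\<Union>A \<in> iso_class X E. \<Union>B \<in> iso_class X F. iso_class X (whitney_sum A B))"
    by (simp add: Vect_def)
  also have "\<dots> = (\<Union>A \<in> iso_class X E. \<Union>B \<in> iso_class X F. iso_class X (whitney_sum E F))"
    using eq by (intro SUP_cong refl) blast
  also have "\<dots> = iso_class X (whitney_sum E F)" using E' F' by blast
  finally show ?thesis .
qed

lemma Vect_one: "\<one>\<^bsub>Vect X\<^esub> = iso_class X (trivial_bundle X 0)"
  by (simp add: Vect_def)

lemma Vect_comm_monoid: "comm_monoid (Vect X)"
proof (rule comm_monoidI)
  fix A B assume "A \<in> carrier (Vect X)" "B \<in> carrier (Vect X)"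
  then obtain E F :: "'a std_bundle" where E: "vector_bundle X E" "A = iso_class X E"
    and F: "vector_bundle X F" "B = iso_class X F" by (metis carrier_VectE)
  show "A \<otimes>\<^bsub>Vect X\<^esub> B \<in> carrier (Vect X)"
    using E F by (simp add: Vect_mult iso_class_carrier vector_bundle_whitney)
  show "A \<otimes>\<^bsub>Vect X\<^esub> B = B \<otimes>\<^bsub>Vect X\<^esub> A"
    using E F by (simp add: Vect_mult iso_class_eq_iff vector_bundle_whitney whitney_commute)
next
  show "\<one>\<^bsub>Vect X\<^esub> \<in> carrier (Vect X)"
    by (simp add: Vect_one iso_class_carrier vector_bundle_trivial)
next
  fix A B C assume "A \<in> carrier (Vect X)" "B \<in> carrier (Vect X)" "C \<in> carrier (Vect X)"
  then obtain E F G :: "'a std_bundle" where E: "vector_bundle X E" "A = iso_class X E"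
    and F: "vector_bundle X F" "B = iso_class X F" and G: "vector_bundle X G" "C = iso_class X G"
    by (metis carrier_VectE)
  then show "A \<otimes>\<^bsub>Vect X\<^esub> B \<otimes>\<^bsub>Vect X\<^esub> C = A \<otimes>\<^bsub>Vect X\<^esub> (B \<otimes>\<^bsub>Vect X\<^esub> C)"
    by (simp add: Vect_mult iso_class_eq_iff vector_bundle_whitney whitney_assoc)
next
  fix A assume "A \<in> carrier (Vect X)"
  then obtain E :: "'a std_bundle" where E: "vector_bundle X E" "A = iso_class X E" by (metis carrier_VectE)
  then have "A \<otimes>\<^bsub>Vect X\<^esub> \<one>\<^bsub>Vect X\<^esub> = A"
    by (simp add: Vect_one Vect_mult iso_class_eq_iff vector_bundle_whitney vector_bundle_trivial whitney_trivial_zero)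
  moreover have "\<one>\<^bsub>Vect X\<^esub> \<otimes>\<^bsub>Vect X\<^esub> A = A \<otimes>\<^bsub>Vect X\<^esub> \<one>\<^bsub>Vect X\<^esub>"
    using E by (simp add: Vect_one Vect_mult iso_class_eq_iff vector_bundle_whitney vector_bundle_trivial whitney_commute)
  ultimately show "\<one>\<^bsub>Vect X\<^esub> \<otimes>\<^bsub>Vect X\<^esub> A = A" by simp
qed

text \<open>The exponents in the monoid of classes are Whitney powers, so that the stable isomorphism can be
  computed by monoid algebra.\<close>

lemma iso_class_power:
  assumes E: "vector_bundle X E"
  shows "iso_class X (bundle_power X E k) = iso_class X E [^]\<^bsub>Vect X\<^esub> k"
proof -
  interpret V: comm_monoid "Vect X" by (rule Vect_comm_monoid)
  show ?thesis
  proof (induction k)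
    case 0
    have "iso_class X (trivial_bundle X 0) = iso_class X (bundle_power X E 0)"
      using iso_class_eq_iff[OF vector_bundle_trivial vector_bundle_power[OF E]] bundle_power_0 by blast
    then show ?case by (simp add: Vect_one)
  next
    case (Suc k)
    have "iso_class X (whitney_sum (bundle_power X E k) E) = iso_class X (bundle_power X E (Suc k))"
      using iso_class_eq_iff[OF vector_bundle_whitney[OF vector_bundle_power[OF E] E] vector_bundle_power[OF E]]
        bundle_power_Suc[OF vector_bundle_fibre_closed[OF E]] by blast
    then show ?case
      using Vect_mult[OF vector_bundle_power[OF E] E, of k] Suc by simp
  qed
qed

lemma iso_class_trivial_add:
  "iso_class X (trivial_bundle X n) \<otimes>\<^bsub>Vect X\<^esub> iso_class X (trivial_bundle X m) = iso_class X (trivial_bundle X (n + m))"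
  by (simp add: Vect_mult vector_bundle_trivial iso_class_eq_iff vector_bundle_whitney whitney_trivial)

lemma iso_class_trivial_power:
  "iso_class X (trivial_bundle X (n * k)) = iso_class X (trivial_bundle X n) [^]\<^bsub>Vect X\<^esub> k"
proof -
  interpret V: comm_monoid "Vect X" by (rule Vect_comm_monoid)
  show ?thesis
  proof (induction k)
    case (Suc k)
    have "iso_class X (trivial_bundle X (n * Suc k))
        = iso_class X (trivial_bundle X (n * k)) \<otimes>\<^bsub>Vect X\<^esub> iso_class X (trivial_bundle X n)"
      by (simp add: iso_class_trivial_add add.commute)
    then show ?case using Suc by simp
  qed (simp add: Vect_one)
qed


section \<open>The Grothendieck group\<close>

abbreviation groth_class :: "('a, 'm) monoid_scheme \<Rightarrow> 'a \<Rightarrow> 'a \<Rightarrow> ('a \<times> 'a) set" where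
  "groth_class M a b \<equiv> grothendieck_rel M `` {(a, b)}"

context comm_monoid
begin

text \<open>For transitivity the two cancelling elements are multiplied with each other and with the middle
  denominator.\<close>

lemma grothendieck_equiv: "equiv (carrier G \<times> carrier G) (grothendieck_rel G)"
proof (rule equivI)
  show "grothendieck_rel G \<subseteq> (carrier G \<times> carrier G) \<times> (carrier G \<times> carrier G)"
    by (auto simp: grothendieck_rel_def)
  show "refl_on (carrier G \<times> carrier G) (grothendieck_rel G)"
    by (auto simp: refl_on_def grothendieck_rel_def intro!: bexI[of _ \<one>])
  show "sym (grothendieck_rel G)"
    by (auto simp: sym_def grothendieck_rel_def) metis
  show "trans (grothendieck_rel G)"
  proof (rule transI, clarify)
    fix a b c d e f
    assume "((a, b), (c, d)) \<in> grothendieck_rel G" "((c, d), (e, f)) \<in> grothendieck_rel G"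
    then obtain k l where c: "a \<in> carrier G" "b \<in> carrier G" "c \<in> carrier G" "d \<in> carrier G"
      "e \<in> carrier G" "f \<in> carrier G" "k \<in> carrier G" "l \<in> carrier G"
      and k: "a \<otimes> d \<otimes> k = c \<otimes> b \<otimes> k" and l: "c \<otimes> f \<otimes> l = e \<otimes> d \<otimes> l"
      by (auto simp: grothendieck_rel_def)
    have "a \<otimes> f \<otimes> (d \<otimes> k \<otimes> l) = (a \<otimes> d \<otimes> k) \<otimes> (f \<otimes> l)" using c by (simp add: m_ac)
    also have "\<dots> = (c \<otimes> f \<otimes> l) \<otimes> (b \<otimes> k)" unfolding k using c by (simp add: m_ac)
    also have "\<dots> = e \<otimes> b \<otimes> (d \<otimes> k \<otimes> l)" unfolding l using c by (simp add: m_ac)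
    finally show "((a, b), (e, f)) \<in> grothendieck_rel G"
      using c by (auto simp: grothendieck_rel_def)
  qed
qed

lemma groth_class_eq_iff:
  assumes "a \<in> carrier G" "b \<in> carrier G" "c \<in> carrier G" "d \<in> carrier G"
  shows "groth_class G a b = groth_class G c d \<longleftrightarrow> (\<exists>k \<in> carrier G. a \<otimes> d \<otimes> k = c \<otimes> b \<otimes> k)"
  using eq_equiv_class_iff[OF grothendieck_equiv, of "(a, b)" "(c, d)"] assms
  by (auto simp: grothendieck_rel_def)

lemma carrier_grothendieck: "carrier (grothendieck_group G) = {groth_class G a b | a b. a \<in> carrier G \<and> b \<in> carrier G}"
  by (auto simp: grothendieck_group_def quotient_def)

lemma groth_class_carrier: "a \<in> carrier G \<Longrightarrow> b \<in> carrier G \<Longrightarrow> groth_class G a b \<in> carrier (grothendieck_group G)"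
  by (auto simp: carrier_grothendieck)

lemma groth_mult:
  assumes ab: "a \<in> carrier G" "b \<in> carrier G" and cd: "c \<in> carrier G" "d \<in> carrier G"
  shows "groth_class G a b \<otimes>\<^bsub>grothendieck_group G\<^esub> groth_class G c d = groth_class G (a \<otimes> c) (b \<otimes> d)"
proof -
  have eq: "groth_class G (a' \<otimes> c') (b' \<otimes> d') = groth_class G (a \<otimes> c) (b \<otimes> d)"
    if mem: "(a', b') \<in> groth_class G a b" "(c', d') \<in> groth_class G c d" for a' b' c' d'
  proof -
    obtain k l where c': "a' \<in> carrier G" "b' \<in> carrier G" "c' \<in> carrier G" "d' \<in> carrier G"
       "k \<in> carrier G" "l \<in> carrier G"
      and k: "a \<otimes> b' \<otimes> k = a' \<otimes> b \<otimes> k" and l: "c \<otimes> d' \<otimes> l = c' \<otimes> d \<otimes> l"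
      using mem by (auto simp: grothendieck_rel_def)
    have "(a' \<otimes> c') \<otimes> (b \<otimes> d) \<otimes> (k \<otimes> l) = (a' \<otimes> b \<otimes> k) \<otimes> (c' \<otimes> d \<otimes> l)" using ab cd c' by (simp add: m_ac)
    also have "\<dots> = (a \<otimes> c) \<otimes> (b' \<otimes> d') \<otimes> (k \<otimes> l)"
      unfolding k[symmetric] l[symmetric] using ab cd c' by (simp add: m_ac)
    finally show ?thesis
      using ab cd c' by (subst groth_class_eq_iff) auto
  qed
  have "groth_class G a b \<otimes>\<^bsub>grothendieck_group G\<^esub> groth_class G c d
      = (\<Union>(a', b') \<in> groth_class G a b. \<Union>(c', d') \<in> groth_class G c d. groth_class G (a' \<otimes> c') (b' \<otimes> d'))"
    by (simp add: grothendieck_group_def)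
  also have "\<dots> = (\<Union>(a', b') \<in> groth_class G a b. \<Union>(c', d') \<in> groth_class G c d. groth_class G (a \<otimes> c) (b \<otimes> d))"
  proof (rule SUP_cong[OF refl], clarify)
    fix a' b' assume 1: "((a, b), (a', b')) \<in> grothendieck_rel G"
    show "(\<Union>(c', d') \<in> groth_class G c d. groth_class G (a' \<otimes> c') (b' \<otimes> d'))
        = (\<Union>(c', d') \<in> groth_class G c d. groth_class G (a \<otimes> c) (b \<otimes> d))"
    proof (rule SUP_cong[OF refl], clarify)
      fix c' d' assume 2: "((c, d), (c', d')) \<in> grothendieck_rel G"
      show "groth_class G (a' \<otimes> c') (b' \<otimes> d') = groth_class G (a \<otimes> c) (b \<otimes> d)"
        using eq[of a' b' c' d'] 1 2 by simp
    qed
  qed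
  also have "\<dots> = groth_class G (a \<otimes> c) (b \<otimes> d)"
  proof -
    have "(a, b) \<in> groth_class G a b" "(c, d) \<in> groth_class G c d"
      using equiv_class_self[OF grothendieck_equiv] ab cd by auto
    then show ?thesis by blast
  qed
  finally show ?thesis .
qed

lemma groth_one: "\<one>\<^bsub>grothendieck_group G\<^esub> = groth_class G \<one> \<one>"
  by (simp add: grothendieck_group_def)

lemma grothendieck_comm_group: "comm_group (grothendieck_group G)"
proof (rule comm_groupI)
  let ?K = "grothendieck_group G"
  fix x y assume "x \<in> carrier ?K" "y \<in> carrier ?K"
  then obtain a b c d where "x = groth_class G a b" "a \<in> carrier G" "b \<in> carrier G"
    "y = groth_class G c d" "c \<in> carrier G" "d \<in> carrier G"
    unfolding carrier_grothendieck by auto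
  then show "x \<otimes>\<^bsub>?K\<^esub> y \<in> carrier ?K" "x \<otimes>\<^bsub>?K\<^esub> y = y \<otimes>\<^bsub>?K\<^esub> x"
    by (simp_all add: groth_mult groth_class_carrier m_comm)
next
  let ?K = "grothendieck_group G"
  show "\<one>\<^bsub>?K\<^esub> \<in> carrier ?K" by (auto simp: carrier_grothendieck groth_one)
next
  let ?K = "grothendieck_group G"
  fix x y z assume "x \<in> carrier ?K" "y \<in> carrier ?K" "z \<in> carrier ?K"
  then show "x \<otimes>\<^bsub>?K\<^esub> y \<otimes>\<^bsub>?K\<^esub> z = x \<otimes>\<^bsub>?K\<^esub> (y \<otimes>\<^bsub>?K\<^esub> z)"
    unfolding carrier_grothendieck by (clarsimp simp: groth_mult m_assoc)
next
  let ?K = "grothendieck_group G"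
  fix x assume "x \<in> carrier ?K"
  then obtain a b where x: "x = groth_class G a b" "a \<in> carrier G" "b \<in> carrier G"
    unfolding carrier_grothendieck by auto
  then show "\<one>\<^bsub>?K\<^esub> \<otimes>\<^bsub>?K\<^esub> x = x" by (simp add: groth_one groth_mult)
  show "\<exists>y \<in> carrier ?K. y \<otimes>\<^bsub>?K\<^esub> x = \<one>\<^bsub>?K\<^esub>"
  proof (rule bexI)
    show "groth_class G b a \<otimes>\<^bsub>?K\<^esub> x = \<one>\<^bsub>?K\<^esub>"
      using x by (simp add: groth_one groth_mult groth_class_eq_iff) (metis m_comm one_closed)
    show "groth_class G b a \<in> carrier ?K" using x by (auto simp: carrier_grothendieck)
  qed
qed

lemma groth_inv:
  assumes "a \<in> carrier G" "b \<in> carrier G"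
  shows "inv\<^bsub>grothendieck_group G\<^esub> groth_class G a b = groth_class G b a"
proof -
  interpret K: comm_group "grothendieck_group G" by (rule grothendieck_comm_group)
  have "groth_class G b a \<otimes>\<^bsub>grothendieck_group G\<^esub> groth_class G a b = \<one>\<^bsub>grothendieck_group G\<^esub>"
    using assms by (simp add: groth_one groth_mult groth_class_eq_iff) (metis m_comm one_closed)
  then show ?thesis
    using assms by (intro K.inv_equality) (auto simp: carrier_grothendieck)
qed

lemma groth_pow:
  assumes "a \<in> carrier G" "b \<in> carrier G"
  shows "groth_class G a b [^]\<^bsub>grothendieck_group G\<^esub> (k::nat) = groth_class G (a [^] k) (b [^] k)"
proof -
  interpret K: comm_group "grothendieck_group G" by (rule grothendieck_comm_group)
  show ?thesis using assms by (induction k) (simp_all add: groth_one groth_mult)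
qed

end


section \<open>Formal differences of bundles\<close>

lemma KO_diff_eq:
  assumes "vector_bundle X E" "vector_bundle X F"
  shows "KO_diff X E F = groth_class (Vect X) (iso_class X E) (iso_class X F)"
proof -
  interpret V: comm_monoid "Vect X" by (rule Vect_comm_monoid)
  show ?thesis
    using assms by (simp add: KO_diff_def KO_class_def KO_def grothendieck_of_def V.groth_inv V.groth_mult iso_class_carrier)
qed

lemma iso_class_rank:
  assumes "vector_bundle X E" "E' \<in> iso_class X E" "x \<in> topspace X"
  shows "bundle_rank E' x = bundle_rank E x"
  using assms bundle_rank_iso[of E E' X x] by (simp add: iso_class_def vector_bundle_fibre_closed)

text \<open>Any other representative of the class becomes isomorphic to the given one after crosswise sums
  and the addition of a bundle, and all of this is additive for the rank. Hence the union in the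
  definition of \<^const>\<open>virtual_rank\<close> is a singleton.\<close>

lemma virtual_rank_KO_diff:
  fixes X :: "'b topology"
  assumes E: "vector_bundle X E" and F: "vector_bundle X F" and x: "x \<in> topspace X"
  shows "virtual_rank x (KO_diff X E F) = int (bundle_rank E x) - int (bundle_rank F x)"
proof -
  interpret V: comm_monoid "Vect X" by (rule Vect_comm_monoid)
  let ?z = "groth_class (Vect X) (iso_class X E) (iso_class X F)"
  let ?r = "int (bundle_rank E x) - int (bundle_rank F x)"
  have rank: "int (bundle_rank E' x) - int (bundle_rank F' x) = ?r"
    if AB: "(A, B) \<in> ?z" and E': "E' \<in> A" and F': "F' \<in> B" for A B E' F'
  proof -
    obtain K where K: "K \<in> carrier (Vect X)" and AB': "A \<in> carrier (Vect X)" "B \<in> carrier (Vect X)"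
      and eq: "iso_class X E \<otimes>\<^bsub>Vect X\<^esub> B \<otimes>\<^bsub>Vect X\<^esub> K = A \<otimes>\<^bsub>Vect X\<^esub> iso_class X F \<otimes>\<^bsub>Vect X\<^esub> K"
      using AB by (auto simp: grothendieck_rel_def)
    obtain E1 F1 G :: "'b std_bundle" where 1: "vector_bundle X E1" "A = iso_class X E1" "vector_bundle X F1" "B = iso_class X F1"
       "vector_bundle X G" "K = iso_class X G"
      using K AB' by (metis carrier_VectE)
    have "bundle_iso (whitney_sum (whitney_sum E F1) G) (whitney_sum (whitney_sum E1 F) G)"
      using eq 1 E F by (simp add: Vect_mult vector_bundle_whitney iso_class_eq_iff)
    then have "bundle_rank (whitney_sum (whitney_sum E F1) G) x = bundle_rank (whitney_sum (whitney_sum E1 F) G) x"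
      using 1 E F x by (intro bundle_rank_iso) (auto intro!: vector_bundle_whitney vector_bundle_fibre_closed[of X])
    then have "bundle_rank E x + bundle_rank F1 x = bundle_rank E1 x + bundle_rank F x"
      using 1 E F x by (simp add: bundle_rank_whitney[of X] vector_bundle_whitney)
    moreover have "bundle_rank E' x = bundle_rank E1 x" "bundle_rank F' x = bundle_rank F1 x"
      using iso_class_rank[OF 1(1) _ x, of E'] iso_class_rank[OF 1(3) _ x, of F'] 1(2,4) E' F' by simp_all
    ultimately show ?thesis by simp
  qed
  obtain E' where E': "E' \<in> iso_class X E" using exists_std_bundle[OF E] by (auto simp: iso_class_def)
  obtain F' where F': "F' \<in> iso_class X F" using exists_std_bundle[OF F] by (auto simp: iso_class_def)
  have in_z: "(iso_class X E, iso_class X F) \<in> ?z"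
    using equiv_class_self[OF V.grothendieck_equiv] iso_class_carrier[OF E] iso_class_carrier[OF F] by blast
  have "(\<Union>(A, B) \<in> ?z. \<Union>E \<in> A. \<Union>F \<in> B. {int (bundle_rank E x) - int (bundle_rank F x)}) = {?r}" (is "?U = _")
  proof (rule equalityI)
    show "?U \<subseteq> {?r}" using rank by fast
    have "?r = int (bundle_rank E' x) - int (bundle_rank F' x)" using rank[OF in_z E' F'] by simp
    then show "{?r} \<subseteq> ?U" using in_z E' F' by blast
  qed
  then show ?thesis by (simp add: virtual_rank_def KO_diff_eq[OF E F])
qed

lemma KO_diff_reduced:
  assumes E: "vector_bundle X E" and F: "vector_bundle X F" and x: "x \<in> topspace X"
    and "bundle_rank E x = bundle_rank F x"
  shows "KO_diff X E F \<in> carrier (reduced_KO X x)"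
proof -
  interpret V: comm_monoid "Vect X" by (rule Vect_comm_monoid)
  have "KO_diff X E F \<in> carrier (KO X)"
    using iso_class_carrier[OF E] iso_class_carrier[OF F]
    by (auto simp: KO_diff_eq[OF E F] KO_def V.carrier_grothendieck)
  then show ?thesis
    using virtual_rank_KO_diff[OF E F x] assms(4) by (simp add: reduced_KO_def kernel_def integer_group_def)
qed

text \<open>Exponents do not involve the carrier, the only component in which the two groups differ.\<close>

lemma reduced_KO_pow: "z [^]\<^bsub>reduced_KO X x\<^esub> (k::nat) = z [^]\<^bsub>KO X\<^esub> k"
  by (simp add: reduced_KO_def nat_pow_def)

lemma KO_diff_power:
  assumes E: "vector_bundle X E" and F: "vector_bundle X F"
  shows "KO_diff X E F [^]\<^bsub>KO X\<^esub> k = KO_diff X (bundle_power X E k) (bundle_power X F k)"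
proof -
  interpret V: comm_monoid "Vect X" by (rule Vect_comm_monoid)
  show ?thesis
    using V.groth_pow[OF iso_class_carrier[OF E] iso_class_carrier[OF F]]
    by (simp add: KO_def KO_diff_eq E F vector_bundle_power iso_class_power)
qed

lemma KO_diff_cong_iso:
  assumes "vector_bundle X E" "vector_bundle X F" "vector_bundle X F'" "bundle_iso F F'"
  shows "KO_diff X E F = KO_diff X E F'"
proof -
  have "iso_class X F = iso_class X F'" using assms iso_class_eq_iff by metis
  then show ?thesis using assms by (simp add: KO_diff_eq)
qed

lemma stably_isomorphic_iff_Vect:
  assumes E: "vector_bundle X E" and F: "vector_bundle X F"
  shows "stably_isomorphic X E F \<longleftrightarrow>
    (\<exists>r. iso_class X E \<otimes>\<^bsub>Vect X\<^esub> iso_class X (trivial_bundle X r) = iso_class X F \<otimes>\<^bsub>Vect X\<^esub> iso_class X (trivial_bundle X r))"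
  using assms
  by (simp add: stably_isomorphic_def Vect_mult vector_bundle_trivial vector_bundle_whitney iso_class_eq_iff)

lemma stably_isomorphic_KO_diff:
  assumes E: "vector_bundle X E" and F: "vector_bundle X F" and G: "vector_bundle X G"
    and st: "stably_isomorphic X E F"
  shows "KO_diff X E G = KO_diff X F G"
proof -
  interpret V: comm_monoid "Vect X" by (rule Vect_comm_monoid)
  obtain r where r: "iso_class X E \<otimes>\<^bsub>Vect X\<^esub> iso_class X (trivial_bundle X r)
      = iso_class X F \<otimes>\<^bsub>Vect X\<^esub> iso_class X (trivial_bundle X r)"
    using st stably_isomorphic_iff_Vect[OF E F] by blast
  let ?r = "iso_class X (trivial_bundle X r)"
  note c = iso_class_carrier[OF E] iso_class_carrier[OF F] iso_class_carrier[OF G]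
    iso_class_carrier[OF vector_bundle_trivial, of X r]
  have "iso_class X E \<otimes>\<^bsub>Vect X\<^esub> iso_class X G \<otimes>\<^bsub>Vect X\<^esub> ?r
      = (iso_class X E \<otimes>\<^bsub>Vect X\<^esub> ?r) \<otimes>\<^bsub>Vect X\<^esub> iso_class X G" using c by (simp add: V.m_ac)
  also have "\<dots> = iso_class X F \<otimes>\<^bsub>Vect X\<^esub> iso_class X G \<otimes>\<^bsub>Vect X\<^esub> ?r"
    unfolding r using c by (simp add: V.m_ac)
  finally show ?thesis
    using c E F G by (auto simp: KO_diff_eq V.groth_class_eq_iff)
qed


section \<open>Projective space\<close>

definition sq_norm :: "nat \<Rightarrow> (nat \<Rightarrow> real) \<Rightarrow> real" where
  "sq_norm d a = (\<Sum>k\<le>d. (a k)\<^sup>2)"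

text \<open>The unit representative depends on the choice in \<^const>\<open>hom_coords\<close>, but only up to a sign.\<close>

definition unit_rep :: "nat \<Rightarrow> (nat \<Rightarrow> real) set \<Rightarrow> nat \<Rightarrow> real" where
  "unit_rep d p = (\<lambda>k. hom_coords p k / sqrt (sq_norm d (hom_coords p)))"

abbreviation punctured :: "nat \<Rightarrow> (nat \<Rightarrow> real) topology" where
  "punctured d \<equiv> subtopology (Euclidean_space (Suc d)) {\<alpha>. \<alpha> \<noteq> (\<lambda>_. 0)}"

lemma quotient_map_RP: "quotient_map (punctured d) (RP d) proj_point"
  unfolding RP_def by (rule quotient_map_quotient_topology)

lemma topspace_RP: "p \<in> topspace (RP d) \<longleftrightarrow> (\<exists>a \<in> Vec (Suc d). a \<noteq> (\<lambda>_. 0) \<and> p = proj_point a)"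
  by (auto simp: RP_def)

lemma hom_coords_proj_point:
  assumes "a \<noteq> (\<lambda>_. 0)"
  obtains c where "c \<noteq> 0" "hom_coords (proj_point a) = (\<lambda>k. c * a k)"
proof -
  have "(\<lambda>k. 1 * a k) \<in> proj_point a" unfolding proj_point_def by blast
  then have "hom_coords (proj_point a) \<in> proj_point a \<and> hom_coords (proj_point a) \<noteq> (\<lambda>_. 0)"
    unfolding hom_coords_def using assms by (intro someI[of "\<lambda>b. b \<in> proj_point a \<and> b \<noteq> (\<lambda>_. 0)" a]) simp
  then obtain c where "hom_coords (proj_point a) = (\<lambda>k. c * a k)" "hom_coords (proj_point a) \<noteq> (\<lambda>_. 0)"
    by (auto simp: proj_point_def)
  then show thesis using that[of c] by (cases "c = 0") auto
qed

lemma sq_norm_pos: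
  assumes "a \<in> Vec (Suc d)" "a \<noteq> (\<lambda>_. 0)"
  shows "sq_norm d a > 0"
proof -
  obtain k where "a k \<noteq> 0" using assms(2) by auto
  moreover have "k \<le> d" using assms(1) \<open>a k \<noteq> 0\<close> by (metis Vec_iff not_less_eq_eq)
  ultimately show ?thesis unfolding sq_norm_def by (intro sum_pos2[of _ k]) auto
qed

lemma sq_norm_scale: "sq_norm d (\<lambda>k. c * a k) = c\<^sup>2 * sq_norm d a"
  by (simp add: sq_norm_def power_mult_distrib sum_distrib_left)

lemma unit_rep_proj_point:
  assumes "a \<in> Vec (Suc d)" "a \<noteq> (\<lambda>_. 0)"
  obtains s where "s = 1 \<or> s = - 1" "unit_rep d (proj_point a) = (\<lambda>k. s * (a k / sqrt (sq_norm d a)))"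
proof -
  obtain c where c: "c \<noteq> 0" "hom_coords (proj_point a) = (\<lambda>k. c * a k)"
    using hom_coords_proj_point[OF assms(2)] .
  have "unit_rep d (proj_point a) = (\<lambda>k. sgn c * (a k / sqrt (sq_norm d a)))"
    using c(1) by (auto simp: unit_rep_def c(2) sq_norm_scale real_sqrt_mult sgn_if)
  moreover have "sgn c = 1 \<or> sgn c = - 1" using c(1) by (auto simp: sgn_if)
  ultimately show thesis using that by blast
qed

lemma unit_rep_Vec: "p \<in> topspace (RP d) \<Longrightarrow> unit_rep d p \<in> Vec (Suc d)"
  and sq_norm_unit_rep: "p \<in> topspace (RP d) \<Longrightarrow> sq_norm d (unit_rep d p) = 1"
proof -
  assume "p \<in> topspace (RP d)"
  then obtain a where a: "a \<in> Vec (Suc d)" "a \<noteq> (\<lambda>_. 0)" "p = proj_point a" by (auto simp: topspace_RP)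
  then obtain s where s: "s = 1 \<or> s = - 1" "unit_rep d p = (\<lambda>k. s * (a k / sqrt (sq_norm d a)))"
    using unit_rep_proj_point by metis
  then show "unit_rep d p \<in> Vec (Suc d)" using a(1) by (auto simp: Vec_iff)
  have eq: "unit_rep d p = (\<lambda>k. (s / sqrt (sq_norm d a)) * a k)" using s(2) by auto
  show "sq_norm d (unit_rep d p) = 1"
    unfolding eq sq_norm_scale using s(1) sq_norm_pos[OF a(1,2)] by (auto simp: power_divide)
qed

lemma mem_RP_iff:
  assumes "p \<in> topspace (RP d)"
  shows "v \<in> p \<longleftrightarrow> (\<exists>c. v = (\<lambda>k. c * unit_rep d p k))"
proof -
  obtain a where a: "a \<in> Vec (Suc d)" "a \<noteq> (\<lambda>_. 0)" "p = proj_point a" using assms by (auto simp: topspace_RP)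
  then obtain s where s: "s = 1 \<or> s = - 1" "unit_rep d p = (\<lambda>k. s * (a k / sqrt (sq_norm d a)))"
    using unit_rep_proj_point by metis
  have nz: "sqrt (sq_norm d a) \<noteq> 0" using sq_norm_pos[OF a(1,2)] by simp
  show ?thesis
  proof
    assume "v \<in> p"
    then obtain c where "v = (\<lambda>k. c * a k)" using a(3) by (auto simp: proj_point_def)
    then have "v = (\<lambda>k. (c * s * sqrt (sq_norm d a)) * unit_rep d p k)" using s nz by auto
    then show "\<exists>c. v = (\<lambda>k. c * unit_rep d p k)" by blast
  next
    assume "\<exists>c. v = (\<lambda>k. c * unit_rep d p k)"
    then obtain c where "v = (\<lambda>k. c * unit_rep d p k)" by blast
    then have "v = (\<lambda>k. (c * s / sqrt (sq_norm d a)) * a k)" using s by auto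
    then show "v \<in> p" using a(3) unfolding proj_point_def by blast
  qed
qed

lemma chart_domain_iff: "p \<in> chart_domain d i \<longleftrightarrow> p \<in> topspace (RP d) \<and> unit_rep d p i \<noteq> 0"
proof -
  have "hom_coords p i \<noteq> 0 \<longleftrightarrow> unit_rep d p i \<noteq> 0" if p: "p \<in> topspace (RP d)"
  proof -
    have "sq_norm d (hom_coords p) \<noteq> 0"
    proof
      assume "sq_norm d (hom_coords p) = 0"
      then have "unit_rep d p = (\<lambda>_. 0)" by (simp add: unit_rep_def)
      then show False using sq_norm_unit_rep[OF p] by (simp add: sq_norm_def)
    qed
    then show ?thesis by (simp add: unit_rep_def)
  qed
  then show ?thesis by (auto simp: chart_domain_def)
qed

lemma unit_rep_nonzero:
  assumes "p \<in> topspace (RP d)"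
  obtains k where "k \<le> d" "unit_rep d p k \<noteq> 0"
proof -
  have "unit_rep d p \<noteq> (\<lambda>_. 0)" using sq_norm_unit_rep[OF assms] by (auto simp: sq_norm_def)
  then show thesis using that unit_rep_Vec[OF assms] by (metis Vec_iff not_less_eq_eq)
qed

lemma proj_point_chart_domain:
  assumes "a \<in> Vec (Suc d)" "a \<noteq> (\<lambda>_. 0)"
  shows "proj_point a \<in> chart_domain d i \<longleftrightarrow> a i \<noteq> 0"
proof -
  obtain s where s: "s = 1 \<or> s = - 1" "unit_rep d (proj_point a) = (\<lambda>k. s * (a k / sqrt (sq_norm d a)))"
    using unit_rep_proj_point[OF assms] .
  have "proj_point a \<in> topspace (RP d)" using assms by (auto simp: topspace_RP)
  then show ?thesis using s sq_norm_pos[OF assms] by (auto simp: chart_domain_iff)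
qed

lemma openin_chart_domain: "openin (RP d) (chart_domain d i)"
  unfolding RP_def openin_quotient_topology
proof
  have c: "continuous_map (punctured d) euclideanreal (\<lambda>a. a i)"
    by (rule continuous_map_Euclidean_coord[where n = "Suc d"]) (simp add: continuous_map_from_subtopology)
  have "openin (punctured d) {a \<in> topspace (punctured d). a i \<in> - {0}}"
    by (rule openin_continuous_map_preimage[OF c]) auto
  moreover have "{a \<in> topspace (punctured d). a i \<in> - {0}} = {x \<in> topspace (punctured d). proj_point x \<in> chart_domain d i}"
    by (auto simp: proj_point_chart_domain)
  ultimately show "openin (punctured d) {x \<in> topspace (punctured d). proj_point x \<in> chart_domain d i}" by simp
  show "chart_domain d i \<subseteq> proj_point ` topspace (punctured d)"
    by (auto simp: chart_domain_def RP_def)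
qed

lemma chart_domain_cover:
  assumes "p \<in> topspace (RP d)"
  obtains i where "i \<le> d" "p \<in> chart_domain d i"
proof -
  obtain i where "i \<le> d" "unit_rep d p i \<noteq> 0" using unit_rep_nonzero[OF assms] .
  then show thesis using that assms by (auto simp: chart_domain_iff)
qed

text \<open>On a chart domain the sign of the unit representative can be chosen continuously.\<close>

lemma chart_section:
  obtains \<sigma> where "continuous_map (subtopology (RP d) (chart_domain d i)) (Euclidean_space (Suc d)) \<sigma>"
    "\<And>p. p \<in> chart_domain d i \<Longrightarrow> \<sigma> p = unit_rep d p \<or> \<sigma> p = (\<lambda>k. - unit_rep d p k)"
proof -
  let ?U = "chart_domain d i"
  define \<sigma> where "\<sigma> p = (\<lambda>k. sgn (unit_rep d p i) * unit_rep d p k)" for p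
  let ?S = "subtopology (punctured d) {a \<in> topspace (punctured d). proj_point a \<in> ?U}"
  have q: "quotient_map ?S (subtopology (RP d) ?U) proj_point"
    by (rule quotient_map_restriction[OF quotient_map_RP refl]) (simp add: openin_chart_domain)
  let ?\<tau> = "\<lambda>a k. (a i / \<bar>a i\<bar>) * (a k / sqrt (sq_norm d a))"
  have c: "continuous_map ?S euclideanreal (\<lambda>a. a k)" for k
    by (rule continuous_map_Euclidean_coord[where n = "Suc d"]) (simp add: continuous_map_from_subtopology)
  have "continuous_map ?S (Euclidean_space (Suc d)) ?\<tau>"
    unfolding continuous_map_into_Euclidean_space
  proof (intro conjI ballI allI impI)
    fix k
    have "continuous_map ?S euclideanreal (\<lambda>a. sqrt (sq_norm d a))"
    proof -
      have "continuous_map ?S euclideanreal (\<lambda>a. sq_norm d a)"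
        unfolding sq_norm_def by (intro continuous_map_sum continuous_map_real_pow c) auto
      from continuous_map_compose[OF this, of euclideanreal sqrt] show ?thesis
        by (simp add: o_def continuous_on_real_sqrt)
    qed
    then show "continuous_map ?S euclideanreal (\<lambda>a. ?\<tau> a k)"
      by (intro continuous_map_real_mult continuous_map_real_divide continuous_map_real_abs c)
        (auto simp: proj_point_chart_domain dest: sq_norm_pos)
  qed (auto simp: Vec_iff)
  then have "continuous_map ?S (Euclidean_space (Suc d)) (\<sigma> \<circ> proj_point)"
  proof (rule continuous_map_eq)
    fix a assume "a \<in> topspace ?S"
    then have a: "a \<in> Vec (Suc d)" "a \<noteq> (\<lambda>_. 0)" "a i \<noteq> 0" by (auto simp: proj_point_chart_domain)
    obtain s where s: "s = 1 \<or> s = - 1" "unit_rep d (proj_point a) = (\<lambda>k. s * (a k / sqrt (sq_norm d a)))"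
      using unit_rep_proj_point[OF a(1,2)] .
    have "sgn (a i / sqrt (sq_norm d a)) = a i / \<bar>a i\<bar>"
      using sq_norm_pos[OF a(1,2)] by (simp add: sgn_if abs_if divide_less_0_iff zero_less_divide_iff)
    then show "?\<tau> a = (\<sigma> \<circ> proj_point) a"
      using s(1) by (auto simp: \<sigma>_def s(2) simp del: sgn_divide)
  qed
  then have "continuous_map (subtopology (RP d) ?U) (Euclidean_space (Suc d)) \<sigma>"
    using continuous_compose_quotient_map_eq[OF q] by blast
  moreover have "\<sigma> p = unit_rep d p \<or> \<sigma> p = (\<lambda>k. - unit_rep d p k)" if "p \<in> ?U" for p
    using that by (auto simp: \<sigma>_def chart_domain_iff sgn_if)
  ultimately show thesis using that by blast
qed

text \<open>The sign of the unit representative is arbitrary, but even functions do not see it.\<close>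

lemma continuous_map_unit_rep:
  assumes H: "continuous_map (prod_topology (Euclidean_space (Suc d)) Z) Y (\<lambda>z. H (fst z) (snd z))"
    and even: "\<And>a z. a \<in> Vec (Suc d) \<Longrightarrow> z \<in> topspace Z \<Longrightarrow> H (\<lambda>k. - a k) z = H a z"
  shows "continuous_map (prod_topology (subtopology (RP d) U) Z) Y (\<lambda>z. H (unit_rep d (fst z)) (snd z))"
proof -
  have "continuous_map (prod_topology (RP d) Z) Y (\<lambda>z. H (unit_rep d (fst z)) (snd z))"
  proof (rule pasting_lemma[where I = "{..d}" and T = "\<lambda>i. chart_domain d i \<times> topspace Z"
        and f = "\<lambda>_ z. H (unit_rep d (fst z)) (snd z)"])
    fix i assume "i \<in> {..d}"
    show "openin (prod_topology (RP d) Z) (chart_domain d i \<times> topspace Z)"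
      by (simp add: openin_chart_domain openin_prod_Times_iff)
    obtain \<sigma> where \<sigma>: "continuous_map (subtopology (RP d) (chart_domain d i)) (Euclidean_space (Suc d)) \<sigma>"
      "\<And>p. p \<in> chart_domain d i \<Longrightarrow> \<sigma> p = unit_rep d p \<or> \<sigma> p = (\<lambda>k. - unit_rep d p k)"
      using chart_section by metis
    let ?P = "prod_topology (subtopology (RP d) (chart_domain d i)) Z"
    have "continuous_map ?P (prod_topology (Euclidean_space (Suc d)) Z) (\<lambda>z. (\<sigma> (fst z), snd z))"
      using continuous_map_compose[OF continuous_map_fst \<sigma>(1)]
      by (intro continuous_map_pairedI continuous_map_snd) (simp add: o_def)
    from continuous_map_compose[OF this H]
    have "continuous_map ?P Y (\<lambda>z. H (\<sigma> (fst z)) (snd z))" by (simp add: o_def)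
    then have "continuous_map ?P Y (\<lambda>z. H (unit_rep d (fst z)) (snd z))"
    proof (rule continuous_map_eq)
      fix z assume "z \<in> topspace ?P"
      then have z: "fst z \<in> chart_domain d i" "fst z \<in> topspace (RP d)" "snd z \<in> topspace Z" by auto
      show "H (\<sigma> (fst z)) (snd z) = H (unit_rep d (fst z)) (snd z)"
        using \<sigma>(2)[OF z(1)] even[OF unit_rep_Vec[OF z(2)] z(3)] by auto
    qed
    then show "continuous_map (subtopology (prod_topology (RP d) Z) (chart_domain d i \<times> topspace Z)) Y
        (\<lambda>z. H (unit_rep d (fst z)) (snd z))"
      by (simp add: prod_topology_subtopology)
  next
    fix z assume "z \<in> topspace (prod_topology (RP d) Z)"
    then have "fst z \<in> topspace (RP d)" "snd z \<in> topspace Z" by auto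
    moreover obtain j where "j \<le> d" "fst z \<in> chart_domain d j"
      using chart_domain_cover[OF calculation(1)] .
    ultimately show "\<exists>j. j \<in> {..d} \<and> z \<in> chart_domain d j \<times> topspace Z \<and> H (unit_rep d (fst z)) (snd z) = H (unit_rep d (fst z)) (snd z)"
      by (auto simp: mem_Times_iff)
  qed simp
  then show ?thesis by (simp add: prod_topology_subtopology continuous_map_from_subtopology)
qed

lemma continuous_map_unit_rep_base:
  assumes H: "continuous_map (Euclidean_space (Suc d)) Y H"
    and even: "\<And>a. a \<in> Vec (Suc d) \<Longrightarrow> H (\<lambda>k. - a k) = H a"
  shows "continuous_map (subtopology (RP d) U) Y (\<lambda>p. H (unit_rep d p))"
proof -
  \<comment> \<open>A one-point space as second factor.\<close>
  let ?Z = "Euclidean_space 0"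
  have 1: "continuous_map (prod_topology (subtopology (RP d) U) ?Z) Y (\<lambda>z. H (unit_rep d (fst z)))"
    using continuous_map_compose[OF continuous_map_fst H] even
    by (intro continuous_map_unit_rep[where H = "\<lambda>a _. H a"]) (auto simp: o_def)
  have 2: "continuous_map (subtopology (RP d) U) (prod_topology (subtopology (RP d) U) ?Z) (\<lambda>p. (p, \<lambda>_. 0))"
    by (intro continuous_map_pairedI) (auto simp: Vec_iff)
  from continuous_map_compose[OF 2 1] show ?thesis by (simp add: o_def)
qed


section \<open>The tautological line bundle\<close>

lemma tautological_simps [simp]:
  "tot (tautological_bundle d) = subtopology (prod_topology (RP d) (Euclidean_space (Suc d))) {(p, v). v \<in> p}"
  "proj (tautological_bundle d) = fst"
  "fib_add (tautological_bundle d) = (\<lambda>(p, v) (q, w). (p, \<lambda>k. v k + w k))"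
  "fib_scale (tautological_bundle d) = (\<lambda>c (p, v). (p, \<lambda>k. c * v k))"
  by (simp_all add: tautological_bundle_def)

lemma topspace_tautological:
  "z \<in> topspace (tot (tautological_bundle d)) \<longleftrightarrow>
     fst z \<in> topspace (RP d) \<and> (\<exists>c. snd z = (\<lambda>k. c * unit_rep d (fst z) k))"
  using mem_RP_iff[of "fst z" d "snd z"] unit_rep_Vec[of "fst z" d]
  by (cases z) (auto simp: Vec_iff)

lemma continuous_map_tautologicalI:
  assumes "continuous_map T (RP d) f" "\<And>k. continuous_map T euclideanreal (\<lambda>z. g z * unit_rep d (f z) k)"
  shows "continuous_map T (tot (tautological_bundle d)) (\<lambda>z. (f z, \<lambda>k. g z * unit_rep d (f z) k))"
proof -
  have f: "f z \<in> topspace (RP d)" if "z \<in> topspace T" for z using assms(1) that by (auto simp: continuous_map_def)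
  have "continuous_map T (Euclidean_space (Suc d)) (\<lambda>z k. g z * unit_rep d (f z) k)"
    unfolding continuous_map_into_Euclidean_space using assms(2) unit_rep_Vec[OF f] by (auto simp: Vec_iff)
  then show ?thesis
    using assms(1) mem_RP_iff[OF f] by (auto simp: continuous_map_in_subtopology intro!: continuous_map_pairedI)
qed

lemma continuous_map_coords:
  "continuous_map (prod_topology (Euclidean_space n) Z) euclideanreal (\<lambda>z. fst z k)"
  "continuous_map (prod_topology Z (Euclidean_space n)) euclideanreal (\<lambda>z. snd z k)"
  by (rule continuous_map_Euclidean_coord[where n = n]; simp add: continuous_map_fst continuous_map_snd)+

text \<open>The frame sends \<open>1\<close> to \<open>\<mu>\<^sub>i \<mu>\<close>, where \<open>\<mu>\<close> is the unit representative: this is even in \<open>\<mu>\<close>, and it is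
  nonzero where \<open>\<mu>\<^sub>i\<close> is.\<close>

lemma tautological_local:
  "bundle_iso (trivial_bundle (subtopology (RP d) (chart_domain d i)) 1)
     (restrict_bundle (tautological_bundle d) (chart_domain d i))"
  unfolding bundle_iso_iff
proof (intro exI bundle_iso_mapI)
  let ?U = "chart_domain d i"
  let ?T = "trivial_bundle (subtopology (RP d) ?U) 1" and ?G = "restrict_bundle (tautological_bundle d) ?U"
  let ?f = "\<lambda>z. (fst z, \<lambda>k. (snd z (0::nat) * unit_rep d (fst z) i) * unit_rep d (fst z) k)"
  let ?g = "\<lambda>z. (fst z, \<lambda>j::nat. if j < 1 then snd z i / (unit_rep d (fst z) i)\<^sup>2 else 0)"
  have c: "continuous_map (tot ?T) (tot ?G) ?f"
    unfolding restrict_bundle_simps continuous_map_in_subtopology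
  proof
    show "continuous_map (tot ?T) (tot (tautological_bundle d)) ?f"
    proof (rule continuous_map_tautologicalI)
      show "continuous_map (tot ?T) (RP d) fst"
        using continuous_map_fst[of "subtopology (RP d) ?U" "Euclidean_space 1"]
        by (simp add: continuous_map_in_subtopology)
      fix k
      show "continuous_map (tot ?T) euclideanreal (\<lambda>z. snd z 0 * unit_rep d (fst z) i * unit_rep d (fst z) k)"
        unfolding trivial_bundle_simps
        by (rule continuous_map_unit_rep[where H = "\<lambda>a t. t 0 * a i * a k"])
           (intro continuous_map_real_mult continuous_map_coords, simp)
    qed
    show "?f \<in> topspace (tot ?T) \<rightarrow> {v. proj (tautological_bundle d) v \<in> ?U}" by auto
  qed
  show "bundle_map ?T ?G ?f"
    unfolding bundle_map_def
    by (intro conjI ballI allI c) (auto simp: fibre_trivial algebra_simps split: if_splits)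
  show "continuous_map (tot ?G) (tot ?T) ?g"
    unfolding trivial_bundle_simps
  proof (rule continuous_map_pairedI)
    have G: "tot ?G = subtopology (prod_topology (RP d) (Euclidean_space (Suc d))) ({(p, v). v \<in> p} \<inter> {v. fst v \<in> ?U})"
      by (simp add: subtopology_subtopology)
    show 1: "continuous_map (tot ?G) (subtopology (RP d) ?U) fst"
      unfolding G by (auto simp: continuous_map_in_subtopology intro: continuous_map_from_subtopology continuous_map_fst)
    have "continuous_map (tot ?G) euclideanreal (\<lambda>z. snd z i)"
      unfolding G by (rule continuous_map_from_subtopology[OF continuous_map_coords(2)])
    moreover have "continuous_map (tot ?G) euclideanreal (\<lambda>z. (unit_rep d (fst z) i)\<^sup>2)"
    proof -
      have "continuous_map (subtopology (RP d) ?U) euclideanreal (\<lambda>p. (unit_rep d p i)\<^sup>2)"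
        by (rule continuous_map_unit_rep_base[where H = "\<lambda>a. (a i)\<^sup>2"],
            rule continuous_map_real_pow, rule continuous_map_Euclidean_coord[where n = "Suc d"]) simp_all
      from continuous_map_compose[OF 1 this] show ?thesis by (simp add: o_def)
    qed
    ultimately have "continuous_map (tot ?G) euclideanreal (\<lambda>z. snd z i / (unit_rep d (fst z) i)\<^sup>2)"
      by (rule continuous_map_real_divide) (auto simp: chart_domain_iff)
    then show "continuous_map (tot ?G) (Euclidean_space 1) (\<lambda>z j. if j < 1 then snd z i / (unit_rep d (fst z) i)\<^sup>2 else 0)"
      by (simp add: continuous_map_into_Euclidean_space)
  qed
  show "?g (?f v) = v" if v: "v \<in> topspace (tot ?T)" for v
  proof -
    obtain p t where pt: "v = (p, t)" "unit_rep d p i \<noteq> 0" "t \<in> Vec 1"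
      using v by (cases v) (auto simp: chart_domain_iff simp flip: One_nat_def)
    have "(\<lambda>j. if j < 1 then t 0 * unit_rep d p i * unit_rep d p i / (unit_rep d p i)\<^sup>2 else 0) = t"
      using pt(2,3) by (auto simp: Vec_iff power2_eq_square)
    then show ?thesis unfolding pt(1) fst_conv snd_conv by (rule arg_cong[where f = "Pair p"])
  qed
  show "?f (?g w) = w" if w: "w \<in> topspace (tot ?G)" for w
  proof -
    have "w \<in> topspace (tot (tautological_bundle d))" "fst w \<in> ?U"
      using w unfolding restrict_bundle_simps topspace_subtopology by auto
    then obtain p c where "w = (p, \<lambda>k. c * unit_rep d p k)" "unit_rep d p i \<noteq> 0"
      unfolding topspace_tautological chart_domain_iff by (metis prod.collapse)
    then show ?thesis by (simp add: power2_eq_square)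
  qed
qed

lemma vector_bundle_tautological: "vector_bundle (RP d) (tautological_bundle d)"
proof (rule vector_bundleI)
  show "continuous_map (tot (tautological_bundle d)) (RP d) (proj (tautological_bundle d))"
    by (auto intro: continuous_map_from_subtopology continuous_map_fst)
  have fibre: "v \<in> fibre (tautological_bundle d) x \<longleftrightarrow>
      x \<in> topspace (RP d) \<and> (\<exists>c. v = (x, \<lambda>k. c * unit_rep d x k))" for v x
    unfolding in_fibre topspace_tautological tautological_simps(2) by (cases v) auto
  show "fibre_closed (tautological_bundle d)"
    unfolding fibre_closed_def
  proof (intro conjI allI ballI)
    fix x v w assume "v \<in> fibre (tautological_bundle d) x" "w \<in> fibre (tautological_bundle d) x"
    then obtain c c' where "x \<in> topspace (RP d)" "v = (x, \<lambda>k. c * unit_rep d x k)" "w = (x, \<lambda>k. c' * unit_rep d x k)"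
      unfolding fibre by blast
    then show "fib_add (tautological_bundle d) v w \<in> fibre (tautological_bundle d) x"
      unfolding fibre by (auto intro!: exI[of _ "c + c'"] simp: distrib_right)
  next
    fix c x v assume "v \<in> fibre (tautological_bundle d) x"
    then obtain c' where "x \<in> topspace (RP d)" "v = (x, \<lambda>k. c' * unit_rep d x k)"
      unfolding fibre by blast
    then show "fib_scale (tautological_bundle d) c v \<in> fibre (tautological_bundle d) x"
      unfolding fibre by (auto intro!: exI[of _ "c * c'"])
  qed
  fix p assume p: "p \<in> topspace (RP d)"
  then obtain i where "p \<in> chart_domain d i" using chart_domain_cover by metis
  then show "\<exists>U n. openin (RP d) U \<and> p \<in> U \<and>
       bundle_iso (trivial_bundle (subtopology (RP d) U) n) (restrict_bundle (tautological_bundle d) U)"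
    using tautological_local openin_chart_domain by blast
qed

lemma bundle_rank_tautological:
  assumes p: "p \<in> topspace (RP d)"
  shows "bundle_rank (tautological_bundle d) p = 1"
proof -
  obtain i where "p \<in> chart_domain d i" using chart_domain_cover[OF p] by metis
  then show ?thesis
    using bundle_rank_local(1)[OF vector_bundle_fibre_closed[OF vector_bundle_tautological] tautological_local _ p] by blast
qed


section \<open>Bundles glued from a cocycle\<close>

lemma mat_act_eq:
  assumes "A \<in> carrier_mat n n"
  shows "mat_act A w = (\<lambda>r. if r < n then \<Sum>s<n. A $$ (r, s) * w s else 0)"
  using assms by (auto simp: mat_act_def scalar_prod_def lessThan_atLeast0)

lemma mat_act_Vec: "A \<in> carrier_mat n n \<Longrightarrow> mat_act A w \<in> Vec n"
  by (simp add: mat_act_eq Vec_iff)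

lemma mat_act_one: "w \<in> Vec n \<Longrightarrow> mat_act (1\<^sub>m n) w = w"
  by (auto simp: mat_act_eq[of _ n] Vec_iff fun_eq_iff if_distrib[of "\<lambda>a. a * _"] cong: if_cong)

lemma mat_act_mult:
  assumes A: "A \<in> carrier_mat n n" and B: "B \<in> carrier_mat n n"
  shows "mat_act (A * B) w = mat_act A (mat_act B w)"
proof
  fix r
  have "(\<Sum>s<n. (A * B) $$ (r, s) * w s) = (\<Sum>t<n. A $$ (r, t) * (\<Sum>s<n. B $$ (t, s) * w s))" if "r < n"
  proof -
    have "(\<Sum>s<n. (A * B) $$ (r, s) * w s) = (\<Sum>s<n. \<Sum>t<n. A $$ (r, t) * (B $$ (t, s) * w s))"
      using that A B by (intro sum.cong refl)
        (simp add: scalar_prod_def lessThan_atLeast0 sum_distrib_right mult.assoc)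
    also have "\<dots> = (\<Sum>t<n. \<Sum>s<n. A $$ (r, t) * (B $$ (t, s) * w s))" by (rule sum.swap)
    finally show ?thesis by (simp add: sum_distrib_left)
  qed
  then show "mat_act (A * B) w r = mat_act A (mat_act B w) r"
    by (simp add: mat_act_eq[OF A] mat_act_eq[OF B] mat_act_eq[OF mult_carrier_mat[OF A B]])
qed

lemma mat_act_linear:
  assumes "A \<in> carrier_mat n n"
  shows "mat_act A (\<lambda>k. v k + w k) = (\<lambda>k. mat_act A v k + mat_act A w k)"
    and "mat_act A (\<lambda>k. c * v k) = (\<lambda>k. c * mat_act A v k)"
  by (auto simp: mat_act_eq[OF assms] fun_eq_iff algebra_simps sum.distrib sum_distrib_left)

locale gluing_data =
  fixes X :: "'b topology" and I :: "'i set" and U :: "'i \<Rightarrow> 'b set" and n :: nat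
    and g :: "'i \<Rightarrow> 'i \<Rightarrow> 'b \<Rightarrow> real mat"
  assumes openin_U: "i \<in> I \<Longrightarrow> openin X (U i)"
    and U_cover: "x \<in> topspace X \<Longrightarrow> \<exists>i \<in> I. x \<in> U i"
    and g_carrier: "i \<in> I \<Longrightarrow> j \<in> I \<Longrightarrow> p \<in> U i \<inter> U j \<Longrightarrow> g i j p \<in> carrier_mat n n"
    and g_diag: "i \<in> I \<Longrightarrow> p \<in> U i \<Longrightarrow> g i i p = 1\<^sub>m n"
    and g_cocycle: "i \<in> I \<Longrightarrow> j \<in> I \<Longrightarrow> k \<in> I \<Longrightarrow> p \<in> U i \<inter> U j \<inter> U k \<Longrightarrow> g i j p * g j k p = g i k p"
    and g_continuous: "i \<in> I \<Longrightarrow> j \<in> I \<Longrightarrow> r < n \<Longrightarrow> s < n \<Longrightarrow>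
      continuous_map (subtopology X (U i \<inter> U j)) euclideanreal (\<lambda>p. g i j p $$ (r, s))"
begin

abbreviation "E \<equiv> glued_bundle X I U n g"
abbreviation "R \<equiv> glue_rel I U n g"

definition point :: "'i \<Rightarrow> 'b \<Rightarrow> (nat \<Rightarrow> real) \<Rightarrow> ('i \<times> 'b \<times> (nat \<Rightarrow> real)) set" where
  "point i p w = R `` {(i, p, w)}"

definition sum_space :: "('i \<times> 'b \<times> (nat \<Rightarrow> real)) topology" where
  "sum_space = sum_topology (\<lambda>i. prod_topology (subtopology X (U i)) (Euclidean_space n)) I"

lemma U_subset: "i \<in> I \<Longrightarrow> U i \<subseteq> topspace X"
  using openin_U openin_subset by blast

lemma topspace_sum_space: "(i, p, w) \<in> topspace sum_space \<longleftrightarrow> i \<in> I \<and> p \<in> U i \<and> w \<in> Vec n"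
  using U_subset by (auto simp: sum_space_def)

lemma g_inverse:
  assumes "i \<in> I" "j \<in> I" "p \<in> U i" "p \<in> U j" "v \<in> Vec n"
  shows "mat_act (g i j p) (mat_act (g j i p) v) = v"
proof -
  have "mat_act (g i j p) (mat_act (g j i p) v) = mat_act (g i j p * g j i p) v"
    using mat_act_mult[OF g_carrier[of i j p] g_carrier[of j i p], of v] assms by simp
  then show ?thesis using g_cocycle[of i j i p] g_diag[of i p] assms mat_act_one by simp
qed

lemma mem_point_iff:
  "(j, q, v) \<in> point i p w \<longleftrightarrow> i \<in> I \<and> j \<in> I \<and> q = p \<and> p \<in> U i \<and> p \<in> U j \<and>
     w \<in> Vec n \<and> v \<in> Vec n \<and> w = mat_act (g i j p) v"
  by (auto simp: point_def glue_rel_def)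

lemma mem_point_iff':
  "(j, q, v) \<in> point i p w \<longleftrightarrow> i \<in> I \<and> j \<in> I \<and> q = p \<and> p \<in> U i \<and> p \<in> U j \<and>
     w \<in> Vec n \<and> v = mat_act (g j i p) w"
proof -
  have "w = mat_act (g i j p) v \<longleftrightarrow> v = mat_act (g j i p) w"
    if "i \<in> I" "j \<in> I" "p \<in> U i" "p \<in> U j" "w \<in> Vec n" "v \<in> Vec n"
    using g_inverse[of i j p w] g_inverse[of j i p v] that by auto
  moreover have "mat_act (g j i p) w \<in> Vec n" if "i \<in> I" "j \<in> I" "p \<in> U i" "p \<in> U j"
    using mat_act_Vec[OF g_carrier[of j i p]] that by simp
  ultimately show ?thesis unfolding mem_point_iff by blast
qed

lemma point_self: "i \<in> I \<Longrightarrow> p \<in> U i \<Longrightarrow> w \<in> Vec n \<Longrightarrow> (i, p, w) \<in> point i p w"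
  by (simp add: mem_point_iff g_diag mat_act_one)

text \<open>Both classes meet a chart \<open>k\<close> in the single vector that the cocycle condition prescribes.\<close>

lemma point_change_chart:
  assumes "i \<in> I" "j \<in> I" "p \<in> U i" "p \<in> U j" "v \<in> Vec n"
  shows "point i p (mat_act (g i j p) v) = point j p v"
proof -
  have "(k, q, u) \<in> point i p (mat_act (g i j p) v) \<longleftrightarrow> (k, q, u) \<in> point j p v" for k q u
  proof -
    have "mat_act (g k i p) (mat_act (g i j p) v) = mat_act (g k j p) v" if "k \<in> I" "p \<in> U k"
      using that assms g_cocycle[of k i j p] mat_act_mult[OF g_carrier[of k i p] g_carrier[of i j p], of v] by simp
    moreover have "mat_act (g i j p) v \<in> Vec n" using mat_act_Vec[OF g_carrier[of i j p]] assms by simp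
    ultimately show ?thesis unfolding mem_point_iff' using assms by auto
  qed
  then show ?thesis by auto
qed

lemma point_eq_iff:
  assumes "i \<in> I" "p \<in> U i" "w \<in> Vec n" "j \<in> I" "q \<in> U j" "v \<in> Vec n"
  shows "point i p w = point j q v \<longleftrightarrow> p = q \<and> w = mat_act (g i j p) v"
proof
  assume "point i p w = point j q v"
  then have "(j, q, v) \<in> point i p w" using point_self[of j q v] assms by simp
  then show "p = q \<and> w = mat_act (g i j p) v" by (simp add: mem_point_iff)
next
  assume "p = q \<and> w = mat_act (g i j p) v"
  then show "point i p w = point j q v" using point_change_chart assms by simp
qed

lemma tot_glued: "tot E = quotient_topology sum_space (\<lambda>z. R `` {z})"
  by (simp add: glued_bundle_def sum_space_def)

lemma topspace_glued:
  "A \<in> topspace (tot E) \<longleftrightarrow> (\<exists>i p w. i \<in> I \<and> p \<in> U i \<and> w \<in> Vec n \<and> A = point i p w)"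
proof -
  have "A \<in> topspace (tot E) \<longleftrightarrow> (\<exists>z. z \<in> topspace sum_space \<and> A = R `` {z})"
    by (auto simp: tot_glued)
  also have "\<dots> \<longleftrightarrow> (\<exists>i p w. (i, p, w) \<in> topspace sum_space \<and> A = point i p w)"
    by (simp add: point_def split_paired_Ex)
  finally show ?thesis by (simp add: topspace_sum_space)
qed

lemma proj_point_glued:
  assumes "i \<in> I" "p \<in> U i" "w \<in> Vec n"
  shows "proj E (point i p w) = p"
  using point_self[OF assms] unfolding glued_bundle_def vbundle.simps
  by (intro the_equality) (auto simp: mem_point_iff)

lemma fib_add_glued:
  assumes "i \<in> I" "p \<in> U i" "v \<in> Vec n" "w \<in> Vec n"
  shows "fib_add E (point i p v) (point i p w) = point i p (\<lambda>k. v k + w k)"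
proof -
  have "(j, q, u) \<in> fib_add E (point i p v) (point i p w) \<longleftrightarrow> (j, q, u) \<in> point i p (\<lambda>k. v k + w k)" for j q u
    using assms mat_act_linear(1)[OF g_carrier, of j i p v w]
    by (auto simp: glued_bundle_def mem_point_iff')
  then show ?thesis by auto
qed

lemma fib_scale_glued:
  assumes "i \<in> I" "p \<in> U i" "v \<in> Vec n"
  shows "fib_scale E c (point i p v) = point i p (\<lambda>k. c * v k)"
proof -
  have "(j, q, u) \<in> fib_scale E c (point i p v) \<longleftrightarrow> (j, q, u) \<in> point i p (\<lambda>k. c * v k)" for j q u
    using assms mat_act_linear(2)[OF g_carrier, of j i p c v]
    by (auto simp: glued_bundle_def mem_point_iff')
  then show ?thesis by auto
qed

lemma fibre_glued:
  assumes "i \<in> I" "p \<in> U i"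
  shows "A \<in> fibre E p \<longleftrightarrow> (\<exists>w \<in> Vec n. A = point i p w)"
proof
  assume "A \<in> fibre E p"
  then obtain j w where j: "j \<in> I" "p \<in> U j" "w \<in> Vec n" "A = point j p w"
    by (auto simp: in_fibre topspace_glued proj_point_glued)
  then have "A = point i p (mat_act (g i j p) w)" using point_change_chart[of i j p w] assms by simp
  then show "\<exists>w \<in> Vec n. A = point i p w"
    using mat_act_Vec[OF g_carrier[of i j p], of w] assms j by auto
next
  assume "\<exists>w \<in> Vec n. A = point i p w"
  then show "A \<in> fibre E p"
    using assms by (auto simp: in_fibre topspace_glued proj_point_glued)
qed

lemma quotient_map_glued: "quotient_map sum_space (tot E) (\<lambda>z. R `` {z})"
  unfolding tot_glued by (rule quotient_map_quotient_topology)

lemma continuous_map_point: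
  assumes "i \<in> I"
  shows "continuous_map (prod_topology (subtopology X (U i)) (Euclidean_space n)) (tot E)
    (\<lambda>z. point i (fst z) (snd z))"
  using continuous_map_compose[OF continuous_map_component_injection[OF assms]
      quotient_imp_continuous_map[OF quotient_map_glued, unfolded sum_space_def]]
  by (simp add: o_def point_def)

lemma continuous_map_from_glued:
  assumes "\<And>i. i \<in> I \<Longrightarrow> continuous_map (prod_topology (subtopology X (U i)) (Euclidean_space n)) Y
    (\<lambda>z. f (point i (fst z) (snd z)))"
  shows "continuous_map (tot E) Y f"
proof -
  have "continuous_map sum_space Y (f \<circ> (\<lambda>z. R `` {z}))"
    unfolding continuous_map_def
  proof (intro conjI allI impI)
    have "f (point i p w) \<in> topspace Y" if i: "i \<in> I" "p \<in> U i" "w \<in> Vec n" for i p w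
    proof -
      have "(p, w) \<in> topspace (prod_topology (subtopology X (U i)) (Euclidean_space n))"
        using i U_subset[OF i(1)] by auto
      from funcset_mem[OF continuous_map_funspace[OF assms[OF i(1)]] this] show ?thesis by simp
    qed
    then show "f \<circ> (\<lambda>z. R `` {z}) \<in> topspace sum_space \<rightarrow> topspace Y"
      by (auto simp: Pi_iff topspace_sum_space point_def)
    fix V assume V: "openin Y V"
    show "openin sum_space {z \<in> topspace sum_space. (f \<circ> (\<lambda>z. R `` {z})) z \<in> V}"
      unfolding sum_space_def openin_sum_topology
    proof (intro conjI ballI)
      fix i assume i: "i \<in> I"
      let ?P = "prod_topology (subtopology X (U i)) (Euclidean_space n)"
      have "openin ?P {z \<in> topspace ?P. f (point i (fst z) (snd z)) \<in> V}"
        by (rule openin_continuous_map_preimage[OF assms[OF i] V])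
      moreover have "{z \<in> topspace ?P. f (point i (fst z) (snd z)) \<in> V} = {z. (i, z) \<in>
         {z \<in> topspace (sum_topology (\<lambda>i. prod_topology (subtopology X (U i)) (Euclidean_space n)) I).
          (f \<circ> (\<lambda>z. R `` {z})) z \<in> V}}"
        using i by (auto simp: point_def)
      ultimately show "openin ?P {z. (i, z) \<in>
         {z \<in> topspace (sum_topology (\<lambda>i. prod_topology (subtopology X (U i)) (Euclidean_space n)) I).
          (f \<circ> (\<lambda>z. R `` {z})) z \<in> V}}" by simp
    qed auto
  qed
  then show ?thesis using continuous_compose_quotient_map_eq[OF quotient_map_glued] by blast
qed

lemma proj_glued_continuous: "continuous_map (tot E) X (proj E)"
proof (rule continuous_map_from_glued)
  fix i assume i: "i \<in> I"
  have "continuous_map (prod_topology (subtopology X (U i)) (Euclidean_space n)) X fst"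
    using continuous_map_fst[of "subtopology X (U i)" "Euclidean_space n"] by (simp add: continuous_map_in_subtopology)
  then show "continuous_map (prod_topology (subtopology X (U i)) (Euclidean_space n)) X
      (\<lambda>z. proj E (point i (fst z) (snd z)))"
    by (rule continuous_map_eq) (use i in \<open>auto simp: proj_point_glued\<close>)
qed

lemma fibre_closed_glued: "fibre_closed E"
  unfolding fibre_closed_def
proof (intro conjI allI ballI)
  fix p A B assume A: "A \<in> fibre E p" and B: "B \<in> fibre E p"
  then obtain i where i: "i \<in> I" "p \<in> U i" by (auto simp: in_fibre topspace_glued proj_point_glued)
  then show "fib_add E A B \<in> fibre E p"
    using A B by (auto simp: fibre_glued fib_add_glued)
next
  fix c p A assume A: "A \<in> fibre E p"
  then obtain i where i: "i \<in> I" "p \<in> U i" by (auto simp: in_fibre topspace_glued proj_point_glued)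
  then show "fib_scale E c A \<in> fibre E p"
    using A by (auto simp: fibre_glued fib_scale_glued)
qed

text \<open>Seen in chart \<open>j\<close>, the classes of the points of an open set of chart \<open>i\<close> form its preimage under
  the transition map, which is defined and continuous on the open overlap.\<close>

lemma point_open_map:
  assumes i: "i \<in> I"
  shows "open_map (prod_topology (subtopology X (U i)) (Euclidean_space n)) (tot E)
    (\<lambda>z. point i (fst z) (snd z))"
  unfolding open_map_def
proof (intro allI impI)
  let ?P = "\<lambda>i. prod_topology (subtopology X (U i)) (Euclidean_space n)"
  fix W assume W: "openin (?P i) W"
  let ?V = "(\<lambda>z. point i (fst z) (snd z)) ` W"
  have WP: "W \<subseteq> topspace (?P i)" using W openin_subset by blast
  have "?V \<subseteq> topspace (tot E)"
  proof
    fix A assume "A \<in> ?V"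
    then obtain p w where "(p, w) \<in> W" "A = point i p w" by auto
    moreover from this have "p \<in> U i" "w \<in> Vec n" using WP by auto
    ultimately show "A \<in> topspace (tot E)" unfolding topspace_glued using i by blast
  qed
  moreover have "openin sum_space {z \<in> topspace sum_space. R `` {z} \<in> ?V}"
    unfolding sum_space_def openin_sum_topology
  proof (intro conjI ballI)
    fix j assume j: "j \<in> I"
    let ?S = "prod_topology (subtopology X (U i \<inter> U j)) (Euclidean_space n)"
    let ?h = "\<lambda>z. (fst z, mat_act (g i j (fst z)) (snd z))"
    have S: "?S = subtopology (?P j) ((U i \<inter> U j) \<times> Vec n)"
      unfolding prod_topology_subtopology subtopology_subtopology
      by (rule arg_cong[where f = "subtopology _"]) auto
    have gc: "g i j p \<in> carrier_mat n n" if "p \<in> U i \<inter> U j" for p using g_carrier i j that by blast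
    have "continuous_map ?S (?P i) ?h"
    proof (rule continuous_map_pairedI)
      show "continuous_map ?S (subtopology X (U i)) fst"
        using continuous_map_fst[of "subtopology X (U i \<inter> U j)" "Euclidean_space n"]
        by (auto simp: continuous_map_in_subtopology)
      show "continuous_map ?S (Euclidean_space n) (\<lambda>z. mat_act (g i j (fst z)) (snd z))"
        unfolding continuous_map_into_Euclidean_space
      proof (intro conjI ballI allI impI)
        fix z r assume z: "z \<in> topspace ?S" and r: "n \<le> r"
        have "fst z \<in> U i \<inter> U j" using z by auto
        then show "mat_act (g i j (fst z)) (snd z) r = 0" using r by (simp add: mat_act_eq[OF gc])
      next
        fix r assume r: "r < n"
        have "continuous_map ?S euclideanreal (\<lambda>z. \<Sum>s<n. g i j (fst z) $$ (r, s) * snd z s)"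
        proof (intro continuous_map_sum continuous_map_real_mult)
          fix s assume "s \<in> {..<n}"
          then show "continuous_map ?S euclideanreal (\<lambda>z. g i j (fst z) $$ (r, s))"
            using continuous_map_compose[OF continuous_map_fst g_continuous[OF i j r]] by (simp add: o_def)
          show "continuous_map ?S euclideanreal (\<lambda>z. snd z s)" by (rule continuous_map_coords(2))
        qed simp
        then show "continuous_map ?S euclideanreal (\<lambda>z. mat_act (g i j (fst z)) (snd z) r)"
          by (rule continuous_map_eq) (use r in \<open>auto simp: mat_act_eq[OF gc]\<close>)
      qed
    qed
    from openin_continuous_map_preimage[OF this W]
    have "openin ?S {z \<in> topspace ?S. ?h z \<in> W}" .
    moreover have "openin (?P j) ((U i \<inter> U j) \<times> Vec n)"
      using openin_U[OF i] by (auto simp: openin_prod_Times_iff openin_subtopology)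
    ultimately have "openin (?P j) {z \<in> topspace ?S. ?h z \<in> W}"
      unfolding S by (rule openin_trans_full)
    moreover have "{z \<in> topspace ?S. ?h z \<in> W} = {z. (j, z) \<in> {z \<in> topspace (sum_topology ?P I). R `` {z} \<in> ?V}}"
    proof (rule Set.set_eqI)
      fix z :: "'b \<times> (nat \<Rightarrow> real)"
      obtain p v where z: "z = (p, v)" by (cases z)
      have "point j p v \<in> ?V \<longleftrightarrow> p \<in> U i \<and> (p, mat_act (g i j p) v) \<in> W"
        if pv: "p \<in> U j" "v \<in> Vec n"
      proof
        assume "point j p v \<in> ?V"
        then obtain q w where qw: "(q, w) \<in> W" "point j p v = point i q w" by auto
        then have "q \<in> U i" "w \<in> Vec n" using WP by auto
        then show "p \<in> U i \<and> (p, mat_act (g i j p) v) \<in> W"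
          using point_eq_iff[of i q w j p v] i j pv qw by auto
      next
        assume "p \<in> U i \<and> (p, mat_act (g i j p) v) \<in> W"
        then show "point j p v \<in> ?V"
          using point_change_chart[of i j p v] i j pv
          by (intro image_eqI[of _ _ "(p, mat_act (g i j p) v)"]) simp_all
      qed
      then show "z \<in> {z \<in> topspace ?S. ?h z \<in> W} \<longleftrightarrow> z \<in> {z. (j, z) \<in> {z \<in> topspace (sum_topology ?P I). R `` {z} \<in> ?V}}"
        using j U_subset[OF j] by (auto simp: z point_def)
    qed
    ultimately show "openin (?P j) {z. (j, z) \<in> {z \<in> topspace (sum_topology ?P I). R `` {z} \<in> ?V}}" by simp
  qed auto
  ultimately show "openin (tot E) ?V"
    using quotient_map_glued unfolding quotient_map_def by blast
qed

lemma glued_local: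
  assumes i: "i \<in> I"
  shows "bundle_iso (trivial_bundle (subtopology X (U i)) n) (restrict_bundle E (U i))"
proof -
  let ?T = "trivial_bundle (subtopology X (U i)) n" and ?f = "\<lambda>z. point i (fst z) (snd z)"
  let ?P = "prod_topology (subtopology X (U i)) (Euclidean_space n)"
  have tz: "fst z \<in> U i \<and> snd z \<in> Vec n" if "z \<in> topspace ?P" for z using that by auto
  have im: "?f ` topspace ?P = topspace (tot (restrict_bundle E (U i)))"
  proof
    show "?f ` topspace ?P \<subseteq> topspace (tot (restrict_bundle E (U i)))"
    proof
      fix A assume "A \<in> ?f ` topspace ?P"
      then obtain z where "z \<in> topspace ?P" "A = ?f z" by blast
      then have "fst z \<in> U i" "snd z \<in> Vec n" "A = point i (fst z) (snd z)" using tz by auto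
      then have "A \<in> topspace (tot E)" "proj E A = fst z"
        unfolding topspace_glued using i by (blast, simp add: proj_point_glued)
      then show "A \<in> topspace (tot (restrict_bundle E (U i)))"
        using \<open>fst z \<in> U i\<close> by simp
    qed
    show "topspace (tot (restrict_bundle E (U i))) \<subseteq> ?f ` topspace ?P"
    proof
      fix A assume "A \<in> topspace (tot (restrict_bundle E (U i)))"
      then have "A \<in> fibre E (proj E A)" "proj E A \<in> U i" by (auto simp: in_fibre)
      then obtain w where "w \<in> Vec n" "A = point i (proj E A) w" using fibre_glued[OF i] by blast
      then show "A \<in> ?f ` topspace ?P"
        using \<open>proj E A \<in> U i\<close> U_subset[OF i] by (intro image_eqI[of _ _ "(proj E A, w)"]) auto
    qed
  qed
  have "homeomorphic_map ?P (tot (restrict_bundle E (U i))) ?f"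
  proof (rule bijective_open_imp_homeomorphic_map)
    show "continuous_map ?P (tot (restrict_bundle E (U i))) ?f"
      using continuous_map_point[OF i] im by (auto simp: continuous_map_in_subtopology)
    show "open_map ?P (tot (restrict_bundle E (U i))) ?f"
      unfolding open_map_def
    proof (intro allI impI)
      fix W assume W: "openin ?P W"
      have "openin (tot E) (?f ` W)" using point_open_map[OF i] W by (simp add: open_map_def)
      moreover have "?f ` W \<subseteq> topspace (tot (restrict_bundle E (U i)))"
        using im openin_subset[OF W] by blast
      ultimately show "openin (tot (restrict_bundle E (U i))) (?f ` W)"
        by (auto simp: openin_subtopology)
    qed
    show "?f ` topspace ?P = topspace (tot (restrict_bundle E (U i)))" by (rule im)
    show "inj_on ?f (topspace ?P)"
    proof (rule inj_onI)
      fix z z' assume "z \<in> topspace ?P" "z' \<in> topspace ?P" "?f z = ?f z'"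
      then show "z = z'"
        using point_eq_iff[of i "fst z" "snd z" i "fst z'" "snd z'"] tz[of z] tz[of z'] i
        by (simp add: g_diag mat_act_one prod_eq_iff)
    qed
  qed
  moreover have "bundle_map ?T (restrict_bundle E (U i)) ?f"
    unfolding bundle_map_def
  proof (intro conjI ballI allI)
    show "continuous_map (tot ?T) (tot (restrict_bundle E (U i))) ?f"
      using homeomorphic_imp_continuous_map[OF calculation] by simp
  qed (use i in \<open>auto simp: fibre_trivial proj_point_glued fib_add_glued fib_scale_glued split: if_splits\<close>)
  ultimately have "bundle_iso_map ?T (restrict_bundle E (U i)) ?f"
    by (simp add: bundle_iso_map_def)
  then show ?thesis by (auto simp: bundle_iso_iff)
qed

lemma vector_bundle_glued: "vector_bundle X E"
proof (rule vector_bundleI[OF proj_glued_continuous fibre_closed_glued])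
  fix x assume "x \<in> topspace X"
  then obtain i where "i \<in> I" "x \<in> U i" using U_cover by blast
  then show "\<exists>U n. openin X U \<and> x \<in> U \<and> bundle_iso (trivial_bundle (subtopology X U) n) (restrict_bundle E U)"
    using glued_local openin_U by blast
qed

lemma bundle_rank_glued:
  assumes x: "x \<in> topspace X"
  shows "bundle_rank E x = n"
proof -
  obtain i where "i \<in> I" "x \<in> U i" using U_cover[OF x] by blast
  then show ?thesis using bundle_rank_local(1)[OF fibre_closed_glued glued_local _ x] by blast
qed

end


section \<open>Square identities\<close>

text \<open>A family of square matrices, linear in \<open>x \<in> \<real>\<^sup>d\<close>, whose columns are orthogonal of length \<open>\<bar>x\<bar>\<close>. For
  the matrices of left multiplication of a composition algebra this is the polarised form of
  \<open>N (x u) = N x N u\<close>.\<close>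

locale square_identity =
  fixes d :: nat and c :: "nat \<Rightarrow> nat \<Rightarrow> nat \<Rightarrow> real"
  assumes columns_orthogonal: "s < d \<Longrightarrow> t < d \<Longrightarrow>
    (\<Sum>r<d. (\<Sum>k<d. x k * c k s r) * (\<Sum>k<d. x k * c k t r)) = (if s = t then \<Sum>k<d. (x k)\<^sup>2 else 0)"
begin

text \<open>\<open>Q i a\<close> is the matrix of left multiplication by the vector with coordinates \<open>a\<close>, the \<open>i\<close>-th
  one deleted.\<close>

definition Q :: "nat \<Rightarrow> (nat \<Rightarrow> real) \<Rightarrow> nat \<Rightarrow> nat \<Rightarrow> real" where
  "Q i a r s = (\<Sum>k<d. a (insert_index i k) * c k s r)"

definition norm_del :: "nat \<Rightarrow> (nat \<Rightarrow> real) \<Rightarrow> real" where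
  "norm_del i a = (\<Sum>k<d. (a (insert_index i k))\<^sup>2)"

lemma Q_columns: "s < d \<Longrightarrow> t < d \<Longrightarrow> (\<Sum>r<d. Q i a r s * Q i a r t) = (if s = t then norm_del i a else 0)"
  unfolding Q_def norm_del_def by (rule columns_orthogonal)

lemma norm_del_nonneg: "norm_del i a \<ge> 0"
  by (simp add: norm_del_def sum_nonneg)

text \<open>A one-sided inverse of a square matrix is two-sided: \<open>Q\<^sup>T Q = n\<close> implies \<open>Q Q\<^sup>T = n\<close> if \<open>n \<noteq> 0\<close>, and
  for \<open>n = 0\<close> all coordinates that \<open>Q\<close> depends on vanish.\<close>

lemma Q_rows:
  assumes "r < d" "t < d"
  shows "(\<Sum>s<d. Q i a r s * Q i a t s) = (if r = t then norm_del i a else 0)"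
proof (cases "norm_del i a = 0")
  case True
  then have "a (insert_index i k) = 0" if "k < d" for k
    using that by (simp add: norm_del_def sum_nonneg_eq_0_iff)
  then show ?thesis using True by (simp add: Q_def)
next
  case False
  define A where "A = mat d d (\<lambda>(s, r). Q i a r s / norm_del i a)"
  define B where "B = mat d d (\<lambda>(r, s). Q i a r s)"
  have A: "A \<in> carrier_mat d d" and B: "B \<in> carrier_mat d d" by (simp_all add: A_def B_def)
  have "A * B = 1\<^sub>m d"
  proof (rule eq_matI)
    fix s t assume st: "s < dim_row (1\<^sub>m d)" "t < dim_col (1\<^sub>m d)"
    then have "(A * B) $$ (s, t) = (\<Sum>r<d. Q i a r s * Q i a r t) / norm_del i a"
      by (simp add: A_def B_def scalar_prod_def lessThan_atLeast0 sum_divide_distrib)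
    then show "(A * B) $$ (s, t) = 1\<^sub>m d $$ (s, t)" using st False by (simp add: Q_columns)
  qed (simp_all add: A_def B_def)
  then have "B * A = 1\<^sub>m d" by (rule mat_mult_left_right_inverse[OF A B])
  then have "(B * A) $$ (r, t) = (if r = t then 1 else 0)" using assms by simp
  moreover have "(B * A) $$ (r, t) = (\<Sum>s<d. Q i a r s * Q i a t s) / norm_del i a"
    using assms by (simp add: A_def B_def scalar_prod_def lessThan_atLeast0 sum_divide_distrib)
  ultimately show ?thesis using False by (auto simp: field_simps split: if_splits)
qed

lemma norm_del_eq:
  assumes "i \<le> d"
  shows "norm_del i a = sq_norm d a - (a i)\<^sup>2"
proof -
  have im: "insert_index i ` {..<d} = {..d} - {i}"
    using insert_index_image[of i d] assms by (simp add: lessThan_atLeast0 lessThan_Suc_atMost[symmetric])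
  have "norm_del i a = (\<Sum>k \<in> insert_index i ` {..<d}. (a k)\<^sup>2)"
    unfolding norm_del_def by (simp add: sum.reindex insert_index_inj_on)
  also have "\<dots> = sq_norm d a - (a i)\<^sup>2"
    unfolding im sq_norm_def using assms by (simp add: sum_diff1)
  finally show ?thesis .
qed

lemma norm_del_pos:
  assumes "i \<le> d" "j \<le> d" "i \<noteq> j" "a i \<noteq> 0"
  shows "norm_del j a > 0"
proof -
  have "(a i)\<^sup>2 + (a j)\<^sup>2 = (\<Sum>k \<in> {i, j}. (a k)\<^sup>2)" using assms by simp
  also have "\<dots> \<le> sq_norm d a" unfolding sq_norm_def using assms by (intro sum_mono2) auto
  finally show ?thesis
    using norm_del_eq[OF assms(2), of a] zero_less_power2[of "a i"] assms(4) by linarith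
qed

lemma Q_minus: "Q i (\<lambda>k. - a k) r s = - Q i a r s"
  by (simp add: Q_def sum_negf)

lemma norm_del_minus: "norm_del i (\<lambda>k. - a k) = norm_del i a"
  by (simp add: norm_del_def)

definition ap :: "nat \<Rightarrow> (nat \<Rightarrow> real) \<Rightarrow> (nat \<Rightarrow> real) \<Rightarrow> nat \<Rightarrow> real" where
  "ap i a v r = (\<Sum>s<d. Q i a r s * v s)"

definition apT :: "nat \<Rightarrow> (nat \<Rightarrow> real) \<Rightarrow> (nat \<Rightarrow> real) \<Rightarrow> nat \<Rightarrow> real" where
  "apT i a v s = (\<Sum>r<d. Q i a r s * v r)"

lemma ap_apT: "r < d \<Longrightarrow> ap i a (apT i a v) r = norm_del i a * v r"
proof -
  assume r: "r < d"
  have "ap i a (apT i a v) r = (\<Sum>t<d. \<Sum>s<d. Q i a r s * Q i a t s * v t)"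
    unfolding ap_def apT_def sum_distrib_left by (subst sum.swap) (simp add: mult.assoc)
  also have "\<dots> = (\<Sum>t<d. (\<Sum>s<d. Q i a r s * Q i a t s) * v t)"
    by (simp only: sum_distrib_right)
  also have "\<dots> = (\<Sum>t<d. if r = t then norm_del i a * v t else 0)"
    using r by (intro sum.cong) (simp_all add: Q_rows)
  finally show ?thesis using r by simp
qed

lemma apT_ap: "s < d \<Longrightarrow> apT i a (ap i a v) s = norm_del i a * v s"
proof -
  assume s: "s < d"
  have "apT i a (ap i a v) s = (\<Sum>t<d. \<Sum>r<d. Q i a r s * Q i a r t * v t)"
    unfolding ap_def apT_def sum_distrib_left by (subst sum.swap) (simp add: mult.assoc)
  also have "\<dots> = (\<Sum>t<d. (\<Sum>r<d. Q i a r s * Q i a r t) * v t)"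
    by (simp only: sum_distrib_right)
  also have "\<dots> = (\<Sum>t<d. if s = t then norm_del i a * v t else 0)"
    using s by (intro sum.cong) (simp_all add: Q_columns)
  finally show ?thesis using s by simp
qed

lemma ap_cong: "(\<And>s. s < d \<Longrightarrow> v s = w s) \<Longrightarrow> ap i a v r = ap i a w r"
  and apT_cong: "(\<And>s. s < d \<Longrightarrow> v s = w s) \<Longrightarrow> apT i a v r = apT i a w r"
  by (auto simp: ap_def apT_def intro: sum.cong)

lemma ap_add: "ap i a (\<lambda>s. v s + w s) r = ap i a v r + ap i a w r"
  and apT_add: "apT i a (\<lambda>s. v s + w s) r = apT i a v r + apT i a w r"
  and ap_scale: "ap i a (\<lambda>s. b * v s) r = b * ap i a v r"
  and apT_scale: "apT i a (\<lambda>s. b * v s) r = b * apT i a v r"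
  by (simp_all add: ap_def apT_def algebra_simps sum.distrib sum_distrib_left)

lemma ap_minus: "ap i (\<lambda>k. - a k) v r = - ap i a v r"
  and apT_minus: "apT i (\<lambda>k. - a k) v r = - apT i a v r"
  by (simp_all add: ap_def apT_def Q_minus sum_negf)

lemma continuous_map_Q:
  assumes "\<And>k. continuous_map T euclideanreal (\<lambda>z. a z k)"
  shows "continuous_map T euclideanreal (\<lambda>z. Q i (a z) r s)"
  unfolding Q_def by (intro continuous_map_sum continuous_map_real_mult assms) auto

lemma continuous_map_norm_del:
  assumes "\<And>k. continuous_map T euclideanreal (\<lambda>z. a z k)"
  shows "continuous_map T euclideanreal (\<lambda>z. norm_del i (a z))"
  unfolding norm_del_def by (intro continuous_map_sum continuous_map_real_pow assms) auto

lemma continuous_map_ap: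
  assumes "\<And>k. continuous_map T euclideanreal (\<lambda>z. a z k)" "\<And>k. continuous_map T euclideanreal (\<lambda>z. v z k)"
  shows "continuous_map T euclideanreal (\<lambda>z. ap i (a z) (v z) r)"
    and "continuous_map T euclideanreal (\<lambda>z. apT i (a z) (v z) r)"
  unfolding ap_def apT_def
  by (intro continuous_map_sum continuous_map_real_mult continuous_map_Q assms; simp)+


subsection \<open>The pairing that trivialises an even multiple of the line bundle\<close>

text \<open>The block matrix with rows \<open>(a\<^sub>0, Q\<^sub>0)\<close> and \<open>(- Q\<^sub>0\<^sup>T, a\<^sub>0)\<close>, linear in \<open>a\<close>. Its product with its transpose
  is \<open>\<bar>a\<bar>\<^sup>2\<close>.\<close>

definition pairing :: "(nat \<Rightarrow> real) \<Rightarrow> (nat \<Rightarrow> real) \<Rightarrow> nat \<Rightarrow> real" where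
  "pairing a v i = (if i < d then a 0 * v i + ap 0 a (\<lambda>s. v (d + s)) i
     else a 0 * v i - apT 0 a v (i - d))"

lemma pairing_injective:
  assumes a: "sq_norm d a = 1" and v: "v \<in> Vec (2 * d)" and z: "\<And>i. i < 2 * d \<Longrightarrow> pairing a v i = 0"
  shows "v = (\<lambda>_. 0)"
proof -
  have n0: "norm_del 0 a + (a 0)\<^sup>2 = 1" using norm_del_eq[of 0 a] a by simp
  have 1: "a 0 * v i + ap 0 a (\<lambda>s. v (d + s)) i = 0" if "i < d" for i
    using z[of i] that by (simp add: pairing_def)
  have 2: "a 0 * v (d + s) = apT 0 a v s" if "s < d" for s
    using z[of "d + s"] that by (simp add: pairing_def)
  have v0: "v i = 0" if "i < d" for i
  proof -
    have "a 0 * ap 0 a (\<lambda>s. v (d + s)) i = ap 0 a (\<lambda>s. a 0 * v (d + s)) i"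
      by (simp add: ap_scale)
    also have "\<dots> = ap 0 a (apT 0 a v) i" by (rule ap_cong) (simp add: 2)
    also have "\<dots> = norm_del 0 a * v i" using ap_apT[OF that] .
    finally have "a 0 * (a 0 * v i + ap 0 a (\<lambda>s. v (d + s)) i) = (norm_del 0 a + (a 0)\<^sup>2) * v i"
      by (simp add: algebra_simps power2_eq_square)
    then show ?thesis using 1[OF that] n0 by simp
  qed
  have v1: "v (d + s) = 0" if "s < d" for s
  proof -
    have "apT 0 a (ap 0 a (\<lambda>s. v (d + s))) s = apT 0 a (\<lambda>_. 0) s"
      by (rule apT_cong) (use 1 v0 in simp)
    then have "norm_del 0 a * v (d + s) = 0" using apT_ap[OF that] by (simp add: apT_def)
    moreover have "apT 0 a v s = apT 0 a (\<lambda>_. 0) s" by (rule apT_cong) (simp add: v0)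
    then have "a 0 * v (d + s) = 0" using 2[OF that] by (simp add: apT_def)
    ultimately have "(norm_del 0 a + (a 0)\<^sup>2) * v (d + s) = 0" by auto
    then show ?thesis using n0 by simp
  qed
  show ?thesis
  proof
    fix i
    consider "i < d" | "d \<le> i" "i < 2 * d" | "2 * d \<le> i" by linarith
    then show "v i = 0"
    proof cases
      case 2
      then show ?thesis using v1[of "i - d"] by simp
    qed (use v0 v in \<open>auto simp: Vec_iff\<close>)
  qed
qed


subsection \<open>The comparison map\<close>

definition wt :: "nat set \<Rightarrow> (nat \<Rightarrow> real) \<Rightarrow> real" where
  "wt S a = (\<Prod>k \<in> {..d} - S. norm_del k a)"

text \<open>If \<open>w = Q\<^sub>i u / a\<^sub>i\<close> is the coordinate vector in chart \<open>i\<close> of the point with parameter \<open>u\<close>, then the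
  \<open>j\<close>-th component is \<open>Q\<^sub>j u\<close> times the product of the \<open>n\<^sub>k\<close> with \<open>k \<noteq> j\<close>. The parameter
  \<open>u = a\<^sub>i Q\<^sub>i\<^sup>T w / n\<^sub>i\<close> has a pole at the \<open>i\<close>-th coordinate point; the weights cancel it, and the
  expression below is polynomial in \<open>a\<close> and \<open>w\<close>. It is homogeneous in \<open>a\<close> of odd degree.\<close>

definition chart_part :: "nat \<Rightarrow> (nat \<Rightarrow> real) \<Rightarrow> (nat \<Rightarrow> real) \<Rightarrow> nat \<Rightarrow> nat \<Rightarrow> real" where
  "chart_part i a w j r =
     (if j = i then wt {i} a * (a i * w r) else wt {i, j} a * (a i * ap j a (apT i a w) r))"

lemma wt_insert: "i \<le> d \<Longrightarrow> i \<notin> S \<Longrightarrow> wt S a = norm_del i a * wt (insert i S) a"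
proof -
  assume "i \<le> d" "i \<notin> S"
  then have "{..d} - S = insert i ({..d} - insert i S)" by auto
  then have "wt S a = (\<Prod>k \<in> insert i ({..d} - insert i S). norm_del k a)" by (simp only: wt_def)
  also have "\<dots> = norm_del i a * wt (insert i S) a" unfolding wt_def by (rule prod.insert) auto
  finally show ?thesis .
qed

lemma wt_nonneg: "wt S a \<ge> 0"
  by (simp add: wt_def prod_nonneg norm_del_nonneg)

lemma chart_part_eq:
  assumes "i \<le> d" "j \<le> d" "a i \<noteq> 0" and w: "\<And>s. s < d \<Longrightarrow> w s = ap i a u s / a i" and r: "r < d"
  shows "chart_part i a w j r = wt {j} a * ap j a u r"
proof (cases "j = i")
  case True
  then show ?thesis using assms by (simp add: chart_part_def)
next
  case False
  have "ap j a (apT i a w) r = ap j a (\<lambda>s. (norm_del i a / a i) * u s) r"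
  proof (rule ap_cong)
    fix s assume s: "s < d"
    have "apT i a w s = apT i a (\<lambda>s. (1 / a i) * ap i a u s) s" by (rule apT_cong) (simp add: w)
    also have "\<dots> = (norm_del i a / a i) * u s" using apT_ap[OF s] by (simp only: apT_scale) simp
    finally show "apT i a w s = (norm_del i a / a i) * u s" .
  qed
  also have "\<dots> = norm_del i a / a i * ap j a u r" by (rule ap_scale)
  finally show ?thesis
    using False assms wt_insert[of i "{j}" a] by (simp add: chart_part_def)
qed

text \<open>The transition formula expresses that \<open>v\<close> and \<open>w\<close> have the same parameter \<open>u = a\<^sub>j Q\<^sub>j\<^sup>T v / n\<^sub>j\<close>.\<close>

lemma chart_part_compatible:
  assumes ij: "i \<le> d" "j \<le> d" "i \<noteq> j" "a i \<noteq> 0" "a j \<noteq> 0" and k: "k \<le> d" and r: "r < d"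
    and w: "\<And>s. s < d \<Longrightarrow> w s = a j / (a i * norm_del j a) * ap i a (apT j a v) s"
  shows "chart_part i a w k r = chart_part j a v k r"
proof -
  define u where "u = (\<lambda>s. a j / norm_del j a * apT j a v s)"
  have apu: "ap l a u s = a j / norm_del j a * ap l a (apT j a v) s" for l s
    unfolding u_def by (rule ap_scale)
  have nj: "norm_del j a \<noteq> 0" using norm_del_pos[of i j a] ij by simp
  have "chart_part i a w k r = wt {k} a * ap k a u r"
  proof (rule chart_part_eq)
    fix s assume "s < d"
    then show "w s = ap i a u s / a i" using w by (simp add: apu)
  qed (use ij k r in auto)
  moreover have "chart_part j a v k r = wt {k} a * ap k a u r"
  proof (rule chart_part_eq)
    fix s assume "s < d"
    then show "v s = ap j a u s / a j" using ij nj by (simp add: apu ap_apT)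
  qed (use ij k r in auto)
  ultimately show ?thesis by simp
qed

text \<open>For \<open>j \<noteq> i\<close> the matrix \<open>Q\<^sub>j\<close> is invertible because \<open>a\<^sub>i \<noteq> 0\<close>, and the \<open>j\<close>-th equation determines
  \<open>u\<^sub>j\<close> as a nonpositive multiple of \<open>a\<^sub>i Q\<^sub>i\<^sup>T w\<close>. As the \<open>u\<^sub>j\<close> have sum zero, \<open>u\<^sub>i\<close> is a nonnegative
  multiple of the same vector, and in the \<open>i\<close>-th equation \<open>a\<^sub>i w\<close> gets a positive coefficient. This
  works at the \<open>i\<close>-th coordinate point as well, where \<open>Q\<^sub>i = 0\<close>.\<close>

lemma chart_part_injective:
  assumes i: "i \<le> d" "a i \<noteq> 0" and u: "\<And>s. s < d \<Longrightarrow> (\<Sum>j\<le>d. u j s) = 0"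
    and z: "\<And>j r. j \<le> d \<Longrightarrow> r < d \<Longrightarrow> chart_part i a w j r + ap j a (u j) r = 0"
  shows "s < d \<Longrightarrow> w s = 0" and "j \<le> d \<Longrightarrow> s < d \<Longrightarrow> u j s = 0"
proof -
  have uj: "u j s = - (wt {i, j} a * a i) * apT i a w s" if j: "j \<le> d" "j \<noteq> i" and s: "s < d" for j s
  proof -
    have nj: "norm_del j a > 0" using norm_del_pos[of i j a] i j by simp
    have "apT j a (ap j a (\<lambda>s. wt {i, j} a * a i * apT i a w s + u j s)) s = apT j a (\<lambda>_. 0) s"
    proof (rule apT_cong)
      fix r assume "r < d"
      then show "ap j a (\<lambda>s. wt {i, j} a * a i * apT i a w s + u j s) r = 0"
        using z[OF j(1), of r] j(2) by (simp add: chart_part_def ap_add ap_scale)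
    qed
    then have "norm_del j a * (wt {i, j} a * a i * apT i a w s + u j s) = 0"
      using apT_ap[OF s] by (simp add: apT_def)
    then show ?thesis using nj by simp
  qed
  define S where "S = (\<Sum>j \<in> {..d} - {i}. wt {i, j} a)"
  have ui: "u i s = S * a i * apT i a w s" if s: "s < d" for s
  proof -
    have "(\<Sum>j\<le>d. u j s) = u i s + (\<Sum>j \<in> {..d} - {i}. u j s)"
      using i(1) by (intro sum.remove) auto
    also have "(\<Sum>j \<in> {..d} - {i}. u j s) = (\<Sum>j \<in> {..d} - {i}. - (wt {i, j} a * a i) * apT i a w s)"
      using s by (intro sum.cong) (auto simp: uj)
    also have "\<dots> = - (S * a i * apT i a w s)"
      by (simp add: S_def sum_distrib_right sum_negf)
    finally show ?thesis using u[OF s] by simp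
  qed
  have w0: "w s = 0" if s: "s < d" for s
  proof -
    have "ap i a (u i) s = ap i a (\<lambda>s. (S * a i) * apT i a w s) s" by (rule ap_cong) (simp add: ui)
    also have "\<dots> = S * a i * (norm_del i a * w s)" using ap_apT[OF s] by (simp only: ap_scale)
    finally have "a i * ((wt {i} a + S * norm_del i a) * w s) = 0"
      using z[OF i(1) s] by (simp add: chart_part_def algebra_simps)
    moreover have "wt {i} a > 0"
      unfolding wt_def using norm_del_pos[of i _ a] i by (intro prod_pos) auto
    moreover have "S \<ge> 0" unfolding S_def by (intro sum_nonneg wt_nonneg)
    moreover have "S * norm_del i a \<ge> 0" using calculation(3) norm_del_nonneg by simp
    ultimately have "wt {i} a + S * norm_del i a \<noteq> 0" by linarith
    with \<open>a i * ((wt {i} a + S * norm_del i a) * w s) = 0\<close> show ?thesis using i(2) by simp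
  qed
  then show "s < d \<Longrightarrow> w s = 0" .
  have "apT i a w s = 0" for s using w0 by (simp add: apT_def)
  then show "j \<le> d \<Longrightarrow> s < d \<Longrightarrow> u j s = 0" using uj ui by (cases "j = i") auto
qed

lemma chart_part_add: "chart_part i a (\<lambda>s. v s + w s) j r = chart_part i a v j r + chart_part i a w j r"
proof -
  have "ap j a (apT i a (\<lambda>s. v s + w s)) r = ap j a (apT i a v) r + ap j a (apT i a w) r"
    unfolding ap_add[symmetric] by (rule ap_cong) (rule apT_add)
  then show ?thesis by (simp add: chart_part_def algebra_simps)
qed

lemma chart_part_scale: "chart_part i a (\<lambda>s. b * v s) j r = b * chart_part i a v j r"
proof -
  have "ap j a (apT i a (\<lambda>s. b * v s)) r = b * ap j a (apT i a v) r"
    unfolding ap_scale[symmetric] by (rule ap_cong) (rule apT_scale)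
  then show ?thesis by (simp add: chart_part_def algebra_simps)
qed

lemma chart_part_minus: "chart_part i (\<lambda>k. - a k) w j r = - chart_part i a w j r"
proof -
  have "ap j a (apT i (\<lambda>k. - a k) w) r = ap j a (\<lambda>s. (-1) * apT i a w s) r"
    by (rule ap_cong) (simp add: apT_minus)
  also have "\<dots> = (-1) * ap j a (apT i a w) r" by (rule ap_scale)
  finally show ?thesis by (simp add: chart_part_def wt_def norm_del_minus ap_minus)
qed

lemma continuous_map_chart_part:
  assumes "\<And>k. continuous_map T euclideanreal (\<lambda>z. a z k)" "\<And>k. continuous_map T euclideanreal (\<lambda>z. w z k)"
  shows "continuous_map T euclideanreal (\<lambda>z. chart_part i (a z) (w z) j r)"
proof -
  have wt: "continuous_map T euclideanreal (\<lambda>z. wt S (a z))" for S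
    unfolding wt_def by (rule continuous_map_prod) (auto intro: continuous_map_norm_del[OF assms(1)])
  have ap: "continuous_map T euclideanreal (\<lambda>z. ap j (a z) (apT i (a z) (w z)) r)"
    by (rule continuous_map_ap(1)[OF assms(1) continuous_map_ap(2)[OF assms]])
  show ?thesis
    unfolding chart_part_def using continuous_map_real_mult[OF wt continuous_map_real_mult[OF assms(1) assms(2)]]
      continuous_map_real_mult[OF wt continuous_map_real_mult[OF assms(1) ap]]
    by (cases "j = i") simp_all
qed

end


section \<open>An even multiple of the tautological bundle is trivial\<close>

context square_identity
begin

lemma pairing_add: "pairing a (\<lambda>s. v s + w s) i = pairing a v i + pairing a w i"
  by (simp add: pairing_def ap_add apT_add algebra_simps)

lemma pairing_scale: "pairing a (\<lambda>s. b * v s) i = b * pairing a v i"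
  by (simp add: pairing_def ap_scale apT_scale algebra_simps)

lemma pairing_minus: "pairing (\<lambda>k. - a k) v i = - pairing a v i"
  by (simp add: pairing_def ap_minus apT_minus)

lemma continuous_map_pairing:
  assumes a: "\<And>k. continuous_map T euclideanreal (\<lambda>z. a z k)" and v: "\<And>k. continuous_map T euclideanreal (\<lambda>z. v z k)"
  shows "continuous_map T euclideanreal (\<lambda>z. pairing (a z) (v z) i)"
proof -
  have 1: "continuous_map T euclideanreal (\<lambda>z. ap 0 (a z) (\<lambda>s. v z (d + s)) i)"
    by (rule continuous_map_ap(1)[OF a]) (rule v)
  have 2: "continuous_map T euclideanreal (\<lambda>z. apT 0 (a z) (v z) (i - d))"
    by (rule continuous_map_ap(2)[OF a v])
  have 3: "continuous_map T euclideanreal (\<lambda>z. a z 0 * v z i)"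
    by (rule continuous_map_real_mult[OF a v])
  show ?thesis
    unfolding pairing_def using continuous_map_add[OF 3 1] continuous_map_diff[OF 3 2]
    by (cases "i < d") simp_all
qed

text \<open>The \<open>2d\<close> coordinates of a vector are turned into multiples of the unit representative by an
  invertible matrix that is linear in it; the product of the two is even.\<close>

lemma tautological_power_trivial:
  "bundle_iso (trivial_bundle (RP d) (2 * d)) (bundle_power (RP d) (tautological_bundle d) (2 * d))"
proof -
  let ?T = "trivial_bundle (RP d) (2 * d)" and ?P = "bundle_power (RP d) (tautological_bundle d) (2 * d)"
  let ?u = "unit_rep d"
  let ?f = "\<lambda>z. (fst z, \<lambda>i\<in>{..<2 * d}. (fst z, \<lambda>k. pairing (?u (fst z)) (snd z) i * ?u (fst z) k))"
  have c: "continuous_map (tot ?T) (tot ?P) ?f"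
  proof (rule continuous_map_powerI)
    show b: "continuous_map (tot ?T) (RP d) fst" by (simp add: continuous_map_fst)
    fix i assume i: "i < 2 * d"
    have "continuous_map (tot ?T) (tot (tautological_bundle d))
       (\<lambda>z. (fst z, \<lambda>k. pairing (?u (fst z)) (snd z) i * ?u (fst z) k))"
    proof (rule continuous_map_tautologicalI[OF b])
      fix k
      \<comment> \<open>The whole space as a subspace of itself, to match \<open>continuous_map_unit_rep\<close>.\<close>
      have "continuous_map (prod_topology (subtopology (RP d) (topspace (RP d))) (Euclidean_space (2 * d))) euclideanreal
          (\<lambda>z. pairing (?u (fst z)) (snd z) i * ?u (fst z) k)"
        by (rule continuous_map_unit_rep[where H = "\<lambda>a v. pairing a v i * a k"])
           (intro continuous_map_real_mult continuous_map_pairing continuous_map_coords, simp add: pairing_minus)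
      then show "continuous_map (tot ?T) euclideanreal (\<lambda>z. pairing (?u (fst z)) (snd z) i * ?u (fst z) k)" by simp
    qed
    then show "continuous_map (tot ?T) (tot (tautological_bundle d))
       (\<lambda>z. (\<lambda>i\<in>{..<2 * d}. (fst z, \<lambda>k. pairing (?u (fst z)) (snd z) i * ?u (fst z) k)) i)"
      using i by simp
  qed auto
  have "bundle_iso_map ?T ?P ?f"
  proof (rule injective_bundle_map_iso[OF vector_bundle_trivial vector_bundle_power[OF vector_bundle_tautological]])
    show "bundle_rank ?T x = bundle_rank ?P x" if "x \<in> topspace (RP d)" for x
      using that by (simp add: bundle_rank_trivial bundle_rank_power[OF vector_bundle_tautological] bundle_rank_tautological)
    show "bundle_map ?T ?P ?f"
      unfolding bundle_map_def
      by (intro conjI ballI allI c)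
         (auto simp: fibre_trivial pairing_add pairing_scale fun_eq_iff distrib_right split: if_splits)
    fix z assume z: "z \<in> topspace (tot ?T)" and eq: "?f z = fib_scale ?P 0 (?f z)"
    obtain p v where pv: "z = (p, v)" by (cases z)
    have p: "p \<in> topspace (RP d)" and v: "v \<in> Vec (2 * d)" using z by (simp_all add: pv)
    obtain k where k: "?u p k \<noteq> 0" using unit_rep_nonzero[OF p] by metis
    have "pairing (?u p) v i = 0" if i: "i < 2 * d" for i
    proof -
      have "snd (snd (?f z) i) k = snd (snd (fib_scale ?P 0 (?f z)) i) k" using eq by simp
      then have "pairing (?u p) v i * ?u p k = 0" using i by (simp add: pv)
      then show ?thesis using k by simp
    qed
    then have "v = (\<lambda>_. 0)" using pairing_injective[OF sq_norm_unit_rep[OF p] v] by blast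
    then show "z = fib_scale ?T 0 z" by (simp add: pv)
  qed
  then show ?thesis by (auto simp: bundle_iso_iff)
qed

end


section \<open>Multiplication matrices of a composition algebra\<close>

locale based_composition_algebra = composition_division_algebra mul unt N
  for mul :: "'a::real_vector \<Rightarrow> 'a \<Rightarrow> 'a" and unt :: 'a and N :: "'a \<Rightarrow> real" +
  fixes e :: "nat \<Rightarrow> 'a" and d :: nat
  assumes basis: "orthonormal_basis N d e"
begin

lemma polar_self: "polar N u u = N u"
proof -
  have "N (u + u) = 4 * N u" using norm_scale[of 2 u] by (simp add: scaleR_2)
  then show ?thesis by (simp add: polar_def)
qed

lemma linear_polar_left: "linear (\<lambda>u. polar N u v)" and linear_polar_right: "linear (polar N v)"
  using bilinear_polar by (auto simp: bilinear_def)

lemma polar_mul: "polar N (mul x u) (mul x v) = N x * polar N u v"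
proof -
  have "mul x u + mul x v = mul x (u + v)" using bilinear_mul by (simp add: bilinear_radd)
  then show ?thesis by (simp add: polar_def norm_mult algebra_simps)
qed

lemma polar_basis: "r < d \<Longrightarrow> s < d \<Longrightarrow> polar N (e r) (e s) = (if r = s then 1 else 0)"
  and span_basis: "span (e ` {..<d}) = UNIV"
  using basis by (auto simp: orthonormal_basis_def)

lemma inj_basis: "inj_on e {..<d}"
proof (rule inj_onI)
  fix r s assume rs: "r \<in> {..<d}" "s \<in> {..<d}" "e r = e s"
  then show "r = s" using polar_basis[of r s] polar_basis[of s s] by (auto split: if_splits)
qed

lemma polar_sum:
  assumes "s < d"
  shows "polar N (\<Sum>r<d. f r *\<^sub>R e r) (e s) = f s"
proof -
  have "polar N (\<Sum>r<d. f r *\<^sub>R e r) (e s) = (\<Sum>r<d. polar N (f r *\<^sub>R e r) (e s))"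
    by (rule linear_sum[OF linear_polar_left])
  also have "\<dots> = (\<Sum>r<d. if s = r then f r else 0)"
    using assms by (intro sum.cong) (auto simp: linear_cmul[OF linear_polar_left] polar_basis)
  finally show ?thesis using assms by simp
qed

lemma basis_expansion: "v = (\<Sum>r<d. polar N v (e r) *\<^sub>R e r)"
proof -
  have "v \<in> span (e ` {..<d})" using span_basis by simp
  then obtain u where "v = (\<Sum>b \<in> e ` {..<d}. u b *\<^sub>R b)" by (auto simp: span_finite)
  then have u: "v = (\<Sum>r<d. u (e r) *\<^sub>R e r)" by (simp add: sum.reindex[OF inj_basis])
  have "polar N v (e s) = u (e s)" if "s < d" for s unfolding u using polar_sum[OF that] .
  then show ?thesis using u by simp
qed

lemma independent_basis: "independent (e ` {..<d})"
  unfolding dependent_finite[OF finite_imageI[OF finite_lessThan]]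
proof
  assume "\<exists>u. (\<exists>v \<in> e ` {..<d}. u v \<noteq> 0) \<and> (\<Sum>v \<in> e ` {..<d}. u v *\<^sub>R v) = 0"
  then obtain u s where s: "s \<in> {..<d}" "u (e s) \<noteq> 0" and z: "(\<Sum>v \<in> e ` {..<d}. u v *\<^sub>R v) = 0"
    by blast
  then have "(\<Sum>r<d. u (e r) *\<^sub>R e r) = 0" by (simp add: sum.reindex[OF inj_basis])
  then have "u (e s) = polar N 0 (e s)" using polar_sum[of s "\<lambda>r. u (e r)"] s by simp
  then show False using s(2) linear_0[OF linear_polar_left] by simp
qed

lemma representation_basis: "r < d \<Longrightarrow> representation (e ` {..<d}) v (e r) = polar N v (e r)"
proof -
  assume r: "r < d"
  have "v = (\<Sum>b \<in> e ` {..<d}. representation (e ` {..<d}) v b *\<^sub>R b)"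
    using sum_representation_eq[OF independent_basis, of v "e ` {..<d}"] span_basis by simp
  then have eq: "v = (\<Sum>s<d. representation (e ` {..<d}) v (e s) *\<^sub>R e s)"
    by (simp add: sum.reindex[OF inj_basis])
  have "polar N (\<Sum>s<d. representation (e ` {..<d}) v (e s) *\<^sub>R e s) (e r) = representation (e ` {..<d}) v (e r)"
    using polar_sum[OF r] .
  then show ?thesis using eq by simp
qed

lemma parseval: "polar N v w = (\<Sum>r<d. polar N v (e r) * polar N w (e r))"
proof -
  have "polar N v w = polar N v (\<Sum>r<d. polar N w (e r) *\<^sub>R e r)" using basis_expansion[of w] by simp
  also have "\<dots> = (\<Sum>r<d. polar N v (polar N w (e r) *\<^sub>R e r))"
    by (rule linear_sum[OF linear_polar_right])
  finally show ?thesis by (simp add: linear_cmul[OF linear_polar_right] mult.commute)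
qed

definition structure_const :: "nat \<Rightarrow> nat \<Rightarrow> nat \<Rightarrow> real" where
  "structure_const k s r = polar N (mul (e k) (e s)) (e r)"

lemma polar_mul_basis: "polar N (mul (\<Sum>k<d. x k *\<^sub>R e k) (e s)) (e r) = (\<Sum>k<d. x k * structure_const k s r)"
proof -
  have "linear (\<lambda>u. mul u (e s))" using bilinear_mul by (simp add: bilinear_def)
  from linear_compose[OF this linear_polar_left[of "e r"]]
  have lin: "linear (\<lambda>u. polar N (mul u (e s)) (e r))" by (simp add: o_def)
  show ?thesis by (simp add: linear_sum[OF lin] linear_cmul[OF lin] structure_const_def)
qed

sublocale square_identity d structure_const
proof
  fix s t and x :: "nat \<Rightarrow> real" assume st: "s < d" "t < d"
  let ?x = "\<Sum>k<d. x k *\<^sub>R e k"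
  have "(\<Sum>r<d. (\<Sum>k<d. x k * structure_const k s r) * (\<Sum>k<d. x k * structure_const k t r)) = polar N (mul ?x (e s)) (mul ?x (e t))"
    by (subst parseval) (simp add: polar_mul_basis)
  also have "\<dots> = N ?x * (if s = t then 1 else 0)" using st by (simp add: polar_mul polar_basis)
  also have "N ?x = (\<Sum>k<d. (x k)\<^sup>2)"
  proof -
    have "N ?x = (\<Sum>r<d. polar N ?x (e r) * polar N ?x (e r))" by (metis polar_self parseval)
    also have "\<dots> = (\<Sum>k<d. (x k)\<^sup>2)" by (intro sum.cong) (simp_all add: polar_sum power2_eq_square)
    finally show ?thesis .
  qed
  finally show "(\<Sum>r<d. (\<Sum>k<d. x k * structure_const k s r) * (\<Sum>k<d. x k * structure_const k t r)) = (if s = t then \<Sum>k<d. (x k)\<^sup>2 else 0)"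
    by simp
qed


section \<open>The cocycle of the coordinate-deletion bundle\<close>

lemma deletion_mat_carrier: "deletion_mat mul e d i p \<in> carrier_mat d d"
  by (simp add: deletion_mat_def left_mult_mat_def)

lemma deletion_mat_index:
  assumes p: "p \<in> topspace (RP d)" and rs: "r < d" "s < d"
  shows "deletion_mat mul e d i p $$ (r, s) = Q i (unit_rep d p) r s / unit_rep d p i"
proof -
  obtain k where "unit_rep d p k \<noteq> 0" using unit_rep_nonzero[OF p] by metis
  then have nz: "sqrt (sq_norm d (hom_coords p)) \<noteq> 0" by (auto simp: unit_rep_def)
  have ratio: "hom_coords p k / hom_coords p i = unit_rep d p k / unit_rep d p i" for k
    using nz by (simp add: unit_rep_def)
  have "deletion_mat mul e d i p $$ (r, s) =
      polar N (mul (\<Sum>k<d. (unit_rep d p (insert_index i k) / unit_rep d p i) *\<^sub>R e k) (e s)) (e r)"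
    using rs by (simp add: deletion_mat_def left_mult_mat_def representation_basis deletion_coord_def ratio)
  also have "\<dots> = (\<Sum>k<d. unit_rep d p (insert_index i k) / unit_rep d p i * structure_const k s r)"
    by (rule polar_mul_basis)
  finally show ?thesis by (simp add: Q_def sum_divide_distrib)
qed

text \<open>As \<open>Q\<^sub>j\<^sup>T Q\<^sub>j = n\<^sub>j\<close>, this is the inverse of the matrix \<open>Q\<^sub>j / \<mu>\<^sub>j\<close> of the \<open>j\<close>-th deletion coordinate.\<close>

definition deletion_inv :: "nat \<Rightarrow> (nat \<Rightarrow> real) set \<Rightarrow> real mat" where
  "deletion_inv j p = mat d d (\<lambda>(s, r). unit_rep d p j * Q j (unit_rep d p) r s / norm_del j (unit_rep d p))"

lemma deletion_inv_carrier: "deletion_inv j p \<in> carrier_mat d d"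
  by (simp add: deletion_inv_def)

lemma deletion_mat_inverse:
  assumes p: "p \<in> topspace (RP d)" "unit_rep d p i \<noteq> 0" "norm_del i (unit_rep d p) \<noteq> 0"
  shows "deletion_mat mul e d i p * deletion_inv i p = 1\<^sub>m d"
    and "deletion_inv i p * deletion_mat mul e d i p = 1\<^sub>m d"
    and "the (mat_inverse (deletion_mat mul e d i p)) = deletion_inv i p"
proof -
  let ?M = "deletion_mat mul e d i p" and ?B = "deletion_inv i p" and ?u = "unit_rep d p"
  note M = deletion_mat_carrier[of i p] and B = deletion_inv_carrier[of i p]
  show MB: "?M * ?B = 1\<^sub>m d"
  proof (rule eq_matI)
    fix r s assume "r < dim_row (1\<^sub>m d)" "s < dim_col (1\<^sub>m d)"
    then have rs: "r < d" "s < d" by simp_all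
    have "(?M * ?B) $$ (r, s) = (\<Sum>t<d. ?M $$ (r, t) * ?B $$ (t, s))"
      using rs M B by (simp add: scalar_prod_def lessThan_atLeast0)
    also have "\<dots> = (\<Sum>t<d. Q i ?u r t * Q i ?u s t) / norm_del i ?u"
      unfolding sum_divide_distrib using rs p
      by (intro sum.cong) (simp_all add: deletion_mat_index deletion_inv_def)
    finally show "(?M * ?B) $$ (r, s) = 1\<^sub>m d $$ (r, s)" using rs p by (simp add: Q_rows)
  qed (use M B in auto)
  then show BM: "?B * ?M = 1\<^sub>m d" by (rule mat_mult_left_right_inverse[OF M B])
  have "?M \<in> Units (ring_mat TYPE(real) d ())"
    using M B MB BM by (auto simp: Units_def ring_mat_simps)
  then obtain C where C: "mat_inverse ?M = Some C"
    using mat_inverse(1)[OF M, of "()"] by (cases "mat_inverse ?M") auto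
  then have "?M * C = 1\<^sub>m d" "C \<in> carrier_mat d d" using mat_inverse(2)[OF M C] by auto
  moreover from this have "?B * (?M * C) = (?B * ?M) * C" using assoc_mult_mat[OF B M] by simp
  ultimately have "C = ?B" using BM left_mult_one_mat[of C d d] right_mult_one_mat[OF B] by simp
  then show "the (mat_inverse ?M) = ?B" using C by simp
qed

lemma deletion_cocycle_eq:
  assumes ij: "i \<le> d" "j \<le> d" "i \<noteq> j" and p: "p \<in> chart_domain d i" "p \<in> chart_domain d j"
  shows "deletion_cocycle mul e d i j p = deletion_mat mul e d i p * deletion_inv j p"
proof -
  have "norm_del j (unit_rep d p) > 0" using norm_del_pos[of i j] ij p by (simp add: chart_domain_iff)
  then show ?thesis
    using deletion_mat_inverse(3)[of p j] ij p by (simp add: deletion_cocycle_def chart_domain_iff)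
qed

text \<open>The fraction is expanded by \<open>\<mu>\<^sub>i\<close> so that numerator and denominator are even in the unit
  representative.\<close>

lemma deletion_cocycle_index:
  assumes ij: "i \<le> d" "j \<le> d" "i \<noteq> j" and p: "p \<in> chart_domain d i" "p \<in> chart_domain d j" and rs: "r < d" "s < d"
  shows "deletion_cocycle mul e d i j p $$ (r, s) =
    (\<Sum>t<d. unit_rep d p i * unit_rep d p j * (Q i (unit_rep d p) r t * Q j (unit_rep d p) s t)) /
      ((unit_rep d p i)\<^sup>2 * norm_del j (unit_rep d p))"
proof -
  let ?M = "deletion_mat mul e d i p" and ?B = "deletion_inv j p"
  have "deletion_cocycle mul e d i j p $$ (r, s) = (\<Sum>t<d. ?M $$ (r, t) * ?B $$ (t, s))"
    using rs deletion_mat_carrier[of i p] deletion_inv_carrier[of j p]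
    by (simp add: deletion_cocycle_eq[OF ij p] scalar_prod_def lessThan_atLeast0)
  also have "\<dots> = (\<Sum>t<d. unit_rep d p i * unit_rep d p j * (Q i (unit_rep d p) r t * Q j (unit_rep d p) s t) /
      ((unit_rep d p i)\<^sup>2 * norm_del j (unit_rep d p)))"
    using rs p by (intro sum.cong) (simp_all add: deletion_mat_index deletion_inv_def chart_domain_iff power2_eq_square)
  finally show ?thesis by (simp only: sum_divide_distrib)
qed

sublocale G: gluing_data "RP d" "{..d}" "chart_domain d" d "deletion_cocycle mul e d"
proof
  fix i show "openin (RP d) (chart_domain d i)" by (rule openin_chart_domain)
next
  fix x assume "x \<in> topspace (RP d)"
  then show "\<exists>i \<in> {..d}. x \<in> chart_domain d i" by (rule chart_domain_cover) auto
next
  fix i j p assume "i \<in> {..d}" "j \<in> {..d}" "p \<in> chart_domain d i \<inter> chart_domain d j"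
  then show "deletion_cocycle mul e d i j p \<in> carrier_mat d d"
    using deletion_cocycle_eq[of i j p] mult_carrier_mat[OF deletion_mat_carrier deletion_inv_carrier]
    by (cases "i = j") (simp_all add: deletion_cocycle_def[of _ _ _ j j])
next
  fix i p show "deletion_cocycle mul e d i i p = 1\<^sub>m d" by (simp add: deletion_cocycle_def)
next
  fix i j k p
  assume ijk: "i \<in> {..d}" "j \<in> {..d}" "k \<in> {..d}" and p: "p \<in> chart_domain d i \<inter> chart_domain d j \<inter> chart_domain d k"
  let ?g = "deletion_cocycle mul e d" and ?M = "\<lambda>i. deletion_mat mul e d i p" and ?B = "\<lambda>i. deletion_inv i p"
  note M = deletion_mat_carrier and B = deletion_inv_carrier
  have diag: "?g i i p = 1\<^sub>m d" for i by (simp add: deletion_cocycle_def)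
  have off: "?g a b p = ?M a * ?B b" if "a \<in> {i, j, k}" "b \<in> {i, j, k}" "a \<noteq> b" for a b
    by (rule deletion_cocycle_eq) (use that ijk p in auto)
  have gc: "?g a b p \<in> carrier_mat d d" if "a \<in> {i, j, k}" "b \<in> {i, j, k}" for a b
    using off[OF that] diag mult_carrier_mat[OF M B] by (cases "a = b") simp_all
  show "?g i j p * ?g j k p = ?g i k p"
  proof (cases "i = j \<or> j = k")
    case True
    then show ?thesis
      using gc[of i k] gc[of i j] gc[of j k] diag by (auto simp: left_mult_one_mat right_mult_one_mat)
  next
    case False
    have inv: "?B a * ?M a = 1\<^sub>m d" "?M a * ?B a = 1\<^sub>m d" if a: "a \<in> {i, j}" for a
    proof -
      obtain b where b: "b \<in> {i, j}" "b \<noteq> a" using False a by auto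
      have "norm_del a (unit_rep d p) > 0"
        by (rule norm_del_pos[of b]) (use a b ijk p in \<open>auto simp: chart_domain_iff\<close>)
      then show "?B a * ?M a = 1\<^sub>m d" "?M a * ?B a = 1\<^sub>m d"
        using deletion_mat_inverse[of p a] a p by (auto simp: chart_domain_iff)
    qed
    have "?g i j p * ?g j k p = (?M i * ?B j) * (?M j * ?B k)" using off False by simp
    also have "\<dots> = ?M i * (?B j * (?M j * ?B k))" by (rule assoc_mult_mat[OF M B mult_carrier_mat[OF M B]])
    also have "?B j * (?M j * ?B k) = (?B j * ?M j) * ?B k" by (rule assoc_mult_mat[OF B M B, symmetric])
    also have "\<dots> = ?B k" using inv(1)[of j] left_mult_one_mat[OF B[of k p]] by simp
    also have "?M i * ?B k = ?g i k p" using off[of i k] inv(2)[of i] diag by (cases "i = k") simp_all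
    finally show ?thesis .
  qed
next
  fix i j r s assume ij: "i \<in> {..d}" "j \<in> {..d}" and rs: "r < d" "s < d"
  let ?T = "subtopology (RP d) (chart_domain d i \<inter> chart_domain d j)" and ?u = "unit_rep d"
  show "continuous_map ?T euclideanreal (\<lambda>p. deletion_cocycle mul e d i j p $$ (r, s))"
  proof (cases "i = j")
    case False
    have coord: "continuous_map (Euclidean_space (Suc d)) euclideanreal (\<lambda>a. a k)" for k
      by (rule continuous_map_Euclidean_coord[where n = "Suc d"]) simp
    have num: "continuous_map ?T euclideanreal (\<lambda>p. \<Sum>t<d. ?u p i * ?u p j * (Q i (?u p) r t * Q j (?u p) s t))"
      by (rule continuous_map_unit_rep_base[where H = "\<lambda>a. \<Sum>t<d. a i * a j * (Q i a r t * Q j a s t)"])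
         (intro continuous_map_sum continuous_map_real_mult continuous_map_Q coord, simp_all add: Q_minus)
    have den: "continuous_map ?T euclideanreal (\<lambda>p. (?u p i)\<^sup>2 * norm_del j (?u p))"
      by (rule continuous_map_unit_rep_base[where H = "\<lambda>a. (a i)\<^sup>2 * norm_del j a"])
         (intro continuous_map_real_mult continuous_map_real_pow continuous_map_norm_del coord, simp_all add: norm_del_minus)
    have pos: "norm_del j (?u p) > 0" if "p \<in> topspace ?T" for p
      by (rule norm_del_pos[of i]) (use that ij False in \<open>auto simp: chart_domain_iff\<close>)
    have nz: "(?u p i)\<^sup>2 * norm_del j (?u p) \<noteq> 0" if "p \<in> topspace ?T" for p
      using that pos[OF that] by (auto simp: chart_domain_iff)
    have eq: "(\<Sum>t<d. ?u p i * ?u p j * (Q i (?u p) r t * Q j (?u p) s t)) / ((?u p i)\<^sup>2 * norm_del j (?u p))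
        = deletion_cocycle mul e d i j p $$ (r, s)" if "p \<in> topspace ?T" for p
      by (rule deletion_cocycle_index[symmetric]) (use that ij False rs in auto)
    show ?thesis
      using continuous_map_eq[OF continuous_map_real_divide[OF num den nz] eq] by simp
  qed (simp add: deletion_cocycle_def)
qed

lemma mat_act_deletion_cocycle:
  assumes ij: "i \<le> d" "j \<le> d" "i \<noteq> j" and p: "p \<in> chart_domain d i" "p \<in> chart_domain d j" and r: "r < d"
  shows "mat_act (deletion_cocycle mul e d i j p) v r =
    unit_rep d p j / (unit_rep d p i * norm_del j (unit_rep d p)) * ap i (unit_rep d p) (apT j (unit_rep d p) v) r"
proof -
  let ?u = "unit_rep d p"
  have "mat_act (deletion_cocycle mul e d i j p) v r = (\<Sum>s<d. deletion_cocycle mul e d i j p $$ (r, s) * v s)"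
    using mat_act_eq[OF G.g_carrier[of i j p]] ij p r by simp
  also have "\<dots> = (\<Sum>s<d. \<Sum>t<d. ?u j / (?u i * norm_del j ?u) * (Q i ?u r t * (Q j ?u s t * v s)))"
    using ij p r
    by (intro sum.cong)
       (simp_all add: deletion_cocycle_index sum_divide_distrib sum_distrib_right power2_eq_square chart_domain_iff mult.assoc)
  also have "\<dots> = (\<Sum>t<d. \<Sum>s<d. ?u j / (?u i * norm_del j ?u) * (Q i ?u r t * (Q j ?u s t * v s)))"
    by (rule sum.swap)
  finally show ?thesis by (simp add: ap_def apT_def sum_distrib_left)
qed

end


section \<open>The coordinate-deletion bundle as a summand\<close>

text \<open>The \<open>d\<^sup>2\<close> coordinates of \<open>\<kappa>\<close> are \<open>d\<close> vectors \<open>u\<^sub>1, \<dots>, u\<^sub>d\<close>; the vector \<open>u\<^sub>0\<close> brings their sum to zero.\<close>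

definition block :: "nat \<Rightarrow> (nat \<Rightarrow> real) \<Rightarrow> nat \<Rightarrow> nat \<Rightarrow> real" where
  "block d \<kappa> j s = (if j = 0 then - (\<Sum>l<d. \<kappa> (l * d + s)) else \<kappa> ((j - 1) * d + s))"

lemma block_sum: "(\<Sum>j\<le>d. block d \<kappa> j s) = 0"
proof -
  have "(\<Sum>j\<le>d. block d \<kappa> j s) = block d \<kappa> 0 s + (\<Sum>j<d. block d \<kappa> (Suc j) s)"
    by (simp only: lessThan_Suc_atMost[symmetric] sum.lessThan_Suc_shift)
  then show ?thesis by (simp add: block_def)
qed

lemma block_add: "block d (\<lambda>k. v k + w k) j s = block d v j s + block d w j s"
  by (simp add: block_def sum.distrib)

lemma block_scale: "block d (\<lambda>k. b * v k) j s = b * block d v j s"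
  by (simp add: block_def sum_distrib_left)

lemma block_injective:
  assumes \<kappa>: "\<kappa> \<in> Vec (d * d)" and z: "\<And>j s. j \<le> d \<Longrightarrow> s < d \<Longrightarrow> block d \<kappa> j s = 0"
  shows "\<kappa> = (\<lambda>_. 0)"
proof
  fix m
  show "\<kappa> m = 0"
  proof (cases "m < d * d")
    case True
    then have "d > 0" by (cases d) auto
    have "m div d < d" using True by (simp add: less_mult_imp_div_less)
    then have "block d \<kappa> (Suc (m div d)) (m mod d) = 0" using z \<open>d > 0\<close> by simp
    then show ?thesis by (simp add: block_def)
  qed (use \<kappa> in \<open>simp add: Vec_iff\<close>)
qed

lemma continuous_map_block:
  assumes "\<And>k. continuous_map T euclideanreal (\<lambda>z. \<kappa> z k)"
  shows "continuous_map T euclideanreal (\<lambda>z. block d (\<kappa> z) j s)"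
proof -
  have "continuous_map T euclideanreal (\<lambda>z. - (\<Sum>l<d. \<kappa> z (l * d + s)))"
    by (intro continuous_map_minus continuous_map_sum assms) simp
  then show ?thesis unfolding block_def using assms by (cases "j = 0") simp_all
qed

context based_composition_algebra
begin

lemma coordinate_deletion_bundle_eq: "coordinate_deletion_bundle mul e d = G.E"
  by (simp add: coordinate_deletion_bundle_def)

text \<open>The value does not depend on the chosen representative of the class.\<close>

definition glued_part :: "(nat \<times> (nat \<Rightarrow> real) set \<times> (nat \<Rightarrow> real)) set \<Rightarrow> nat \<Rightarrow> nat \<Rightarrow> real" where
  "glued_part A j r = (case SOME z. z \<in> A of (i, p, w) \<Rightarrow> chart_part i (unit_rep d p) w j r)"

lemma glued_part_point:
  assumes i: "i \<le> d" "p \<in> chart_domain d i" "w \<in> Vec d" and j: "j \<le> d" and r: "r < d"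
  shows "glued_part (G.point i p w) j r = chart_part i (unit_rep d p) w j r"
proof -
  have "(SOME z. z \<in> G.point i p w) \<in> G.point i p w"
    using G.point_self[of i p w] i by (metis atMost_iff someI)
  moreover obtain k q v where kqv: "(SOME z. z \<in> G.point i p w) = (k, q, v)" by (metis prod_cases3)
  ultimately have m: "k \<le> d" "q = p" "p \<in> chart_domain d k" "v \<in> Vec d"
    "w = mat_act (deletion_cocycle mul e d i k p) v"
    by (auto simp: G.mem_point_iff)
  have "chart_part i (unit_rep d p) w j r = chart_part k (unit_rep d p) v j r"
  proof (cases "i = k")
    case True
    then have "w = v" using m mat_act_one[OF m(4)] by (simp add: deletion_cocycle_def)
    then show ?thesis using True by simp
  next
    case False
    show ?thesis
    proof (rule chart_part_compatible)
      fix s assume "s < d"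
      then show "w s = unit_rep d p k / (unit_rep d p i * norm_del k (unit_rep d p)) *
          ap i (unit_rep d p) (apT k (unit_rep d p) v) s"
        unfolding m(5) by (rule mat_act_deletion_cocycle[OF i(1) m(1) False i(2) m(3)])
    qed (use False i m j r in \<open>auto simp: chart_domain_iff\<close>)
  qed
  then show ?thesis by (simp add: glued_part_def kqv m(2))
qed

text \<open>The index \<open>m\<close> runs through the \<open>d + 1\<close> components \<open>j = m div d\<close> and their \<open>d\<close> coordinates
  \<open>r = m mod d\<close>.\<close>

definition comparison ::
    "(nat \<times> (nat \<Rightarrow> real) set \<times> (nat \<Rightarrow> real)) set \<times> ((nat \<Rightarrow> real) set \<times> (nat \<Rightarrow> real)) \<Rightarrow> nat \<Rightarrow> real" where
  "comparison z m = glued_part (fst z) (m div d) (m mod d)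
     + ap (m div d) (unit_rep d (fst (snd z))) (block d (snd (snd z)) (m div d)) (m mod d)"

lemma continuous_map_glued_part:
  assumes j: "j \<le> d" and r: "r < d"
  shows "continuous_map (tot G.E) euclideanreal (\<lambda>A. glued_part A j r * unit_rep d (proj G.E A) k)"
proof (rule G.continuous_map_from_glued)
  fix i assume "i \<in> {..d}"
  then have i: "i \<le> d" by simp
  let ?P = "prod_topology (subtopology (RP d) (chart_domain d i)) (Euclidean_space d)"
  have "continuous_map ?P euclideanreal (\<lambda>z. chart_part i (unit_rep d (fst z)) (snd z) j r * unit_rep d (fst z) k)"
    by (rule continuous_map_unit_rep[where H = "\<lambda>a w. chart_part i a w j r * a k"])
       (intro continuous_map_real_mult continuous_map_chart_part continuous_map_coords, simp add: chart_part_minus)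
  then show "continuous_map ?P euclideanreal
      (\<lambda>z. glued_part (G.point i (fst z) (snd z)) j r * unit_rep d (proj G.E (G.point i (fst z) (snd z))) k)"
    by (rule continuous_map_eq) (use i j r in \<open>auto simp: glued_part_point G.proj_point_glued\<close>)
qed

text \<open>The vectors \<open>(u\<^sub>j)\<close> of sum zero go to \<open>(Q\<^sub>j u\<^sub>j)\<close>, and the vector with parameter \<open>u\<close> of the
  coordinate-deletion bundle goes to the weighted vectors \<open>m\<^sub>j Q\<^sub>j u\<close>. The product \<open>m\<^sub>j n\<^sub>j\<close> is the same for
  all \<open>j\<close>, which makes the second family orthogonal to the first one; the two fill the fibre also at
  the coordinate points, where just one of the \<open>Q\<^sub>j\<close> vanishes. All coefficients are odd in the unit representative \<open>\<mu>\<close>, so that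
  their products with \<open>\<mu>\<close> are vectors of the tautological bundle.\<close>

lemma deletion_bundle_sum_iso:
  assumes d: "d > 0"
  shows "bundle_iso (whitney_sum G.E (trivial_bundle (RP d) (d * d)))
    (bundle_power (RP d) (tautological_bundle d) (Suc d * d))"
proof -
  let ?W = "whitney_sum G.E (trivial_bundle (RP d) (d * d))"
    and ?P = "bundle_power (RP d) (tautological_bundle d) (Suc d * d)"
  let ?u = "unit_rep d"
  let ?b = "\<lambda>z. fst (snd z)"
  let ?F = "\<lambda>z. (?b z, \<lambda>m\<in>{..<Suc d * d}. (?b z, \<lambda>k. comparison z m * ?u (?b z) k))"
  have divmod: "m div d \<le> d" "m mod d < d" if "m < Suc d * d" for m
    using that d less_mult_imp_div_less[of m "Suc d" d] by auto
  have c: "continuous_map (tot ?W) (tot ?P) ?F"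
  proof (rule continuous_map_powerI)
    show b: "continuous_map (tot ?W) (RP d) ?b"
      by (rule continuous_map_from_whitney_snd) (simp add: continuous_map_fst)
    fix m assume m: "m < Suc d * d"
    have "continuous_map (tot ?W) (tot (tautological_bundle d)) (\<lambda>z. (?b z, \<lambda>k. comparison z m * ?u (?b z) k))"
    proof (rule continuous_map_tautologicalI[OF b])
      fix k
      let ?j = "m div d" and ?r = "m mod d"
      have "continuous_map (tot ?W) euclideanreal (\<lambda>z. glued_part (fst z) ?j ?r * ?u (proj G.E (fst z)) k)"
        by (rule continuous_map_from_whitney_fst[OF continuous_map_glued_part[OF divmod[OF m]]])
      then have 1: "continuous_map (tot ?W) euclideanreal (\<lambda>z. glued_part (fst z) ?j ?r * ?u (?b z) k)"
        by (rule continuous_map_eq) auto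
      \<comment> \<open>The whole space as a subspace of itself, to match \<open>continuous_map_unit_rep\<close>.\<close>
      have "continuous_map (prod_topology (subtopology (RP d) (topspace (RP d))) (Euclidean_space (d * d))) euclideanreal
          (\<lambda>y. ap ?j (?u (fst y)) (block d (snd y) ?j) ?r * ?u (fst y) k)"
        by (rule continuous_map_unit_rep[where H = "\<lambda>a \<kappa>. ap ?j a (block d \<kappa> ?j) ?r * a k"])
           (intro continuous_map_real_mult continuous_map_ap continuous_map_block continuous_map_coords, simp add: ap_minus)
      then have 2: "continuous_map (tot ?W) euclideanreal
          (\<lambda>z. ap ?j (?u (?b z)) (block d (snd (snd z)) ?j) ?r * ?u (?b z) k)"
        by (intro continuous_map_from_whitney_snd) simp
      show "continuous_map (tot ?W) euclideanreal (\<lambda>z. comparison z m * ?u (?b z) k)"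
        using continuous_map_add[OF 1 2] by (simp add: comparison_def distrib_right)
    qed
    then show "continuous_map (tot ?W) (tot (tautological_bundle d))
        (\<lambda>z. (\<lambda>m\<in>{..<Suc d * d}. (?b z, \<lambda>k. comparison z m * ?u (?b z) k)) m)"
      using m by simp
  qed auto
  have W: "vector_bundle (RP d) ?W"
    by (rule vector_bundle_whitney[OF G.vector_bundle_glued vector_bundle_trivial])
  have W_cases: "\<exists>i p w \<kappa>. z = (G.point i p w, (p, \<kappa>)) \<and> i \<le> d \<and> p \<in> chart_domain d i \<and> w \<in> Vec d \<and> \<kappa> \<in> Vec (d * d)"
    if "z \<in> topspace (tot ?W)" for z
  proof -
    have z: "fst z \<in> topspace (tot G.E)" "proj G.E (fst z) = fst (snd z)" "snd (snd z) \<in> Vec (d * d)"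
      using that by auto
    from z(1) obtain i p w where ipw: "i \<le> d" "p \<in> chart_domain d i" "w \<in> Vec d" "fst z = G.point i p w"
      by (auto simp: G.topspace_glued)
    then have "z = (G.point i p w, (p, snd (snd z)))"
      using z(2) by (simp add: prod_eq_iff G.proj_point_glued)
    then show ?thesis using ipw z(3) by blast
  qed
  have pf: "comparison (G.point i p w, (p, \<kappa>)) m =
      chart_part i (?u p) w (m div d) (m mod d) + ap (m div d) (?u p) (block d \<kappa> (m div d)) (m mod d)"
    if "i \<le> d" "p \<in> chart_domain d i" "w \<in> Vec d" "m < Suc d * d" for i p w \<kappa> m
    using that glued_part_point divmod[OF that(4)] by (simp add: comparison_def)
  \<comment> \<open>Componentwise linearity of the part of the map that comes from the trivial bundle.\<close>
  have blk_add: "ap j a (block d (\<lambda>k. v k + w k) j) r = ap j a (block d v j) r + ap j a (block d w j) r"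
    and blk_scale: "ap j a (block d (\<lambda>k. b * v k) j) r = b * ap j a (block d v j) r" for j a v w r b
    unfolding ap_add[symmetric] ap_scale[symmetric] by (rule ap_cong, simp add: block_add block_scale)+
  have "bundle_iso_map ?W ?P ?F"
  proof (rule injective_bundle_map_iso[OF W vector_bundle_power[OF vector_bundle_tautological]])
    fix x assume x: "x \<in> topspace (RP d)"
    show "bundle_rank ?W x = bundle_rank ?P x"
      using x by (simp add: bundle_rank_whitney[OF G.vector_bundle_glued vector_bundle_trivial] G.bundle_rank_glued
          bundle_rank_trivial bundle_rank_power[OF vector_bundle_tautological] bundle_rank_tautological)
  next
    show "bundle_map ?W ?P ?F"
      unfolding bundle_map_def
    proof (intro conjI ballI allI c)
      fix z assume z: "z \<in> topspace (tot ?W)"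
      obtain i p w \<kappa> where ipw: "z = (G.point i p w, (p, \<kappa>))" "i \<le> d" "p \<in> chart_domain d i" "w \<in> Vec d"
        using W_cases[OF z] by blast
      show "proj ?P (?F z) = proj ?W z"
        unfolding ipw(1) whitney_sum_simps bundle_power_simps fst_conv snd_conv prod.case
        using ipw by (simp add: G.proj_point_glued)
    next
      fix x z z' assume z: "z \<in> fibre ?W x" and z': "z' \<in> fibre ?W x"
      have zt: "z \<in> topspace (tot ?W)" using z by (simp only: in_fibre)
      obtain i p w \<kappa> where ipw: "z = (G.point i p w, (p, \<kappa>))" "i \<le> d" "p \<in> chart_domain d i" "w \<in> Vec d" "\<kappa> \<in> Vec (d * d)"
        using W_cases[OF zt] by blast
      have z'_mem: "fst z' \<in> fibre G.E x" "snd z' \<in> fibre (trivial_bundle (RP d) (d * d)) x"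
        and z_mem: "fst z \<in> fibre G.E x"
        using z z' by (simp_all only: fibre_whitney mem_Times_iff)
      have "proj G.E (fst z) = x" using z_mem by (simp only: in_fibre)
      then have px: "p = x" using ipw(1-4) by (simp add: G.proj_point_glued)
      have "fst z' \<in> fibre G.E p" using z'_mem(1) px by simp
      then obtain w' where w': "w' \<in> Vec d" "fst z' = G.point i p w'" using G.fibre_glued[of i p] ipw(2,3) by auto
      moreover obtain \<kappa>' where "snd z' = (p, \<kappa>')" "\<kappa>' \<in> Vec (d * d)"
        using z'_mem(2) px by (cases "snd z'") (simp add: in_fibre)
      ultimately have z'_eq: "z' = (G.point i p w', (p, \<kappa>'))" by (simp add: prod_eq_iff)
      have sum: "fib_add ?W z z' = (G.point i p (\<lambda>k. w k + w' k), (p, \<lambda>k. \<kappa> k + \<kappa>' k))"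
        using ipw w' by (simp add: z'_eq G.fib_add_glued)
      have cmp: "comparison (fib_add ?W z z') m = comparison z m + comparison z' m" if "m < Suc d * d" for m
        unfolding sum unfolding z'_eq ipw(1) using ipw w' that by (simp add: pf chart_part_add blk_add)
      have base: "?b (fib_add ?W z z') = p" "?b z = p" "?b z' = p"
        unfolding sum unfolding z'_eq ipw(1) by simp_all
      have "?F (fib_add ?W z z') = (p, \<lambda>m\<in>{..<Suc d * d}. (p, \<lambda>k. (comparison z m + comparison z' m) * ?u p k))"
        unfolding base by (rule arg_cong[where f = "Pair p"], rule restrict_ext) (simp only: cmp lessThan_iff)
      also have "\<dots> = fib_add ?P (?F z) (?F z')"
        unfolding base bundle_power_simps prod.case
        by (rule arg_cong[where f = "Pair p"], rule restrict_ext) (simp add: distrib_right)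
      finally show "?F (fib_add ?W z z') = fib_add ?P (?F z) (?F z')" .
    next
      fix b z assume z: "z \<in> topspace (tot ?W)"
      obtain i p w \<kappa> where ipw: "z = (G.point i p w, (p, \<kappa>))" "i \<le> d" "p \<in> chart_domain d i" "w \<in> Vec d" "\<kappa> \<in> Vec (d * d)"
        using W_cases[OF z] by blast
      have sc: "fib_scale ?W b z = (G.point i p (\<lambda>k. b * w k), (p, \<lambda>k. b * \<kappa> k))"
        using ipw by (simp add: G.fib_scale_glued)
      have cmp: "comparison (fib_scale ?W b z) m = b * comparison z m" if "m < Suc d * d" for m
        unfolding sc unfolding ipw(1) using ipw that by (simp add: pf chart_part_scale blk_scale distrib_left)
      have base: "?b (fib_scale ?W b z) = p" "?b z = p"
        unfolding sc unfolding ipw(1) by simp_all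
      have "?F (fib_scale ?W b z) = (p, \<lambda>m\<in>{..<Suc d * d}. (p, \<lambda>k. b * comparison z m * ?u p k))"
        unfolding base by (rule arg_cong[where f = "Pair p"], rule restrict_ext) (simp only: cmp lessThan_iff)
      also have "\<dots> = fib_scale ?P b (?F z)"
        unfolding base bundle_power_simps prod.case
        by (rule arg_cong[where f = "Pair p"], rule restrict_ext) (simp add: mult.assoc)
      finally show "?F (fib_scale ?W b z) = fib_scale ?P b (?F z)" .
    qed
  next
    \<comment> \<open>A vector in the kernel; one nonzero coordinate of the unit representative, the \<open>i\<close>-th one,
      suffices to read off the scalars.\<close>
    fix z assume z: "z \<in> topspace (tot ?W)" and eq: "?F z = fib_scale ?P 0 (?F z)"
    obtain i p w \<kappa> where ipw: "z = (G.point i p w, (p, \<kappa>))" "i \<le> d" "p \<in> chart_domain d i" "w \<in> Vec d" "\<kappa> \<in> Vec (d * d)"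
      using W_cases[OF z] by blast
    have p: "p \<in> topspace (RP d)" "?u p i \<noteq> 0" using ipw(3) by (auto simp: chart_domain_iff)
    have comp0: "comparison z m = 0" if m: "m < Suc d * d" for m
    proof -
      have "snd (snd (?F z) m) i = snd (snd (fib_scale ?P 0 (?F z)) m) i"
        by (rule arg_cong[OF eq, of "\<lambda>y. snd (snd y m) i"])
      then have "comparison z m * ?u p i = 0" using m by (simp add: ipw(1))
      then show ?thesis using p by simp
    qed
    have zero: "chart_part i (?u p) w j r + ap j (?u p) (block d \<kappa> j) r = 0" if j: "j \<le> d" and r: "r < d" for j r
    proof -
      have "j * d + r < Suc j * d" using r by simp
      also have "\<dots> \<le> Suc d * d" using j by (intro mult_right_mono) auto
      finally have m: "j * d + r < Suc d * d" .
      then show ?thesis using comp0[OF m] pf[OF ipw(2-4) m, of \<kappa>] r by (simp add: ipw(1))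
    qed
    have "w s = 0" if "s < d" for s
      using chart_part_injective(1)[OF ipw(2) p(2) block_sum zero that] .
    then have w: "w = (\<lambda>_. 0)" using ipw(4) by (metis Vec_iff not_le)
    have "block d \<kappa> j s = 0" if "j \<le> d" "s < d" for j s
      using chart_part_injective(2)[OF ipw(2) p(2) block_sum zero that] .
    then have "\<kappa> = (\<lambda>_. 0)" using block_injective[OF ipw(5)] by blast
    then show "z = fib_scale ?W 0 z"
      using ipw by (simp add: w G.fib_scale_glued)
  qed
  then show ?thesis by (auto simp: bundle_iso_iff)
qed

text \<open>Of the \<open>d\<^sup>2 + d\<close> copies of the tautological bundle in the preceding lemma, \<open>d\<^sup>2 = 2d \<cdot> (d / 2)\<close> form
  a trivial bundle of rank \<open>d\<^sup>2\<close>.\<close>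

lemma deletion_bundle_stable:
  assumes d: "d > 0" "even d"
  shows "stably_isomorphic (RP d) G.E (bundle_power (RP d) (tautological_bundle d) d)"
proof -
  let ?X = "RP d" and ?t = "\<lambda>k. iso_class (RP d) (trivial_bundle (RP d) k)"
  let ?V = "Vect ?X" and ?g = "iso_class (RP d) (tautological_bundle d)"
  interpret V: comm_monoid ?V by (rule Vect_comm_monoid)
  note T = vector_bundle_tautological and P = vector_bundle_power[OF vector_bundle_tautological]
  have g: "?g \<in> carrier ?V" by (rule iso_class_carrier[OF T])
  have trivial: "?g [^]\<^bsub>?V\<^esub> (2 * d) = ?t (2 * d)"
    using iso_class_eq_iff[OF vector_bundle_trivial P] tautological_power_trivial iso_class_power[OF T] by metis
  have dd: "d * d = 2 * d * (d div 2)" using d by auto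
  have "iso_class ?X G.E \<otimes>\<^bsub>?V\<^esub> ?t (d * d)
      = iso_class ?X (whitney_sum G.E (trivial_bundle ?X (d * d)))"
    by (rule Vect_mult[OF G.vector_bundle_glued vector_bundle_trivial])
  also have "\<dots> = iso_class ?X (bundle_power ?X (tautological_bundle d) (Suc d * d))"
    using iso_class_eq_iff[OF vector_bundle_whitney[OF G.vector_bundle_glued vector_bundle_trivial] P]
      deletion_bundle_sum_iso[OF d(1)] by blast
  also have "\<dots> = ?g [^]\<^bsub>?V\<^esub> (d + d * d)" by (simp add: iso_class_power[OF T])
  also have "\<dots> = ?g [^]\<^bsub>?V\<^esub> d \<otimes>\<^bsub>?V\<^esub> ?g [^]\<^bsub>?V\<^esub> (2 * d * (d div 2))"
    unfolding dd by (rule V.nat_pow_mult[OF g, symmetric])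
  also have "?g [^]\<^bsub>?V\<^esub> (2 * d * (d div 2)) = ?t (2 * d) [^]\<^bsub>?V\<^esub> (d div 2)"
    using V.nat_pow_pow[OF g, of "2 * d" "d div 2"] trivial by simp
  also have "\<dots> = ?t (d * d)" unfolding dd by (rule iso_class_trivial_power[symmetric])
  also have "?g [^]\<^bsub>?V\<^esub> d = iso_class ?X (bundle_power ?X (tautological_bundle d) d)"
    by (rule iso_class_power[OF T, symmetric])
  finally show ?thesis
    using stably_isomorphic_iff_Vect[OF G.vector_bundle_glued P] by blast
qed

end


section \<open>The class of the coordinate-deletion bundle\<close>

theorem theorem6p2:
  fixes mul :: "'a::real_vector \<Rightarrow> 'a \<Rightarrow> 'a"
    and unt :: 'a
    and N :: "'a \<Rightarrow> real"
    and e :: "nat \<Rightarrow> 'a"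
    and d :: nat
    and x0 :: "(nat \<Rightarrow> real) set"
  assumes "composition_division_algebra mul unt N"
    and "dim (UNIV :: 'a set) = d"
    and "d \<in> {2, 4, 8}"
    and "orthonormal_basis N d e"
    and "x0 \<in> topspace (RP d)"
  shows "let X = RP d;
             E = coordinate_deletion_bundle mul e d;
             \<gamma> = tautological_bundle d;
             \<eta> = KO_diff X \<gamma> (trivial_bundle X 1);
             KO' = reduced_KO X x0
         in \<eta> \<in> carrier KO' \<and>
            KO_diff X E (trivial_bundle X d) \<in> carrier KO' \<and>
            KO_diff X E (trivial_bundle X d) = \<eta> [^]\<^bsub>KO'\<^esub> d \<and>
            KO_diff X E (trivial_bundle X d) =
              KO_diff X (bundle_power X \<gamma> d) (trivial_bundle X d) \<and>
            stably_isomorphic X E (bundle_power X \<gamma> d)"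
proof -
  interpret composition_division_algebra mul unt N by fact
  interpret based_composition_algebra mul unt N e d by unfold_locales fact
  let ?X = "RP d" and ?\<gamma> = "tautological_bundle d" and ?E = "coordinate_deletion_bundle mul e d"
  have d: "d > 0" "even d" using assms(3) by auto
  note T = vector_bundle_tautological[of d] and tr = vector_bundle_trivial[of ?X]
  note P = vector_bundle_power[OF T, of d]
  have E: "vector_bundle ?X ?E" unfolding coordinate_deletion_bundle_eq by (rule G.vector_bundle_glued)
  have stable: "stably_isomorphic ?X ?E (bundle_power ?X ?\<gamma> d)"
    unfolding coordinate_deletion_bundle_eq by (rule deletion_bundle_stable[OF d])
  have \<eta>: "KO_diff ?X ?\<gamma> (trivial_bundle ?X 1) \<in> carrier (reduced_KO ?X x0)"
    by (rule KO_diff_reduced[OF T tr assms(5)])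
      (simp add: bundle_rank_tautological[OF assms(5)] bundle_rank_trivial[OF assms(5)])
  have E_in: "KO_diff ?X ?E (trivial_bundle ?X d) \<in> carrier (reduced_KO ?X x0)"
    by (rule KO_diff_reduced[OF E tr assms(5)])
      (simp add: coordinate_deletion_bundle_eq G.bundle_rank_glued[OF assms(5)] bundle_rank_trivial[OF assms(5)])
  have eq: "KO_diff ?X ?E (trivial_bundle ?X d) = KO_diff ?X (bundle_power ?X ?\<gamma> d) (trivial_bundle ?X d)"
    by (rule stably_isomorphic_KO_diff[OF E P tr stable])
  have "iso_class ?X (bundle_power ?X (trivial_bundle ?X 1) d) = iso_class ?X (trivial_bundle ?X d)"
    using iso_class_power[OF tr, of 1 d] iso_class_trivial_power[of ?X 1 d] by simp
  then have iso: "bundle_iso (bundle_power ?X (trivial_bundle ?X 1) d) (trivial_bundle ?X d)"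
    using iso_class_eq_iff[OF vector_bundle_power[OF tr] tr] by blast
  have "KO_diff ?X ?\<gamma> (trivial_bundle ?X 1) [^]\<^bsub>reduced_KO ?X x0\<^esub> d
      = KO_diff ?X (bundle_power ?X ?\<gamma> d) (bundle_power ?X (trivial_bundle ?X 1) d)"
    by (simp only: reduced_KO_pow KO_diff_power[OF T tr])
  also have "\<dots> = KO_diff ?X (bundle_power ?X ?\<gamma> d) (trivial_bundle ?X d)"
    by (rule KO_diff_cong_iso[OF P vector_bundle_power[OF tr] tr iso])
  finally show ?thesis
    using \<eta> E_in eq stable by (simp add: Let_def)
qed


end
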